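(* It is undecidable to determine whether the $\omega$-language of a given real-time 1-blind-counter Büchi automaton is Borel. Likewise, for a given (non-null countable) ordinal $\alpha$, it is undecidable to determine whether the $\omega$-language of a given real-time 1-blind-counter Büchi automaton is in the Borel class $\mathbf{\Sigma}^0_\alpha$, and undecidable whether it is in the Borel class $\mathbf{\Pi}^0_\alpha$.
   Context: A real-time 1-blind-counter Büchi automaton is a finite-state automaton over a finite alphabet reading one letter per step, whose transitions add $-1,0,+1$ to one non-negative integer counter (a run blocks if the counter would become negative) but never test it for zero; runs start with counter $0$ and an $\omega$-word is accepted if some run visits an accepting state infinitely often. Borel classes refer to the Cantor topology on $\Sigma^\omega$. *)

theory Defs
  imports "HOL-Analysis.Analysis" "HOL-Library.Nat_Bijection"
begin

datatype recf = Z | S | Proj nat | Comp recf "recf list" | Prim recf recf | Mn recf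

inductive rec_eval :: "recf \<Rightarrow> nat list \<Rightarrow> nat \<Rightarrow> bool" where
  zero: "rec_eval Z xs 0"
| succ: "rec_eval S (x # xs) (Suc x)"
| proj: "i < length xs \<Longrightarrow> rec_eval (Proj i) xs (xs ! i)"
| comp: "length ys = length gs \<Longrightarrow> (\<forall>i<length gs. rec_eval (gs ! i) xs (ys ! i))
           \<Longrightarrow> rec_eval f ys z \<Longrightarrow> rec_eval (Comp f gs) xs z"
| prim0: "rec_eval f xs y \<Longrightarrow> rec_eval (Prim f g) (0 # xs) y"
| primS: "rec_eval (Prim f g) (n # xs) y \<Longrightarrow> rec_eval g (y # n # xs) z
           \<Longrightarrow> rec_eval (Prim f g) (Suc n # xs) z"
| mu: "rec_eval f (n # xs) 0 \<Longrightarrow> (\<forall>m<n. \<exists>y. rec_eval f (m # xs) (Suc y))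
           \<Longrightarrow> rec_eval (Mn f) xs n"

datatype cop = Dec | Keep | Inc

fun cop_delta :: "cop \<Rightarrow> int" where
  "cop_delta Dec = -1" | "cop_delta Keep = 0" | "cop_delta Inc = 1"

fun cop_code :: "cop \<Rightarrow> nat" where
  "cop_code Dec = 0" | "cop_code Keep = 1" | "cop_code Inc = 2"

text \<open>Alphabet is {0..<alph}; states are natural numbers (only finitely many occur);
  a transition (p, a, d, q) reads letter a in state p, adds delta d to the counter and
  goes to state q.\<close>
record bca =
  alph :: nat
  trans :: "(nat \<times> nat \<times> cop \<times> nat) list"
  init :: nat
  acc :: "nat list"

definition bca_run :: "bca \<Rightarrow> (nat \<Rightarrow> nat) \<Rightarrow> (nat \<Rightarrow> nat \<times> nat) \<Rightarrow> bool" where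
  "bca_run M x \<rho> \<longleftrightarrow> \<rho> 0 = (init M, 0) \<and>
     (\<forall>i. \<exists>p a d q. (p, a, d, q) \<in> set (trans M) \<and> p = fst (\<rho> i) \<and> a = x i \<and>
          q = fst (\<rho> (Suc i)) \<and> int (snd (\<rho> (Suc i))) = int (snd (\<rho> i)) + cop_delta d)"

definition bca_lang :: "bca \<Rightarrow> (nat \<Rightarrow> nat) set" where
  "bca_lang M = {x. (\<forall>i. x i < alph M) \<and>
     (\<exists>\<rho>. bca_run M x \<rho> \<and> infinite {i. fst (\<rho> i) \<in> set (acc M)})}"

definition bca_enc :: "bca \<Rightarrow> nat" where
  "bca_enc M = list_encode [alph M, init M, list_encode (acc M),
     list_encode (map (\<lambda>(p, a, d, q). list_encode [p, a, cop_code d, q]) (trans M))]"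

definition decidable_bca :: "(bca \<Rightarrow> bool) \<Rightarrow> bool" where
  "decidable_bca P \<longleftrightarrow> (\<exists>f. \<forall>M. rec_eval f [bca_enc M] (if P M then 1 else 0))"

definition cantor :: "nat \<Rightarrow> (nat \<Rightarrow> nat) topology" where
  "cantor k = product_topology (\<lambda>_. discrete_topology {..<k}) UNIV"

text \<open>A countable nonzero ordinal alpha is represented by a well-order r on a nonempty
  subset of nat; Sigma^0_1 = open; for alpha \<ge> 2, Sigma^0_alpha = countable unions of
  sets in Pi^0_beta, 1 \<le> beta < alpha (beta = order type of a proper nonempty initial
  segment underS r a).\<close>
inductive Sigma0_class :: "'a topology \<Rightarrow> nat rel \<Rightarrow> 'a set \<Rightarrow> bool" for X where
  base: "Well_order r \<Longrightarrow> Field r = {a} \<Longrightarrow> openin X A \<Longrightarrow> Sigma0_class X r A"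
| step: "Well_order r \<Longrightarrow> Field r \<noteq> {} \<Longrightarrow> \<not> (\<exists>a. Field r = {a}) \<Longrightarrow>
     (\<forall>n::nat. B n \<subseteq> topspace X \<and> (\<exists>a\<in>Field r. underS r a \<noteq> {} \<and>
            Sigma0_class X (Restr r (underS r a)) (topspace X - B n))) \<Longrightarrow>
     A = (\<Union>n. B n) \<Longrightarrow> Sigma0_class X r A"

definition Pi0_class :: "'a topology \<Rightarrow> nat rel \<Rightarrow> 'a set \<Rightarrow> bool" where
  "Pi0_class X r A \<longleftrightarrow> A \<subseteq> topspace X \<and> Sigma0_class X r (topspace X - A)"

definition borel_in :: "'a topology \<Rightarrow> 'a set \<Rightarrow> bool" where
  "borel_in X A \<longleftrightarrow> A \<in> sigma_sets (topspace X) {U. openin X U}"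

end

(*
  A real-time counter automaton cannot test for zero, but a Buechi condition lets it verify that
  infinitely many inequalities between unary blocks fail: each check has net effect >= 0 on the
  counter exactly when there is an error, and < 0 otherwise, so that infinitely many checks of an
  error-free word exhaust the counter.

  For a counter program c with input k, consider words that are sequences of phases, phase n being
  meant to spell the first n register contents of the computation.  If the program halts, then
  in every word with infinitely many phases, either infinitely often a phase is not longer than its
  predecessor, or there are arbitrarily long phases, and these contain an error at one of the
  finitely many blocks before the halt, where a fixed counter value suffices to expose it.  So the
  automaton accepts everything.  If the program does not halt, the words without errors are rejected
  by this part of the automaton.  The markers that separate the phases carry one bit each, and the
  bits describe a linear order on nat, element i being given by its rank r among 0, ..., i - 1 as
  0^r 1 0^(r+1) 1.  A second part of the automaton keeps the rank of an element of the order in its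
  counter and accepts iff the order has an infinite descending chain.  (Ranks can only be compared
  in one direction, but ill-foundedness below an element is monotone in the element.)  Through the
  Kleene-Brouwer order, ill-foundedness of trees reduces continuously to the accepted language, which
  is therefore not Borel.

  Given a decision procedure f, the program c computes f on the code of the automaton belonging to c
  itself, and halts iff the answer is negative.  Only the part of the automaton that compares the
  first block with the input k depends on k.  Taking for k the code of the remaining transitions
  makes the code of the whole automaton computable from k alone, so that the translation of recursive
  functions to programs and automata need not itself be computed.
*)
theory Submission
  imports Defs
begin

section \<open>Borel sets are analytic\<close>

abbreviation pref :: "(nat \<Rightarrow> 'a) \<Rightarrow> nat \<Rightarrow> 'a list" where
  "pref x n \<equiv> map x [0..<n]"

lemma take_pref: "l \<le> n \<Longrightarrow> take l (pref x n) = pref x l"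
  by (simp add: take_map)

lemma pref_eq_iff: "pref x n = pref y n \<longleftrightarrow> (\<forall>i<n. x i = y i)"
  by auto

text \<open>Projections of closed sets, a closed set being given by a predicate on pairs of finite prefixes.\<close>
definition analytic :: "(nat \<Rightarrow> nat) set \<Rightarrow> bool" where
  "analytic A \<longleftrightarrow> (\<exists>Y. A = {x. \<exists>z::nat \<Rightarrow> nat. \<forall>n. Y (pref x n) (pref z n)})"

lemma analyticI:
  assumes "\<And>x. x \<in> A \<longleftrightarrow> (\<exists>z::nat \<Rightarrow> nat. \<forall>n. Y (pref x n) (pref z n))"
  shows "analytic A"
  unfolding analytic_def using assms by blast

lemma analytic_Union:
  assumes "\<And>i::nat. analytic (A i)"
  shows "analytic (\<Union>i. A i)"
proof -
  have "\<forall>i. \<exists>Y. A i = {x. \<exists>z::nat \<Rightarrow> nat. \<forall>n. Y (pref x n) (pref z n)}"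
    using assms unfolding analytic_def by blast
  from choice[OF this] obtain Y where
    "\<And>i. A i = {x. \<exists>z::nat \<Rightarrow> nat. \<forall>n. Y i (pref x n) (pref z n)}" by blast
  then have Y: "\<And>i x. x \<in> A i \<longleftrightarrow> (\<exists>z::nat \<Rightarrow> nat. \<forall>n. Y i (pref x n) (pref z n))"
    by blast
  \<comment> \<open>The first entry of the witness names the index i, and \<open>butlast\<close>
    makes up for the resulting shift by one.\<close>
  let ?Y = "\<lambda>s t. t = [] \<or> Y (hd t) (butlast s) (tl t)"
  show ?thesis
  proof (rule analyticI[where Y = ?Y])
    fix x
    show "x \<in> (\<Union>i. A i) \<longleftrightarrow> (\<exists>z. \<forall>n. ?Y (pref x n) (pref z n))"
    proof
      assume "x \<in> (\<Union>i. A i)"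
      then obtain i z where z: "\<forall>n. Y i (pref x n) (pref z n)" using Y by blast
      define z' where "z' = case_nat i z"
      have "?Y (pref x n) (pref z' n)" for n
      proof (cases n)
        case (Suc m)
        have "pref z' (Suc m) = i # pref z m"
          by (simp only: upt_conv_Cons[OF zero_less_Suc] map_Suc_upt[symmetric] list.map map_map)
             (simp add: z'_def comp_def)
        then show ?thesis using z Suc by simp
      qed simp
      then show "\<exists>z. \<forall>n. ?Y (pref x n) (pref z n)" by blast
    next
      assume "\<exists>z. \<forall>n. ?Y (pref x n) (pref z n)"
      then obtain z where z: "\<And>n. ?Y (pref x n) (pref z n)" by blast
      have "Y (z 0) (pref x n) (pref (z \<circ> Suc) n)" for n
      proof -
        have "pref z (Suc n) = z 0 # pref (z \<circ> Suc) n"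
          by (simp only: upt_conv_Cons[OF zero_less_Suc] map_Suc_upt[symmetric] list.map map_map)
        then show ?thesis using z[of "Suc n"] by simp
      qed
      then show "x \<in> (\<Union>i. A i)" using Y by blast
    qed
  qed
qed

lemma analytic_Inter:
  assumes "\<And>i::nat. analytic (A i)"
  shows "analytic (\<Inter>i. A i)"
proof -
  have "\<forall>i. \<exists>Y. A i = {x. \<exists>z::nat \<Rightarrow> nat. \<forall>n. Y (pref x n) (pref z n)}"
    using assms unfolding analytic_def by blast
  from choice[OF this] obtain Y where
    "\<And>i. A i = {x. \<exists>z::nat \<Rightarrow> nat. \<forall>n. Y i (pref x n) (pref z n)}" by blast
  then have Y: "\<And>i x. x \<in> A i \<longleftrightarrow> (\<exists>z::nat \<Rightarrow> nat. \<forall>n. Y i (pref x n) (pref z n))"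
    by blast
  \<comment> \<open>One witness carries those of all the sets, the i-th one along the positions
    \<open>prod_encode (i, k)\<close>. A prefix t of it is tested at every length l for which the
    required entries already lie in t.\<close>
  let ?Y = "\<lambda>s t. \<forall>i l. l \<le> length s \<and> (\<forall>k<l. prod_encode (i, k) < length t)
     \<longrightarrow> Y i (take l s) (map (\<lambda>k. t ! prod_encode (i, k)) [0..<l])"
  show ?thesis
  proof (rule analyticI[where Y = ?Y])
    fix x
    show "x \<in> (\<Inter>i. A i) \<longleftrightarrow> (\<exists>z. \<forall>n. ?Y (pref x n) (pref z n))"
    proof
      assume "x \<in> (\<Inter>i. A i)"
      then have "\<forall>i. \<exists>z. \<forall>n. Y i (pref x n) (pref z n)" using Y by blast
      then obtain z where z: "\<And>i n. Y i (pref x n) (pref (z i) n)" by metis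
      define z' where "z' m = (case prod_decode m of (i, k) \<Rightarrow> z i k)" for m
      have "?Y (pref x n) (pref z' n)" for n
      proof (intro allI impI)
        fix i l assume l: "l \<le> length (pref x n) \<and> (\<forall>k<l. prod_encode (i, k) < length (pref z' n))"
        then have eq: "map (\<lambda>k. pref z' n ! prod_encode (i, k)) [0..<l] = pref (z i) l"
          by (simp add: z'_def)
        then show "Y i (take l (pref x n)) (map (\<lambda>k. pref z' n ! prod_encode (i, k)) [0..<l])"
          unfolding eq using z l by (simp add: take_pref)
      qed
      then show "\<exists>z. \<forall>n. ?Y (pref x n) (pref z n)" by blast
    next
      assume "\<exists>z. \<forall>n. ?Y (pref x n) (pref z n)"
      then obtain z where z: "\<And>n. ?Y (pref x n) (pref z n)" by blast
      have "Y i (pref x l) (pref (\<lambda>k. z (prod_encode (i, k))) l)" for i l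
      proof -
        define n where "n = Suc (l + (\<Sum>k<l. prod_encode (i, k)))"
        have k: "prod_encode (i, k) < n" if "k < l" for k
          using member_le_sum[of k "{..<l}" "\<lambda>k. prod_encode (i, k)"] that by (simp add: n_def)
        have "l \<le> n" by (simp add: n_def)
        have eq: "map (\<lambda>k. pref z n ! prod_encode (i, k)) [0..<l] = pref (\<lambda>k. z (prod_encode (i, k))) l"
          using k by simp
        show ?thesis
          using z[of n, rule_format, of l i] k \<open>l \<le> n\<close> unfolding eq by (simp add: take_pref)
      qed
      then show "x \<in> (\<Inter>i. A i)" using Y by blast
    qed
  qed
qed

lemma open_cylinder: "open {y::nat \<Rightarrow> nat. \<forall>i<n. y i = x i}"
proof -
  have "{y. \<forall>i<n. y i = x i} = (\<Inter>i\<in>{..<n}. (\<lambda>y. y i) -` {x i})" by auto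
  moreover have "open ((\<lambda>y::nat\<Rightarrow>nat. y i) -` {x i})" for i
    by (rule open_vimage) (auto intro: open_discrete continuous_on_product_coordinates)
  ultimately show ?thesis by auto
qed

lemma open_iff_cylinder:
  "open (U :: (nat \<Rightarrow> nat) set) \<longleftrightarrow> (\<forall>x\<in>U. \<exists>n. \<forall>y. (\<forall>i<n. y i = x i) \<longrightarrow> y \<in> U)"
proof
  assume U: "open U"
  show "\<forall>x\<in>U. \<exists>n. \<forall>y. (\<forall>i<n. y i = x i) \<longrightarrow> y \<in> U"
  proof
    fix x assume "x \<in> U"
    have "openin (product_topology (\<lambda>_::nat. euclidean :: nat topology) UNIV) U"
      using U by (simp only: open_fun_def)
    from product_topology_open_contains_basis[OF this \<open>x \<in> U\<close>]
    obtain X where X: "x \<in> PiE UNIV X" "finite {i. X i \<noteq> UNIV}" "PiE UNIV X \<subseteq> U"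
      by (auto simp only: topspace_euclidean)
    obtain n where n: "\<And>i. X i \<noteq> UNIV \<Longrightarrow> i < n"
      using X(2) unfolding finite_nat_set_iff_bounded by auto
    have "y \<in> U" if "\<forall>i<n. y i = x i" for y
    proof -
      have "y i \<in> X i" for i using n[of i] that X(1) by (cases "X i = UNIV") (auto simp: PiE_iff)
      then show ?thesis using X(3) by (auto simp: PiE_iff)
    qed
    then show "\<exists>n. \<forall>y. (\<forall>i<n. y i = x i) \<longrightarrow> y \<in> U" by blast
  qed
next
  assume *: "\<forall>x\<in>U. \<exists>n. \<forall>y. (\<forall>i<n. y i = x i) \<longrightarrow> y \<in> U"
  show "open U"
  proof (subst open_subopen, intro ballI)
    fix x assume "x \<in> U"
    then obtain n where "\<forall>y. (\<forall>i<n. y i = x i) \<longrightarrow> y \<in> U" using * by blast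
    then show "\<exists>T. open T \<and> x \<in> T \<and> T \<subseteq> U"
      by (intro exI[of _ "{y. \<forall>i<n. y i = x i}"]) (auto simp: open_cylinder)
  qed
qed

text \<open>Membership in a closed set is a condition on the prefixes of x alone: each must extend
  to some point of the set.\<close>

lemma analytic_closed:
  assumes "open (- C)" shows "analytic C"
proof (rule analyticI[where Y = "\<lambda>s t. \<exists>x\<in>C. pref x (length s) = s"])
  fix x
  show "x \<in> C \<longleftrightarrow> (\<exists>z. \<forall>n. \<exists>y\<in>C. pref y (length (pref x n)) = pref x n)"
  proof
    assume "\<exists>z. \<forall>n. \<exists>y\<in>C. pref y (length (pref x n)) = pref x n"
    then have *: "\<forall>n. \<exists>y\<in>C. \<forall>i<n. y i = x i" by (simp add: pref_eq_iff del: map_eq_conv)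
    show "x \<in> C"
    proof (rule ccontr)
      assume "x \<notin> C"
      then obtain n where "\<forall>y. (\<forall>i<n. y i = x i) \<longrightarrow> y \<in> - C" using assms open_iff_cylinder by blast
      then show False using * by blast
    qed
  qed auto
qed

text \<open>The cylinders contained in U are clopen and indexed by codes of finite sequences, so U
  is a countable union of closed sets.\<close>

lemma analytic_open:
  assumes "open U" shows "analytic U"
proof -
  let ?A = "\<lambda>m. {x. pref x (length (list_decode m)) = list_decode m \<and>
     (\<forall>y. pref y (length (list_decode m)) = list_decode m \<longrightarrow> y \<in> U)}"
  have A: "analytic (?A m)" for m
  proof (rule analytic_closed, subst open_iff_cylinder, intro ballI)
    fix x assume x: "x \<in> - ?A m"
    have "y \<in> - ?A m" if "\<forall>i<length (list_decode m). y i = x i" for y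
      using x pref_eq_iff[of y "length (list_decode m)" x] that by (simp del: map_eq_conv)
    then show "\<exists>n. \<forall>y. (\<forall>i<n. y i = x i) \<longrightarrow> y \<in> - ?A m" by blast
  qed
  have U: "U = (\<Union>m. ?A m)"
  proof
    show "U \<subseteq> (\<Union>m. ?A m)"
    proof
      fix x assume "x \<in> U"
      then obtain n where "\<forall>y. (\<forall>i<n. y i = x i) \<longrightarrow> y \<in> U" using assms open_iff_cylinder by blast
      then have "x \<in> ?A (list_encode (pref x n))" by (simp add: pref_eq_iff)
      then show "x \<in> (\<Union>m. ?A m)" by blast
    qed
  qed auto
  show ?thesis by (subst U) (rule analytic_Union, rule A)
qed

text \<open>Set and complement share one induction because analytic sets are not closed under
  complement.\<close>

lemma borel_analytic:
  assumes "A \<in> sigma_sets UNIV {U. open U}"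
  shows "analytic A" "analytic (- A)"
proof -
  have "analytic A \<and> analytic (- A)" using assms
  proof induction
    case (Basic a) then show ?case by (auto intro: analytic_open analytic_closed)
  next
    case Empty show ?case by (auto intro: analytic_open)
  next
    case (Compl a) then show ?case by (simp add: Compl_eq_Diff_UNIV[symmetric])
  next
    case (Union a) then show ?case by (auto simp: Compl_UN intro: analytic_Union analytic_Inter)
  qed
  then show "analytic A" "analytic (- A)" by auto
qed

section \<open>A set that is not Borel, by diagonalisation\<close>

definition pair_code :: "nat list \<Rightarrow> nat list \<Rightarrow> nat" where
  "pair_code s t = prod_encode (list_encode s, list_encode t)"

text \<open>The sections of a universal analytic set, evaluated on the diagonal.\<close>
definition diag_tree :: "(nat \<Rightarrow> nat) \<Rightarrow> nat list set" where
  "diag_tree x = {t. \<forall>l\<le>length t. x (pair_code (pref x l) (take l t)) = 0}"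

text \<open>Cantor's diagonal: if Y described the complement as an analytic set, its characteristic
  function y (with 0 for true) would lie in the set iff it lies in the complement.\<close>

lemma ill_founded_diag_not_borel:
  "{x. \<exists>z. \<forall>n. pref z n \<in> diag_tree x} \<notin> sigma_sets UNIV {U. open U}" (is "?D \<notin> _")
proof
  assume "?D \<in> sigma_sets UNIV {U. open U}"
  then have "analytic (- ?D)" by (rule borel_analytic)
  then obtain Y where Y: "- ?D = {x. \<exists>z::nat \<Rightarrow> nat. \<forall>n. Y (pref x n) (pref z n)}"
    unfolding analytic_def by blast
  define y :: "nat \<Rightarrow> nat" where
    "y m = (case prod_decode m of (a, b) \<Rightarrow> if Y (list_decode a) (list_decode b) then 0 else 1)" for m
  have "y (pair_code s t) = 0 \<longleftrightarrow> Y s t" for s t by (simp add: y_def pair_code_def)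
  then have "y \<in> ?D \<longleftrightarrow> (\<exists>z. \<forall>n. \<forall>l\<le>n. Y (pref y l) (pref z l))"
    by (simp add: diag_tree_def take_pref)
  also have "\<dots> \<longleftrightarrow> (\<exists>z. \<forall>n. Y (pref y n) (pref z n))" by auto
  also have "\<dots> \<longleftrightarrow> y \<in> - ?D" unfolding Y by simp
  finally show False by blast
qed

section \<open>Borel classes and continuous preimages\<close>

lemma Sigma0_class_trivial:
  assumes r: "Well_order r" "Field r \<noteq> {}"
    and A: "openin X A" "openin X (topspace X - A)" "A \<subseteq> topspace X"
  shows "Sigma0_class X r A"
proof (cases "\<exists>a. Field r = {a}")
  case True
  then show ?thesis using r A by (auto intro: Sigma0_class.base)
next
  case False
  have wr: "wo_rel r" using r by (simp add: wo_rel_def)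
  define m where "m = wo_rel.minim r (Field r)"
  have m: "m \<in> Field r" "\<And>b. b \<in> Field r \<Longrightarrow> (m, b) \<in> r"
    using wo_rel.minim_in[OF wr, of "Field r"] wo_rel.minim_least[OF wr, of "Field r"] r by (auto simp: m_def)
  \<comment> \<open>The second smallest element of the field: its strict predecessors form the
    singleton \<open>{m}\<close>, which represents level 1. At that level the complement of A is
    open, and A is the union of the constant sequence A.\<close>
  define a where "a = wo_rel.minim r (Field r - {m})"
  have ne: "Field r - {m} \<noteq> {}" using False m(1) by auto
  have a: "a \<in> Field r" "a \<noteq> m" "\<And>b. b \<in> Field r \<Longrightarrow> b \<noteq> m \<Longrightarrow> (a, b) \<in> r"
    using wo_rel.minim_in[OF wr, of "Field r - {m}"] wo_rel.minim_least[OF wr, of "Field r - {m}"] ne by (auto simp: a_def)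
  have u: "underS r a = {m}"
  proof
    show "underS r a \<subseteq> {m}"
    proof
      fix b assume "b \<in> underS r a"
      then have b: "b \<noteq> a" "(b, a) \<in> r" by (auto simp: underS_def)
      then have "b \<in> Field r" by (auto simp: Field_def)
      then show "b \<in> {m}" using a(3) b wo_rel.ANTISYM[OF wr] by (auto dest: antisymD)
    qed
    show "{m} \<subseteq> underS r a" using m a by (auto simp: underS_def)
  qed
  have F: "Field (Restr r (underS r a)) = {m}" using m(1) m(2)[OF m(1)] unfolding u by (auto simp: Field_def)
  have "Well_order (Restr r (underS r a))" using r(1) by (rule Well_order_Restr)
  then have "Sigma0_class X (Restr r (underS r a)) (topspace X - A)"
    using F A by (auto intro: Sigma0_class.base)
  then have "\<exists>a\<in>Field r. underS r a \<noteq> {} \<and> Sigma0_class X (Restr r (underS r a)) (topspace X - A)"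
    using a(1) u by blast
  then show ?thesis
    using r False A by (intro Sigma0_class.step[where B = "\<lambda>_. A"]) simp_all
qed

lemma borel_in_Compl:
  assumes "borel_in X A" shows "borel_in X (topspace X - A)"
  using assms unfolding borel_in_def by (rule sigma_sets.Compl)

lemma borel_in_Compl_iff:
  assumes "A \<subseteq> topspace X"
  shows "borel_in X (topspace X - A) \<longleftrightarrow> borel_in X A"
  using borel_in_Compl[of X "topspace X - A"] borel_in_Compl[of X A] assms by (auto simp: double_diff)

lemma Sigma0_class_borel: "Sigma0_class X r A \<Longrightarrow> borel_in X A"
proof (induction rule: Sigma0_class.induct)
  case (base r a A) then show ?case by (auto simp: borel_in_def)
next
  case (step r B A)
  then have "borel_in X (B n)" for n using borel_in_Compl_iff by metis
  then show ?case unfolding step borel_in_def by (intro sigma_sets.Union) auto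
qed

lemma Pi0_class_borel: "Pi0_class X r A \<Longrightarrow> borel_in X A"
  unfolding Pi0_class_def using Sigma0_class_borel borel_in_Compl_iff by metis

lemma topspace_cantor: "topspace (cantor k) = {x. \<forall>i. x i < k}"
  by (auto simp: cantor_def PiE_iff)

text \<open>\<open>loc\<close> expresses that every coordinate of \<Psi> is continuous; preimages
  commute with complements and countable unions.\<close>

lemma borel_in_cantor_vimage:
  fixes \<Psi> :: "(nat \<Rightarrow> nat) \<Rightarrow> nat \<Rightarrow> nat"
  assumes B: "borel_in (cantor k) A"
    and rng: "\<And>x i. \<Psi> x i < k"
    and loc: "\<And>x i. \<exists>n. \<forall>y. (\<forall>j<n. y j = x j) \<longrightarrow> \<Psi> y i = \<Psi> x i"
  shows "{x. \<Psi> x \<in> A} \<in> sigma_sets UNIV {U. open U}"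
proof -
  have "continuous_map euclidean (cantor k) \<Psi>"
    unfolding cantor_def continuous_map_componentwise_UNIV
  proof
    fix i
    show "continuous_map euclidean (discrete_topology {..<k}) (\<lambda>x. \<Psi> x i)"
      unfolding continuous_map_def
    proof (intro conjI allI impI)
      fix U
      have "open {x. \<Psi> x i \<in> U}"
        unfolding open_iff_cylinder
      proof
        fix x assume x: "x \<in> {x. \<Psi> x i \<in> U}"
        obtain n where n: "\<forall>y. (\<forall>j<n. y j = x j) \<longrightarrow> \<Psi> y i = \<Psi> x i" using loc by blast
        have "\<forall>y. (\<forall>j<n. y j = x j) \<longrightarrow> y \<in> {x. \<Psi> x i \<in> U}"
        proof (intro allI impI)
          fix y assume "\<forall>j<n. y j = x j"
          then have "\<Psi> y i = \<Psi> x i" using n by blast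
          then show "y \<in> {x. \<Psi> x i \<in> U}" using x by simp
        qed
        then show "\<exists>n. \<forall>y. (\<forall>j<n. y j = x j) \<longrightarrow> y \<in> {x. \<Psi> x i \<in> U}" by (rule exI)
      qed
      then show "openin euclidean {x \<in> topspace euclidean. \<Psi> x i \<in> U}" by simp
    qed (simp add: rng)
  qed
  then have op: "open {x. \<Psi> x \<in> U}" if "openin (cantor k) U" for U
    using openin_continuous_map_preimage[of euclidean "cantor k" \<Psi> U] that by simp
  from B[unfolded borel_in_def] show ?thesis
  proof induction
    case (Basic U) then show ?case by (auto intro: op)
  next
    case Empty then show ?case by (simp add: sigma_sets.Empty)
  next
    case (Compl A)
    have "{x. \<Psi> x \<in> topspace (cantor k) - A} = UNIV - {x. \<Psi> x \<in> A}"
      using rng by (auto simp: topspace_cantor)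
    then show ?case using Compl by (simp only: sigma_sets.Compl)
  next
    case (Union A)
    have "{x. \<Psi> x \<in> (\<Union>i. A i)} = (\<Union>i. {x. \<Psi> x \<in> A i})" by auto
    then show ?case using Union by (simp only: sigma_sets.Union)
  qed
qed

section \<open>Linear orders from trees\<close>

text \<open>The Kleene-Brouwer order: lexicographic, with proper extensions below their prefixes, so
  that a branch of a tree becomes a descending chain.\<close>

fun kb :: "nat list \<Rightarrow> nat list \<Rightarrow> bool" where
  "kb [] t = False"
| "kb (a # s) [] = True"
| "kb (a # s) (b # t) = (a < b \<or> a = b \<and> kb s t)"

lemma kb_irrefl: "\<not> kb s s"
  by (induction s) auto

lemma kb_trans: "kb s t \<Longrightarrow> kb t u \<Longrightarrow> kb s u"
proof (induction s t arbitrary: u rule: kb.induct)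
  case (2 a s) then show ?case by (cases u) auto
next
  case (3 a s b t) then show ?case by (cases u) auto
qed auto

lemma kb_total: "s \<noteq> t \<Longrightarrow> kb s t \<or> kb t s"
proof (induction s t rule: kb.induct)
  case (1 t) then show ?case by (cases t) auto
qed auto

lemma kb_append: "s \<noteq> [] \<Longrightarrow> kb (t @ s) t"
  by (induction t) (auto simp: neq_Nil_conv)

definition kb_ill :: "nat list set \<Rightarrow> nat list \<Rightarrow> bool" where
  "kb_ill T p \<longleftrightarrow> (\<exists>f. \<forall>i::nat. kb (f (Suc i)) (f i) \<and> p @ f i \<in> T)"

lemma antimono_eventually_const:
  fixes h :: "nat \<Rightarrow> nat"
  assumes "\<And>i. h (Suc i) \<le> h i"
  obtains N where "\<And>i. i \<ge> N \<Longrightarrow> h i = h N"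
proof -
  obtain N where N: "\<And>i. h N \<le> h i"
    using ex_has_least_nat[of "\<lambda>_. True" 0 h] by auto
  have "h i \<le> h N" if "i \<ge> N" for i
    using that by (induction rule: dec_induct) (auto intro: le_trans assms)
  then show ?thesis using N that by (meson le_antisym)
qed

text \<open>Along a descending chain the first entries decrease weakly and are eventually a constant
  a. Cutting it off leaves a descending chain of extensions of \<open>p @ [a]\<close>.\<close>

lemma kb_ill_extend:
  assumes "kb_ill T p" shows "\<exists>a. kb_ill T (p @ [a])"
proof -
  obtain f where f: "\<And>i. kb (f (Suc i)) (f i)" "\<And>i. p @ f i \<in> T"
    using assms unfolding kb_ill_def by blast
  \<comment> \<open>The shift drops \<open>f 0\<close>, the only member that may be empty, since
    \<open>[]\<close> is below nothing.\<close>
  define g where "g i = f (Suc i)" for i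
  have ne: "g i \<noteq> []" for i using f(1)[of i] unfolding g_def by (metis kb.simps(1))
  have g: "kb (g (Suc i)) (g i)" for i using f(1) by (simp add: g_def)
  have step: "hd (g (Suc i)) < hd (g i) \<or> hd (g (Suc i)) = hd (g i) \<and> kb (tl (g (Suc i))) (tl (g i))" for i
    using g[of i] ne[of i] ne[of "Suc i"] by (cases "g i"; cases "g (Suc i)") auto
  obtain N where N: "\<And>i. i \<ge> N \<Longrightarrow> hd (g i) = hd (g N)"
    using antimono_eventually_const[of "\<lambda>i. hd (g i)"] step by (metis less_imp_le order_refl)
  have "kb (tl (g (Suc (N + i)))) (tl (g (N + i))) \<and> (p @ [hd (g N)]) @ tl (g (N + i)) \<in> T" for i
  proof
    show "kb (tl (g (Suc (N + i)))) (tl (g (N + i)))"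
      using step[of "N + i"] N[of "N + i"] N[of "Suc (N + i)"] by auto
    have "hd (g N) # tl (g (N + i)) = g (N + i)"
      using ne[of "N + i"] N[of "N + i"] by (cases "g (N + i)") auto
    then show "(p @ [hd (g N)]) @ tl (g (N + i)) \<in> T" using f(2)[of "Suc (N + i)"] by (simp add: g_def)
  qed
  then have "kb_ill T (p @ [hd (g N)])"
    unfolding kb_ill_def by (intro exI[of _ "\<lambda>i. tl (g (N + i))"]) simp
  then show ?thesis by blast
qed

text \<open>Iterated extension yields the branch. Its nodes have extensions in T, so
  \<open>closed\<close> puts them into T.\<close>

lemma kb_ill_imp_branch:
  assumes ill: "kb_ill T []" and closed: "\<And>s t. s @ t \<in> T \<Longrightarrow> s \<in> T"
  shows "\<exists>z. \<forall>n. pref z n \<in> T"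
proof -
  obtain q where q: "q 0 = []" "\<And>n. kb_ill T (q n)" "\<And>n. \<exists>a. q (Suc n) = q n @ [a]"
    using dependent_nat_choice[of "\<lambda>n p. (n = 0 \<longrightarrow> p = []) \<and> kb_ill T p" "\<lambda>n p p'. \<exists>a. p' = p @ [a]"]
      ill kb_ill_extend[of T] by (metis nat.simps(3))
  define z where "z n = last (q (Suc n))" for n
  have "q n = pref z n" for n
  proof (induction n)
    case (Suc n) then show ?case using q(3)[of n] by (auto simp: z_def)
  qed (simp add: q)
  then have "pref z n \<in> T" for n using q(2)[of n] closed unfolding kb_ill_def by metis
  then show ?thesis by blast
qed

text \<open>Codes of sequences outside the tree are placed below the tree, where they are well-ordered. Hence
  the root, whose code is 0, is the greatest element if the tree is nonempty.\<close>
definition tree_less :: "nat list set \<Rightarrow> nat \<Rightarrow> nat \<Rightarrow> bool" where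
  "tree_less T e f \<longleftrightarrow>
     (if list_decode e \<in> T then list_decode f \<in> T \<and> kb (list_decode e) (list_decode f)
      else list_decode f \<in> T \<or> e < f)"

lemma tree_less_irrefl: "\<not> tree_less T e e"
  by (simp add: tree_less_def kb_irrefl)

lemma tree_less_trans: "tree_less T e f \<Longrightarrow> tree_less T f g \<Longrightarrow> tree_less T e g"
  by (auto simp: tree_less_def intro: kb_trans split: if_splits)

lemma tree_less_total: "e \<noteq> f \<Longrightarrow> tree_less T e f \<or> tree_less T f e"
  using kb_total[of "list_decode e" "list_decode f"] by (auto simp: tree_less_def list_decode_eq)

text \<open>The prefixes of a branch descend. Conversely, a chain that leaves T never returns, and
  outside T it would descend in the natural numbers; so it stays in T.\<close>

lemma tree_less_ill_iff:
  assumes closed: "\<And>s t. s @ t \<in> T \<Longrightarrow> s \<in> T"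
  shows "(\<exists>a::nat \<Rightarrow> nat. \<forall>i. tree_less T (a (Suc i)) (a i)) \<longleftrightarrow> (\<exists>z. \<forall>n. pref z n \<in> T)"
proof
  assume "\<exists>z. \<forall>n. pref z n \<in> T"
  then obtain z where z: "\<And>n. pref z n \<in> T" by blast
  have "kb (pref z (Suc i)) (pref z i)" for i using kb_append[of "[z i]" "pref z i"] by simp
  then have "tree_less T (list_encode (pref z (Suc i))) (list_encode (pref z i))" for i
    using z unfolding tree_less_def list_encode_inverse by metis
  then show "\<exists>a::nat \<Rightarrow> nat. \<forall>i. tree_less T (a (Suc i)) (a i)"
    by (intro exI[of _ "\<lambda>i. list_encode (pref z i)"] allI)
next
  assume "\<exists>a::nat \<Rightarrow> nat. \<forall>i. tree_less T (a (Suc i)) (a i)"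
  then obtain a :: "nat \<Rightarrow> nat" where a: "\<And>i. tree_less T (a (Suc i)) (a i)" by blast
  have "list_decode (a i) \<in> T" for i
  proof (rule ccontr)
    assume n: "list_decode (a i) \<notin> T"
    have "list_decode (a (i + j)) \<notin> T \<and> a (i + j) + j \<le> a i" for j
    proof (induction j)
      case (Suc j) then show ?case using a[of "i + j"] by (auto simp: tree_less_def split: if_splits)
    qed (use n in simp)
    from this[of "Suc (a i)"] show False by simp
  qed
  then have "kb_ill T []" using a unfolding kb_ill_def tree_less_def
    by (intro exI[of _ "\<lambda>i. list_decode (a i)"]) auto
  then show "\<exists>z. \<forall>n. pref z n \<in> T" using closed by (rule kb_ill_imp_branch)
qed

text \<open>The chain forces a branch, so the root, coded by 0, lies in T.\<close>

lemma tree_less_top: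
  assumes "\<forall>i. tree_less T (a (Suc i)) (a i)" and closed: "\<And>s t. s @ t \<in> T \<Longrightarrow> s \<in> T" and "e \<noteq> 0"
  shows "tree_less T e 0"
proof -
  have "(\<exists>a. \<forall>i. tree_less T (a (Suc i)) (a i)) \<longleftrightarrow> (\<exists>z. \<forall>n. pref z n \<in> T)"
    by (rule tree_less_ill_iff) (rule closed)
  then obtain z where "\<forall>n. pref z n \<in> T" using assms(1) by blast
  then have "[] \<in> T" by (metis list.map(1) upt_0)
  moreover have "list_decode e \<noteq> []" using \<open>e \<noteq> 0\<close> by (metis list_decode_inverse list_encode.simps(1))
  ultimately show ?thesis by (auto simp: tree_less_def neq_Nil_conv)
qed

section \<open>Ranks in a linear order on the natural numbers\<close>

locale nat_linorder =
  fixes less :: "nat \<Rightarrow> nat \<Rightarrow> bool" (infix "\<sqsubset>" 50)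
  assumes irrefl: "\<not> a \<sqsubset> a"
    and trans: "a \<sqsubset> b \<Longrightarrow> b \<sqsubset> c \<Longrightarrow> a \<sqsubset> c"
    and total: "a \<noteq> b \<Longrightarrow> a \<sqsubset> b \<or> b \<sqsubset> a"
begin

text \<open>For \<open>e < i\<close> this is the position of e among the first i elements; for
  \<open>e = i\<close> it is the place where the new element i enters.\<close>

definition rank :: "nat \<Rightarrow> nat \<Rightarrow> nat" where
  "rank i e = card {j. j < i \<and> j \<sqsubset> e}"

lemma rank_mono: "e \<sqsubset> f \<Longrightarrow> rank i e \<le> rank i f"
  unfolding rank_def by (rule card_mono) (auto intro: trans)

lemma rank_strict: "e \<sqsubset> f \<Longrightarrow> e < i \<Longrightarrow> rank i e < rank i f"
proof -
  assume "e \<sqsubset> f" "e < i"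
  then have "{j. j < i \<and> j \<sqsubset> e} \<subseteq> {j. j < i \<and> j \<sqsubset> f}" "e \<in> {j. j < i \<and> j \<sqsubset> f}"
    "e \<notin> {j. j < i \<and> j \<sqsubset> e}"
    using trans[of _ e f] irrefl by blast+
  then show ?thesis unfolding rank_def by (intro psubset_card_mono) (simp, blast)
qed

lemma rank_less_iff: "e < i \<Longrightarrow> f < i \<Longrightarrow> rank i e < rank i f \<longleftrightarrow> e \<sqsubset> f"
  using rank_strict[of e f i] rank_mono[of f e i] total[of e f] by fastforce

lemma rank_less: "e < i \<Longrightarrow> rank i e < i"
proof -
  assume e: "e < i"
  have "rank i e < card {..<i}" unfolding rank_def
    by (rule psubset_card_mono) (use e irrefl in auto)
  then show ?thesis by simp
qed

text \<open>An injective self-map of a finite set is onto; thus every counter value below i stands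
  for one of the first i elements.\<close>

lemma rank_surj: "v < i \<Longrightarrow> \<exists>e<i. rank i e = v"
proof -
  assume v: "v < i"
  have "inj_on (rank i) {..<i}"
    by (rule inj_onI) (metis lessThan_iff less_irrefl rank_strict total)
  moreover have "rank i ` {..<i} \<subseteq> {..<i}" using rank_less by auto
  ultimately have "rank i ` {..<i} = {..<i}" by (simp add: endo_inj_surj)
  then show ?thesis using v by (metis (no_types, lifting) imageE lessThan_iff)
qed

lemma rank_Suc: "rank (Suc i) e = rank i e + (if i \<sqsubset> e then 1 else 0)"
proof -
  have "{j. j < Suc i \<and> j \<sqsubset> e} = {j. j < i \<and> j \<sqsubset> e} \<union> (if i \<sqsubset> e then {i} else {})"
    using less_Suc_eq by auto
  then show ?thesis by (simp add: rank_def)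
qed

text \<open>By subtracting, a counter without zero test can verify the inequality on the left but
  not its negation; it shows that i enters below e.\<close>

lemma rank_self_le_iff: "e < i \<Longrightarrow> rank i i \<le> rank i e \<longleftrightarrow> i \<sqsubset> e"
  using rank_strict[of e i i] rank_mono[of i e i] total[of e i] irrefl[of i] trans[of i e i]
  by (cases "e \<sqsubset> i") auto

end

lemma nat_linorder_tree_less: "nat_linorder (tree_less T)"
  by unfold_locales (auto simp: tree_less_irrefl intro: tree_less_trans dest: tree_less_total)

section \<open>Continuity of the diagonal tree and its ranks\<close>

lemma diag_tree_closed: "s @ t \<in> diag_tree x \<Longrightarrow> s \<in> diag_tree x"
proof -
  assume a: "s @ t \<in> diag_tree x"
  have "x (pair_code (pref x l) (take l s)) = 0" if "l \<le> length s" for l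
    using a[unfolded diag_tree_def mem_Collect_eq, rule_format, of l] that by simp
  then show ?thesis by (simp add: diag_tree_def)
qed

text \<open>Membership of t depends on the first \<open>length t\<close> values of x and on its
  values at finitely many codes; the bound exceeds all these positions.\<close>

lemma diag_tree_local: "\<exists>n. \<forall>y. (\<forall>j<n. y j = x j) \<longrightarrow> (t \<in> diag_tree y \<longleftrightarrow> t \<in> diag_tree x)"
proof -
  let ?n = "Suc (length t + (\<Sum>l\<le>length t. pair_code (pref x l) (take l t)))"
  have "t \<in> diag_tree y \<longleftrightarrow> t \<in> diag_tree x" if y: "\<forall>j<?n. y j = x j" for y
  proof -
    have "y (pair_code (pref y l) (take l t)) = x (pair_code (pref x l) (take l t))" if l: "l \<le> length t" for l
    proof -
      have eq: "pref y l = pref x l" using y l by auto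
      have "pair_code (pref x l) (take l t) < ?n"
        using member_le_sum[of l "{..length t}" "\<lambda>l. pair_code (pref x l) (take l t)"] l by simp
      then show ?thesis unfolding eq using y by blast
    qed
    then show ?thesis by (simp add: diag_tree_def)
  qed
  then show ?thesis by blast
qed

definition tree_rank :: "nat list set \<Rightarrow> nat \<Rightarrow> nat" where
  "tree_rank T i = nat_linorder.rank (tree_less T) i i"

text \<open>The rank of l compares numbers up to l only, so it depends on the membership of finitely
  many sequences.\<close>

lemma tree_rank_local:
  "\<exists>n. \<forall>y. (\<forall>j<n. y j = x j) \<longrightarrow> (\<forall>l\<le>i. tree_rank (diag_tree y) l = tree_rank (diag_tree x) l)"
proof -
  obtain n where n: "\<And>t y. (\<forall>j<n t. y j = x j) \<Longrightarrow> (t \<in> diag_tree y \<longleftrightarrow> t \<in> diag_tree x)"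
    using diag_tree_local[of x] by metis
  let ?n = "\<Sum>j\<le>i. n (list_decode j)"
  have "tree_rank (diag_tree y) l = tree_rank (diag_tree x) l" if y: "\<forall>j<?n. y j = x j" and l: "l \<le> i" for y l
  proof -
    have "list_decode j \<in> diag_tree y \<longleftrightarrow> list_decode j \<in> diag_tree x" if "j \<le> i" for j
    proof (rule n)
      show "\<forall>k<n (list_decode j). y k = x k"
        using member_le_sum[of j "{..i}" "\<lambda>j. n (list_decode j)"] that y by fastforce
    qed
    then have "{j. j < l \<and> tree_less (diag_tree y) j l} = {j. j < l \<and> tree_less (diag_tree x) j l}"
      using l by (auto simp: tree_less_def)
    then show ?thesis
      unfolding tree_rank_def nat_linorder.rank_def[OF nat_linorder_tree_less] by simp
  qed
  then show ?thesis by blast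
qed

section \<open>Computing the code of the automaton\<close>

lemma rec_eval_Comp1: "rec_eval g xs y \<Longrightarrow> rec_eval f [y] z \<Longrightarrow> rec_eval (Comp f [g]) xs z"
  by (rule rec_eval.comp[of "[y]"]) auto

lemma rec_eval_Comp2:
  "rec_eval g xs y \<Longrightarrow> rec_eval h xs y' \<Longrightarrow> rec_eval f [y, y'] z \<Longrightarrow> rec_eval (Comp f [g, h]) xs z"
  by (rule rec_eval.comp[of "[y, y']"]) (auto simp: less_Suc_eq)

lemma rec_eval_Proj: "i < length xs \<Longrightarrow> xs ! i = y \<Longrightarrow> rec_eval (Proj i) xs y"
  using rec_eval.proj by auto

fun rConst :: "nat \<Rightarrow> recf" where
  "rConst 0 = Z" | "rConst (Suc n) = Comp S [rConst n]"

lemma rec_eval_rConst: "rec_eval (rConst n) xs n"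
  by (induction n) (auto intro: rec_eval.zero rec_eval_Comp1 rec_eval.succ)

definition rAdd :: recf where "rAdd = Prim (Proj 0) (Comp S [Proj 0])"

lemma rec_eval_rAdd: "rec_eval rAdd [m, n] (m + n)"
  unfolding rAdd_def
proof (induction m)
  case 0 show ?case by (rule rec_eval.prim0, rule rec_eval_Proj) auto
next
  case (Suc m) show ?case unfolding add_Suc
    by (rule rec_eval.primS[OF Suc], rule rec_eval_Comp1[OF rec_eval_Proj rec_eval.succ]) auto
qed

definition rTri :: recf where "rTri = Prim Z (Comp rAdd [Proj 0, Comp S [Proj 1]])"

lemma rec_eval_rTri: "rec_eval rTri [n] (triangle n)"
  unfolding rTri_def
proof (induction n)
  case 0 show ?case using rec_eval.prim0[OF rec_eval.zero] by simp
next
  case (Suc n) show ?case unfolding triangle_Suc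
    by (rule rec_eval.primS[OF Suc], rule rec_eval_Comp2[OF rec_eval_Proj rec_eval_Comp1[OF rec_eval_Proj] rec_eval_rAdd])
       (auto intro: rec_eval.succ)
qed

text \<open>Follows \<open>list_encode (x # xs) = Suc (prod_encode (x, list_encode xs))\<close> with
  \<open>prod_encode (m, n) = triangle (m + n) + m\<close>.\<close>

definition rCons :: "recf \<Rightarrow> recf \<Rightarrow> recf" where
  "rCons e f = Comp (Comp S [Comp rAdd [Comp rTri [rAdd], Proj 0]]) [e, f]"

lemma rec_eval_rCons:
  assumes "rec_eval e xs a" "rec_eval f xs (list_encode as)"
  shows "rec_eval (rCons e f) xs (list_encode (a # as))"
  unfolding rCons_def
  by (rule rec_eval_Comp2[OF assms], rule rec_eval_Comp1,
      rule rec_eval_Comp2[OF rec_eval_Comp1[OF rec_eval_rAdd rec_eval_rTri] rec_eval_Proj rec_eval_rAdd])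
     (auto simp: prod_encode_def intro: rec_eval.succ)

definition trans_code :: "(nat \<times> nat \<times> cop \<times> nat) list \<Rightarrow> nat" where
  "trans_code ts = list_encode (map (\<lambda>(p, a, d, q). list_encode [p, a, cop_code d, q]) ts)"

definition rTrans :: "recf \<Rightarrow> nat \<Rightarrow> recf \<Rightarrow> recf \<Rightarrow> recf" where
  "rTrans p a q ts = rCons (rCons p (rCons (rConst a) (rCons (rConst 1) (rCons q Z)))) ts"

lemma rec_eval_rTrans:
  assumes "rec_eval p xs p'" "rec_eval q xs q'" "rec_eval ts xs (trans_code ts')"
  shows "rec_eval (rTrans p a q ts) xs (trans_code ((p', a, Keep, q') # ts'))"
proof -
  have "rec_eval Z xs (list_encode [])" by (simp add: rec_eval.zero)
  then show ?thesis
    unfolding rTrans_def trans_code_def list.map prod.case cop_code.simps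
    by (intro rec_eval_rCons assms assms(3)[unfolded trans_code_def] rec_eval_rConst)
qed

text \<open>In state \<open>2 * i\<close> the first block has shown i units; if it ends there, it is
  shorter than k, and \<open>dn\<close> records the error. Larger indices come first, which lets
  primitive recursion build the list.\<close>

fun chain_trans :: "nat \<Rightarrow> nat \<Rightarrow> (nat \<times> nat \<times> cop \<times> nat) list" where
  "chain_trans dn 0 = []"
| "chain_trans dn (Suc i) = (2 * i, 0, Keep, 2 * Suc i) # (2 * i, 1, Keep, dn) # chain_trans dn i"

lemma set_chain_trans:
  "set (chain_trans dn k) = (\<Union>i<k. {(2 * i, 0, Keep, 2 * Suc i), (2 * i, 1, Keep, dn)})"
  by (induction k) (auto simp: less_Suc_eq)

text \<open>The states of the chain that depends on k are the even numbers, the transitions in T use even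
  numbers only as targets.\<close>
definition chain_bca :: "nat \<Rightarrow> nat \<Rightarrow> nat list \<Rightarrow> nat \<Rightarrow> (nat \<times> nat \<times> cop \<times> nat) list \<Rightarrow> bca" where
  "chain_bca dn i0 fs k T =
     \<lparr>alph = 4, trans = (2 * k, 0, Keep, dn) # chain_trans dn k @ T, init = i0, acc = fs\<rparr>"

text \<open>The self-reference: as k is the code of T, a single number determines the whole
  automaton, whose code arises by prefixing k chain links to T.\<close>

lemma rec_eval_chain_bca:
  "\<exists>G. \<forall>T. rec_eval G [trans_code T] (bca_enc (chain_bca dn i0 fs (trans_code T) T))"
proof -
  define dbl where "dbl e = Comp rAdd [e, e]" for e
  have dbl: "rec_eval e xs n \<Longrightarrow> rec_eval (dbl e) xs (2 * n)" for e xs n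
    unfolding dbl_def mult_2 by (rule rec_eval_Comp2[OF _ _ rec_eval_rAdd])
  \<comment> \<open>The step function of \<open>Prim\<close> receives the code built so far as
    argument 0 and the index i as argument 1.\<close>
  define st where "st = rTrans (dbl (Proj 1)) 0 (dbl (Comp S [Proj 1]))
     (rTrans (dbl (Proj 1)) 1 (rConst dn) (Proj 0))"
  define X where "X = Prim (Proj 0) st"
  have X: "rec_eval X [i, trans_code T] (trans_code (chain_trans dn i @ T))" for i T
    unfolding X_def
  proof (induction i)
    case 0 show ?case by (rule rec_eval.prim0, rule rec_eval_Proj) auto
  next
    case (Suc i)
    show ?case unfolding chain_trans.simps append_Cons
      by (rule rec_eval.primS[OF Suc], unfold st_def,
          intro rec_eval_rTrans dbl rec_eval_rConst rec_eval_Comp1[OF rec_eval_Proj rec_eval.succ] rec_eval_Proj)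
         auto
  qed
  define fr where "fr = foldr (\<lambda>n. rCons (rConst n))"
  have fr: "rec_eval (fr ns Z) xs (list_encode ns)" for ns xs
    unfolding fr_def
    by (induction ns) (auto intro: rec_eval.zero rec_eval_rCons rec_eval_rConst simp del: list_encode.simps(2))
  define G where "G = rCons (rConst 4) (rCons (rConst i0) (rCons (fr fs Z)
     (rCons (rTrans (dbl (Proj 0)) 0 (rConst dn) (Comp X [Proj 0, Proj 0])) Z)))"
  have "rec_eval G [trans_code T] (bca_enc (chain_bca dn i0 fs (trans_code T) T))" for T
  proof -
    let ?k = "trans_code T"
    have P: "rec_eval (Proj 0) [?k] ?k" by (rule rec_eval_Proj) auto
    have Z: "rec_eval Z [?k] (list_encode [])" by (simp add: rec_eval.zero)
    have "rec_eval G [?k] (list_encode [4, i0, list_encode fs,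
        trans_code ((2 * ?k, 0, Keep, dn) # (chain_trans dn ?k @ T))])"
      unfolding G_def
      by (intro rec_eval_rCons rec_eval_rTrans dbl rec_eval_rConst rec_eval_Comp2[OF P P X] P fr Z)
    then show ?thesis by (simp add: bca_enc_def chain_bca_def trans_code_def)
  qed
  then show ?thesis by blast
qed

section \<open>Counter programs\<close>

datatype com = CSkip | CInc nat | CDec nat | CSeq com com | CWhile nat com

text \<open>The control is the stack of statements still to be executed; z tells whether the tested
  register is nonzero.\<close>

fun nxt :: "com list \<Rightarrow> bool \<Rightarrow> com list" where
  "nxt [] z = []"
| "nxt (CSeq a b # cs) z = a # b # cs"
| "nxt (CWhile r c # cs) z = (if z then c # CWhile r c # cs else cs)"
| "nxt (_ # cs) z = cs"

text \<open>The default 0 is harmless: statements without a register have operation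
  \<open>Keep\<close> and a continuation independent of the test.\<close>

fun reg :: "com list \<Rightarrow> nat" where
  "reg (CInc r # cs) = r"
| "reg (CDec r # cs) = r"
| "reg (CWhile r c # cs) = r"
| "reg _ = 0"

fun opr :: "com list \<Rightarrow> bool \<Rightarrow> cop" where
  "opr (CInc r # cs) z = Inc"
| "opr (CDec r # cs) z = (if z then Dec else Keep)"
| "opr _ z = Keep"

fun cop_app :: "cop \<Rightarrow> nat \<Rightarrow> nat" where
  "cop_app Inc n = Suc n" | "cop_app Dec n = n - 1" | "cop_app Keep n = n"

text \<open>A step tests and alters a single register, so that a finite control can perform it
  during one pass over all registers.\<close>

definition step :: "com list \<times> (nat \<Rightarrow> nat) \<Rightarrow> com list \<times> (nat \<Rightarrow> nat)" where
  "step = (\<lambda>(cs, \<sigma>). let r = reg cs; z = 0 < \<sigma> r in (nxt cs z, \<sigma>(r := cop_app (opr cs z) (\<sigma> r))))"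

text \<open>The quantifier over the remaining stack makes executions composable.\<close>

definition runs :: "com \<Rightarrow> (nat \<Rightarrow> nat) \<Rightarrow> (nat \<Rightarrow> nat) \<Rightarrow> bool" where
  "runs c \<sigma> \<tau> \<longleftrightarrow> (\<forall>cs. \<exists>n. (step ^^ n) (c # cs, \<sigma>) = (cs, \<tau>))"

lemma runs_Skip: "runs CSkip \<sigma> \<sigma>"
  unfolding runs_def by (intro allI exI[of _ 1]) (simp add: step_def)

lemma runs_Inc: "runs (CInc r) \<sigma> (\<sigma>(r := Suc (\<sigma> r)))"
  unfolding runs_def by (intro allI exI[of _ 1]) (simp add: step_def)

lemma runs_Dec: "runs (CDec r) \<sigma> (\<sigma>(r := \<sigma> r - 1))"
  unfolding runs_def by (intro allI exI[of _ 1]) (auto simp: step_def fun_eq_iff)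

lemma funpow_chain: "(f ^^ m) x = y \<Longrightarrow> (f ^^ n) y = z \<Longrightarrow> (f ^^ (n + m)) x = z"
  by (simp add: funpow_add)

lemma runs_Seq: "runs a \<sigma> \<tau> \<Longrightarrow> runs b \<tau> \<upsilon> \<Longrightarrow> runs (CSeq a b) \<sigma> \<upsilon>"
  unfolding runs_def
proof
  fix cs
  assume "\<forall>cs. \<exists>n. (step ^^ n) (a # cs, \<sigma>) = (cs, \<tau>)" "\<forall>cs. \<exists>n. (step ^^ n) (b # cs, \<tau>) = (cs, \<upsilon>)"
  then obtain m n where "(step ^^ m) (a # b # cs, \<sigma>) = (b # cs, \<tau>)" "(step ^^ n) (b # cs, \<tau>) = (cs, \<upsilon>)"
    by blast
  moreover have "(step ^^ 1) (CSeq a b # cs, \<sigma>) = (a # b # cs, \<sigma>)" by (simp add: step_def)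
  ultimately show "\<exists>n. (step ^^ n) (CSeq a b # cs, \<sigma>) = (cs, \<upsilon>)" using funpow_chain by metis
qed

lemma runs_While0: "\<sigma> r = 0 \<Longrightarrow> runs (CWhile r c) \<sigma> \<sigma>"
  unfolding runs_def by (intro allI exI[of _ 1]) (simp add: step_def fun_upd_idem_iff)

lemma runs_WhileS:
  "\<sigma> r \<noteq> 0 \<Longrightarrow> runs c \<sigma> \<tau> \<Longrightarrow> runs (CWhile r c) \<tau> \<upsilon> \<Longrightarrow> runs (CWhile r c) \<sigma> \<upsilon>"
  unfolding runs_def
proof
  fix cs
  assume "\<forall>cs. \<exists>n. (step ^^ n) (c # cs, \<sigma>) = (cs, \<tau>)" "\<forall>cs. \<exists>n. (step ^^ n) (CWhile r c # cs, \<tau>) = (cs, \<upsilon>)"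
  then obtain m n where "(step ^^ m) (c # CWhile r c # cs, \<sigma>) = (CWhile r c # cs, \<tau>)"
    "(step ^^ n) (CWhile r c # cs, \<tau>) = (cs, \<upsilon>)"
    by blast
  moreover assume "\<sigma> r \<noteq> 0"
  then have "(step ^^ 1) (CWhile r c # cs, \<sigma>) = (c # CWhile r c # cs, \<sigma>)" by (simp add: step_def)
  ultimately show "\<exists>n. (step ^^ n) (CWhile r c # cs, \<sigma>) = (cs, \<upsilon>)" using funpow_chain by metis
qed

definition seqs :: "com list \<Rightarrow> com" where "seqs cs = foldr CSeq cs CSkip"

lemma runs_seqs:
  "(\<And>j. j < length cs \<Longrightarrow> runs (cs ! j) (st j) (st (Suc j))) \<Longrightarrow> runs (seqs cs) (st 0) (st (length cs))"
proof (induction cs arbitrary: st)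
  case Nil show ?case by (simp add: seqs_def runs_Skip)
next
  case (Cons c cs)
  have "runs (seqs cs) (st (Suc 0)) (st (Suc (length cs)))"
    by (rule Cons.IH[of "\<lambda>j. st (Suc j)"]) (use Cons.prems in force)
  moreover have "runs c (st 0) (st (Suc 0))" using Cons.prems[of 0] by simp
  ultimately show ?case by (auto simp: seqs_def intro: runs_Seq)
qed

definition move :: "nat \<Rightarrow> nat \<Rightarrow> com" where
  "move s d = CWhile s (CSeq (CDec s) (CInc d))"

lemma runs_move:
  assumes "s \<noteq> d" shows "runs (move s d) \<sigma> (\<sigma>(d := \<sigma> d + \<sigma> s, s := 0))"
  unfolding move_def
proof (induction "\<sigma> s" arbitrary: \<sigma>)
  case 0
  then show ?case using runs_While0[of \<sigma> s] by (simp add: fun_upd_idem)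
next
  case (Suc n)
  let ?\<tau> = "\<sigma>(s := \<sigma> s - 1, d := Suc (\<sigma> d))"
  have "runs (CSeq (CDec s) (CInc d)) \<sigma> ?\<tau>"
    using runs_Seq[OF runs_Dec runs_Inc, of s d \<sigma>] assms by simp
  moreover have "runs (CWhile s (CSeq (CDec s) (CInc d))) ?\<tau> (?\<tau>(d := ?\<tau> d + ?\<tau> s, s := 0))"
    using Suc assms by (intro Suc(1)) simp
  moreover have "?\<tau>(d := ?\<tau> d + ?\<tau> s, s := 0) = \<sigma>(d := \<sigma> d + \<sigma> s, s := 0)"
    using Suc(2) assms by (auto simp: fun_eq_iff)
  ultimately show ?case using Suc(2) by (metis runs_WhileS Zero_not_Suc)
qed

definition clear :: "nat \<Rightarrow> com" where "clear r = CWhile r (CDec r)"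

lemma runs_clear: "runs (clear r) \<sigma> (\<sigma>(r := 0))"
  unfolding clear_def
proof (induction "\<sigma> r" arbitrary: \<sigma>)
  case 0
  then show ?case using runs_While0[of \<sigma> r] by (simp add: fun_upd_idem)
next
  case (Suc n)
  have "runs (CWhile r (CDec r)) (\<sigma>(r := \<sigma> r - 1)) (\<sigma>(r := 0))"
    using Suc(1)[of "\<sigma>(r := \<sigma> r - 1)"] Suc(2) by simp
  then show ?case using Suc(2) runs_WhileS[OF _ runs_Dec] by (metis Zero_not_Suc)
qed

definition copy :: "nat \<Rightarrow> nat \<Rightarrow> nat \<Rightarrow> com" where
  "copy s d t = CSeq (CWhile s (CSeq (CDec s) (CSeq (CInc d) (CInc t)))) (move t s)"

lemma runs_copy:
  assumes "s \<noteq> d" "s \<noteq> t" "d \<noteq> t" "\<sigma> t = 0"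
  shows "runs (copy s d t) \<sigma> (\<sigma>(d := \<sigma> d + \<sigma> s))"
proof -
  let ?W = "CWhile s (CSeq (CDec s) (CSeq (CInc d) (CInc t)))"
  have "runs ?W \<sigma> (\<sigma>(d := \<sigma> d + \<sigma> s, t := \<sigma> t + \<sigma> s, s := 0))" for \<sigma>
  proof (induction "\<sigma> s" arbitrary: \<sigma>)
    case 0
    then show ?case using runs_While0[of \<sigma> s] by (simp add: fun_upd_idem)
  next
    case (Suc n)
    let ?\<tau> = "\<sigma>(s := \<sigma> s - 1, d := Suc (\<sigma> d), t := Suc (\<sigma> t))"
    have "runs (CSeq (CDec s) (CSeq (CInc d) (CInc t))) \<sigma> ?\<tau>"
      using runs_Seq[OF runs_Dec runs_Seq[OF runs_Inc runs_Inc], of s d t \<sigma>] assms by simp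
    moreover have "runs ?W ?\<tau> (?\<tau>(d := ?\<tau> d + ?\<tau> s, t := ?\<tau> t + ?\<tau> s, s := 0))"
      using Suc assms by (intro Suc(1)) simp
    moreover have "?\<tau>(d := ?\<tau> d + ?\<tau> s, t := ?\<tau> t + ?\<tau> s, s := 0) = \<sigma>(d := \<sigma> d + \<sigma> s, t := \<sigma> t + \<sigma> s, s := 0)"
      using Suc(2) assms by (auto simp: fun_eq_iff)
    ultimately show ?case using Suc(2) by (metis runs_WhileS Zero_not_Suc)
  qed
  note W = this[of \<sigma>]
  let ?\<tau> = "\<sigma>(d := \<sigma> d + \<sigma> s, t := \<sigma> t + \<sigma> s, s := 0)"
  have "?\<tau>(s := ?\<tau> s + ?\<tau> t, t := 0) = \<sigma>(d := \<sigma> d + \<sigma> s)" using assms by (auto simp: fun_eq_iff)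
  then show ?thesis unfolding copy_def using runs_Seq[OF W runs_move[of t s ?\<tau>]] assms by simp
qed

text \<open>Registers from b on are scratch space, which is zero before and after. Only the direction from
  rec_eval to programs is needed, since f is total on codes of automata.\<close>
definition compilable :: "recf \<Rightarrow> bool" where
  "compilable f \<longleftrightarrow> (\<forall>ins out b. (\<forall>i\<in>set ins. i < b) \<longrightarrow> out < b \<longrightarrow> out \<notin> set ins \<longrightarrow>
     (\<exists>c. \<forall>\<sigma> y. rec_eval f (map \<sigma> ins) y \<longrightarrow> \<sigma> out = 0 \<longrightarrow> (\<forall>r\<ge>b. \<sigma> r = 0) \<longrightarrow> runs c \<sigma> (\<sigma>(out := y))))"

lemma compilableE:
  assumes "compilable f" "\<forall>i\<in>set ins. i < b" "out < b" "out \<notin> set ins"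
  obtains c where "\<And>\<sigma> y. rec_eval f (map \<sigma> ins) y \<Longrightarrow> \<sigma> out = 0 \<Longrightarrow> \<forall>r\<ge>b. \<sigma> r = 0 \<Longrightarrow>
     runs c \<sigma> (\<sigma>(out := y))"
  using assms unfolding compilable_def by metis

lemma compilableI:
  assumes "\<And>ins out b. \<forall>i\<in>set ins. i < b \<Longrightarrow> out < b \<Longrightarrow> out \<notin> set ins \<Longrightarrow>
     \<exists>c. \<forall>\<sigma> y. rec_eval f (map \<sigma> ins) y \<longrightarrow> \<sigma> out = 0 \<longrightarrow> (\<forall>r\<ge>b. \<sigma> r = 0) \<longrightarrow> runs c \<sigma> (\<sigma>(out := y))"
  shows "compilable f"
  unfolding compilable_def by (intro allI impI) (rule assms)

section \<open>Compilation of recursive functions, constructor by constructor\<close>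

inductive_cases rec_eval_ZE: "rec_eval Z xs y"
inductive_cases rec_eval_SE: "rec_eval S xs y"
inductive_cases rec_eval_ProjE: "rec_eval (Proj i) xs y"
inductive_cases rec_eval_CompE: "rec_eval (Comp f gs) xs y"
inductive_cases rec_eval_PrimE: "rec_eval (Prim f g) xs y"
inductive_cases rec_eval_Prim0E: "rec_eval (Prim f g) (0 # xs) y"
inductive_cases rec_eval_PrimSE: "rec_eval (Prim f g) (Suc n # xs) y"
inductive_cases rec_eval_MnE: "rec_eval (Mn f) xs y"

lemma compilable_Z: "compilable Z"
  by (rule compilableI, rule exI[of _ CSkip]) (auto elim!: rec_eval_ZE simp: fun_upd_idem runs_Skip)

lemma compilable_S: "compilable S"
proof (rule compilableI)
  fix ins out and b :: nat assume a: "\<forall>i\<in>set ins. i < b" "out < b" "out \<notin> set ins"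
  show "\<exists>c. \<forall>\<sigma> y. rec_eval S (map \<sigma> ins) y \<longrightarrow> \<sigma> out = 0 \<longrightarrow> (\<forall>r\<ge>b. \<sigma> r = 0) \<longrightarrow> runs c \<sigma> (\<sigma>(out := y))"
  proof (intro exI[of _ "CSeq (copy (hd ins) out b) (CInc out)"] allI impI)
    fix \<sigma> y assume "rec_eval S (map \<sigma> ins) y" and s: "\<sigma> out = 0" "\<forall>r\<ge>b. \<sigma> r = 0"
    then have "ins \<noteq> []" "y = Suc (\<sigma> (hd ins))" by (auto elim!: rec_eval_SE)
    then show "runs (CSeq (copy (hd ins) out b) (CInc out)) \<sigma> (\<sigma>(out := y))"
      using runs_Seq[OF runs_copy runs_Inc, of "hd ins" out b \<sigma> out] a s hd_in_set[of ins] by force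
  qed
qed

lemma compilable_Proj: "compilable (Proj i)"
proof (rule compilableI)
  fix ins out and b :: nat assume a: "\<forall>i\<in>set ins. i < b" "out < b" "out \<notin> set ins"
  show "\<exists>c. \<forall>\<sigma> y. rec_eval (Proj i) (map \<sigma> ins) y \<longrightarrow> \<sigma> out = 0 \<longrightarrow> (\<forall>r\<ge>b. \<sigma> r = 0) \<longrightarrow> runs c \<sigma> (\<sigma>(out := y))"
  proof (intro exI[of _ "copy (ins ! i) out b"] allI impI)
    fix \<sigma> y assume "rec_eval (Proj i) (map \<sigma> ins) y" and s: "\<sigma> out = 0" "\<forall>r\<ge>b. \<sigma> r = 0"
    then have "i < length ins" "y = \<sigma> (ins ! i)" by (auto elim!: rec_eval_ProjE)
    then show "runs (copy (ins ! i) out b) \<sigma> (\<sigma>(out := y))"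
      using runs_copy[of "ins ! i" out b \<sigma>] a s nth_mem[of i ins] by force
  qed
qed

lemma compilable_Comp:
  assumes f: "compilable f" and gs: "\<And>g. g \<in> set gs \<Longrightarrow> compilable g"
  shows "compilable (Comp f gs)"
proof (rule compilableI)
  fix ins out and b :: nat assume a: "\<forall>i\<in>set ins. i < b" "out < b" "out \<notin> set ins"
  let ?m = "length gs"
  have "\<exists>c. \<forall>\<sigma> y. rec_eval (gs ! j) (map \<sigma> ins) y \<longrightarrow> \<sigma> (b + j) = 0 \<longrightarrow> (\<forall>r\<ge>b + ?m. \<sigma> r = 0)
     \<longrightarrow> runs c \<sigma> (\<sigma>(b + j := y))" if j: "j < ?m" for j
  proof -
    have "\<forall>i\<in>set ins. i < b + ?m" "b + j < b + ?m" "b + j \<notin> set ins" using a j by fastforce+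
    then show ?thesis using compilableE[OF gs[OF nth_mem[OF j]]] by (metis (lifting))
  qed
  then obtain c where c: "\<And>j \<sigma> y. j < ?m \<Longrightarrow> rec_eval (gs ! j) (map \<sigma> ins) y \<Longrightarrow> \<sigma> (b + j) = 0
     \<Longrightarrow> \<forall>r\<ge>b + ?m. \<sigma> r = 0 \<Longrightarrow> runs (c j) \<sigma> (\<sigma>(b + j := y))" by metis
  obtain d where d: "\<And>\<sigma> y. rec_eval f (map \<sigma> [b..<b + ?m]) y \<Longrightarrow> \<sigma> out = 0 \<Longrightarrow> \<forall>r\<ge>b + ?m. \<sigma> r = 0 \<Longrightarrow>
     runs d \<sigma> (\<sigma>(out := y))"
    by (rule compilableE[OF f, of "[b..<b + ?m]" "b + ?m" out]) (use a in auto)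
  let ?c = "CSeq (seqs (map c [0..<?m])) (CSeq d (seqs (map (\<lambda>j. clear (b + j)) [0..<?m])))"
  have "runs ?c \<sigma> (\<sigma>(out := z))"
    if ev: "rec_eval (Comp f gs) (map \<sigma> ins) z" and s: "\<sigma> out = 0" "\<forall>r\<ge>b. \<sigma> r = 0" for \<sigma> z
  proof -
    obtain ys where ys: "length ys = ?m" "\<And>i. i < ?m \<Longrightarrow> rec_eval (gs ! i) (map \<sigma> ins) (ys ! i)" "rec_eval f ys z"
      using ev by (auto elim: rec_eval_CompE)
    \<comment> \<open>Register contents after l arguments have been computed, argument j being kept
      in register \<open>b + j\<close>.\<close>
    define st where "st l r = (if b \<le> r \<and> r < b + l then ys ! (r - b) else \<sigma> r)" for l r
    have "runs (c j) (st j) (st (Suc j))" if j: "j < ?m" for j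
    proof -
      have eq: "map (st j) ins = map \<sigma> ins" using a by (force simp: st_def)
      have "runs (c j) (st j) ((st j)(b + j := ys ! j))"
        using c[OF j, of "st j" "ys ! j", unfolded eq, OF ys(2)[OF j]] s j by (simp add: st_def)
      moreover have "(st j)(b + j := ys ! j) = st (Suc j)" by (auto simp: st_def fun_eq_iff)
      ultimately show ?thesis by simp
    qed
    then have r1: "runs (seqs (map c [0..<?m])) (st 0) (st ?m)"
      using runs_seqs[of "map c [0..<?m]" st] by simp
    have st0: "st 0 = \<sigma>" by (auto simp: st_def)
    have "map (st ?m) [b..<b + ?m] = ys"
      by (rule nth_equalityI) (auto simp: st_def ys(1))
    then have r2: "runs d (st ?m) ((st ?m)(out := z))"
      using d[of "st ?m" z] ys(3) s a by (auto simp: st_def)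
    \<comment> \<open>Register contents after the first l arguments have been erased again.\<close>
    define st' where "st' l r = (if b + l \<le> r \<and> r < b + ?m then ys ! (r - b) else (\<sigma>(out := z)) r)" for l r
    have "runs (clear (b + j)) (st' j) (st' (Suc j))" if j: "j < ?m" for j
    proof -
      have "(st' j)(b + j := 0) = st' (Suc j)"
        using s a j by (auto simp: st'_def fun_eq_iff)
      then show ?thesis using runs_clear[of "b + j" "st' j"] by simp
    qed
    then have r3: "runs (seqs (map (\<lambda>j. clear (b + j)) [0..<?m])) (st' 0) (st' ?m)"
      using runs_seqs[of "map (\<lambda>j. clear (b + j)) [0..<?m]" st'] by simp
    have "(st ?m)(out := z) = st' 0" "st' ?m = \<sigma>(out := z)" using a by (auto simp: st'_def st_def fun_eq_iff)
    then show ?thesis using runs_Seq[OF r1 runs_Seq[OF r2]] r3 st0 by simp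
  qed
  then show "\<exists>c. \<forall>\<sigma> y. rec_eval (Comp f gs) (map \<sigma> ins) y \<longrightarrow> \<sigma> out = 0 \<longrightarrow> (\<forall>r\<ge>b. \<sigma> r = 0) \<longrightarrow> runs c \<sigma> (\<sigma>(out := y))"
    by blast
qed

lemma compilable_Prim:
  assumes f: "compilable f" and g: "compilable g"
  shows "compilable (Prim f g)"
proof (rule compilableI)
  fix ins out and b :: nat assume a: "\<forall>i\<in>set ins. i < b" "out < b" "out \<notin> set ins"
  show "\<exists>c. \<forall>\<sigma> y. rec_eval (Prim f g) (map \<sigma> ins) y \<longrightarrow> \<sigma> out = 0 \<longrightarrow> (\<forall>r\<ge>b. \<sigma> r = 0) \<longrightarrow> runs c \<sigma> (\<sigma>(out := y))"
  proof (cases ins)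
    case Nil then show ?thesis by (auto elim: rec_eval_PrimE)
  next
    case (Cons r0 rs)
    obtain cf where cf: "\<And>\<sigma> y. rec_eval f (map \<sigma> rs) y \<Longrightarrow> \<sigma> (b + 1) = 0 \<Longrightarrow> \<forall>r\<ge>b + 4. \<sigma> r = 0 \<Longrightarrow>
        runs cf \<sigma> (\<sigma>(b + 1 := y))"
      by (rule compilableE[OF f, of rs "b + 4" "b + 1"]) (use a Cons in fastforce)+
    obtain cg where cg: "\<And>\<sigma> y. rec_eval g (map \<sigma> ((b + 1) # b # rs)) y \<Longrightarrow> \<sigma> (b + 2) = 0 \<Longrightarrow> \<forall>r\<ge>b + 4. \<sigma> r = 0 \<Longrightarrow>
        runs cg \<sigma> (\<sigma>(b + 2 := y))"
      by (rule compilableE[OF g, of "(b + 1) # b # rs" "b + 4" "b + 2"]) (use a Cons in fastforce)+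
    \<comment> \<open>Register b holds the iteration index, \<open>b + 1\<close> the current value,
      \<open>b + 2\<close> the next value and \<open>b + 3\<close> the number of iterations left;
      from \<open>b + 4\<close> on there is scratch space.\<close>
    let ?B = "CSeq (CDec (b + 3)) (CSeq cg (CSeq (clear (b + 1)) (CSeq (move (b + 2) (b + 1)) (CInc b))))"
    let ?W = "CWhile (b + 3) ?B"
    let ?c = "CSeq cf (CSeq (copy r0 (b + 3) (b + 4)) (CSeq ?W (CSeq (move (b + 1) out) (clear b))))"
    have "runs ?c \<sigma> (\<sigma>(out := z))"
      if ev: "rec_eval (Prim f g) (map \<sigma> ins) z" and s: "\<sigma> out = 0" "\<forall>r\<ge>b. \<sigma> r = 0" for \<sigma> z
    proof -
      define st where "st m y d = \<sigma>(b := m, b + 1 := y, b + 3 := d)" for m y d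
      have rs: "map (st m y d) rs = map \<sigma> rs" for m y d using a Cons by (force simp: st_def)
      have r0: "r0 < b" using a Cons by simp
      have B: "runs ?B (st n y (Suc d)) (st (Suc n) y' d)" if "rec_eval g (y # n # map \<sigma> rs) y'" for n y y' d
      proof -
        have "map (st n y d) ((b + 1) # b # rs) = y # n # map \<sigma> rs"
          using rs[of n y d] by (simp only: list.map) (simp add: st_def)
        then have "rec_eval g (map (st n y d) ((b + 1) # b # rs)) y'" using that by (simp only:)
        then have 2: "runs cg (st n y d) ((st n y d)(b + 2 := y'))"
          using s by (intro cg) (auto simp: st_def)
        have 1: "runs (CDec (b + 3)) (st n y (Suc d)) (st n y d)"
          using runs_Dec[of "b + 3" "st n y (Suc d)"] by (simp add: st_def)
        have 3: "runs (clear (b + 1)) ((st n y d)(b + 2 := y')) ((st n y d)(b + 2 := y', b + 1 := 0))"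
          by (rule runs_clear)
        have "(st n y d)(b + 2 := y', b + 1 := y', b + 2 := 0) = st n y' d"
          using s by (auto simp: st_def fun_eq_iff)
        then have 4: "runs (move (b + 2) (b + 1)) ((st n y d)(b + 2 := y', b + 1 := 0)) (st n y' d)"
          using runs_move[of "b + 2" "b + 1" "(st n y d)(b + 2 := y', b + 1 := 0)"] by simp
        have "(st n y' d)(b := Suc n) = st (Suc n) y' d" by (auto simp: st_def fun_eq_iff)
        then have 5: "runs (CInc b) (st n y' d) (st (Suc n) y' d)"
          using runs_Inc[of b "st n y' d"] by (simp add: st_def)
        show ?thesis by (rule runs_Seq[OF 1 runs_Seq[OF 2 runs_Seq[OF 3 runs_Seq[OF 4 5]]]])
      qed
      \<comment> \<open>Stated backwards, for an arbitrary final state, because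
        \<open>runs_WhileS\<close> adds iterations in front: what the loop does from index n with d
        iterations left, it does from index 0 with \<open>n + d\<close> left.\<close>
      have W: "rec_eval (Prim f g) (n # map \<sigma> rs) y \<Longrightarrow>
         \<exists>y0. rec_eval f (map \<sigma> rs) y0 \<and> (\<forall>d \<upsilon>. runs ?W (st n y d) \<upsilon> \<longrightarrow> runs ?W (st 0 y0 (n + d)) \<upsilon>)" for n y
      proof (induction n arbitrary: y)
        case 0 then show ?case by (auto elim: rec_eval_Prim0E)
      next
        case (Suc n)
        then obtain y' where y': "rec_eval (Prim f g) (n # map \<sigma> rs) y'" "rec_eval g (y' # n # map \<sigma> rs) y"
          by (auto elim: rec_eval_PrimSE)
        from Suc.IH[OF y'(1)] obtain y0 where y0: "rec_eval f (map \<sigma> rs) y0"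
          "\<And>d \<upsilon>. runs ?W (st n y' d) \<upsilon> \<Longrightarrow> runs ?W (st 0 y0 (n + d)) \<upsilon>" by blast
        have "runs ?W (st 0 y0 (Suc n + d)) \<upsilon>" if "runs ?W (st (Suc n) y d) \<upsilon>" for d \<upsilon>
        proof -
          have "st n y' (Suc d) (b + 3) \<noteq> 0" by (simp add: st_def)
          then have "runs ?W (st n y' (Suc d)) \<upsilon>" using B[OF y'(2)] that by (rule runs_WhileS)
          then show ?thesis using y0(2)[of "Suc d"] by simp
        qed
        then show ?case using y0(1) by blast
      qed
      have "rec_eval (Prim f g) (\<sigma> r0 # map \<sigma> rs) z" using ev Cons by simp
      from W[OF this] obtain y0 where y0: "rec_eval f (map \<sigma> rs) y0"
        "runs ?W (st (\<sigma> r0) z 0) (st (\<sigma> r0) z 0) \<Longrightarrow> runs ?W (st 0 y0 (\<sigma> r0)) (st (\<sigma> r0) z 0)"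
        by (metis add.right_neutral)
      have 3: "runs ?W (st 0 y0 (\<sigma> r0)) (st (\<sigma> r0) z 0)"
        by (rule y0(2), rule runs_While0) (simp add: st_def)
      have 1: "runs cf \<sigma> (\<sigma>(b + 1 := y0))" using s y0 by (intro cf) auto
      have "(\<sigma>(b + 1 := y0))(b + 3 := \<sigma> r0) = st 0 y0 (\<sigma> r0)" using s by (auto simp: st_def fun_eq_iff)
      then have 2: "runs (copy r0 (b + 3) (b + 4)) (\<sigma>(b + 1 := y0)) (st 0 y0 (\<sigma> r0))"
        using runs_copy[of r0 "b + 3" "b + 4" "\<sigma>(b + 1 := y0)"] r0 s by simp
      have 4: "runs (move (b + 1) out) (st (\<sigma> r0) z 0) ((st (\<sigma> r0) z 0)(out := z, b + 1 := 0))"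
        using runs_move[of "b + 1" out "st (\<sigma> r0) z 0"] a s by (simp add: st_def)
      have "(st (\<sigma> r0) z 0)(out := z, b + 1 := 0, b := 0) = \<sigma>(out := z)"
        using a s by (auto simp: st_def fun_eq_iff)
      then have 5: "runs (clear b) ((st (\<sigma> r0) z 0)(out := z, b + 1 := 0)) (\<sigma>(out := z))"
        using runs_clear[of b] by metis
      show ?thesis by (rule runs_Seq[OF 1 runs_Seq[OF 2 runs_Seq[OF 3 runs_Seq[OF 4 5]]]])
    qed
    then show ?thesis by blast
  qed
qed

lemma compilable_Mn:
  assumes f: "compilable f"
  shows "compilable (Mn f)"
proof (rule compilableI)
  fix ins out and b :: nat assume a: "\<forall>i\<in>set ins. i < b" "out < b" "out \<notin> set ins"
  obtain c where c: "\<And>\<sigma> y. rec_eval f (map \<sigma> (b # ins)) y \<Longrightarrow> \<sigma> (b + 1) = 0 \<Longrightarrow> \<forall>r\<ge>b + 2. \<sigma> r = 0 \<Longrightarrow>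
      runs c \<sigma> (\<sigma>(b + 1 := y))"
    by (rule compilableE[OF f, of "b # ins" "b + 2" "b + 1"]) (use a in fastforce)+
  \<comment> \<open>Register b holds the candidate and \<open>b + 1\<close> the value of f there;
    the loop runs while this value is positive.\<close>
  let ?B = "CSeq (clear (b + 1)) (CSeq (CInc b) c)"
  let ?W = "CWhile (b + 1) ?B"
  let ?c = "CSeq c (CSeq ?W (move b out))"
  have "runs ?c \<sigma> (\<sigma>(out := n))"
    if ev: "rec_eval (Mn f) (map \<sigma> ins) n" and s: "\<sigma> out = 0" "\<forall>r\<ge>b. \<sigma> r = 0" for \<sigma> n
  proof -
    define st where "st m v = \<sigma>(b := m, b + 1 := v)" for m v
    have ins: "map (st m v) (b # ins) = m # map \<sigma> ins" for m v using a by (force simp: st_def)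
    have ev: "rec_eval f (n # map \<sigma> ins) 0" "\<And>m. m < n \<Longrightarrow> \<exists>y. rec_eval f (m # map \<sigma> ins) (Suc y)"
      using ev by (auto elim: rec_eval_MnE)
    have c': "runs c (st m 0) (st m v)" if "rec_eval f (m # map \<sigma> ins) v" for m v
      using c[of "st m 0" v] that s unfolding ins by (simp add: st_def)
    have B: "runs ?B (st m v) (st (Suc m) v')" if "rec_eval f (Suc m # map \<sigma> ins) v'" for m v v'
    proof -
      have "(st m 0)(b := Suc m) = st (Suc m) 0" by (auto simp: st_def fun_eq_iff)
      then have "runs (CInc b) (st m 0) (st (Suc m) 0)" using runs_Inc[of b "st m 0"] by (simp add: st_def)
      moreover have "runs (clear (b + 1)) (st m v) (st m 0)" using runs_clear[of "b + 1" "st m v"] by (simp add: st_def)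
      ultimately show ?thesis using c'[OF that] runs_Seq by blast
    qed
    \<comment> \<open>Induction on the distance j of the candidate from the minimum n.\<close>
    have W: "j \<le> n \<Longrightarrow> rec_eval f ((n - j) # map \<sigma> ins) v \<Longrightarrow> v = 0 \<longleftrightarrow> j = 0 \<Longrightarrow> runs ?W (st (n - j) v) (st n 0)" for j v
    proof (induction j arbitrary: v)
      case 0 then show ?case by (auto intro!: runs_While0 simp: st_def)
    next
      case (Suc j)
      have eq: "Suc (n - Suc j) = n - j" using Suc by simp
      obtain v' where v': "rec_eval f ((n - j) # map \<sigma> ins) v'" "v' = 0 \<longleftrightarrow> j = 0"
        using ev Suc.prems(1) by (cases j) (auto, metis diff_less le_simps(3) less_Suc_eq_0_disj less_le_trans nat.simps(3) zero_less_Suc)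
      have "runs ?W (st (n - j) v') (st n 0)" using Suc.prems(1) v' by (intro Suc.IH) auto
      moreover have "runs ?B (st (n - Suc j) v) (st (n - j) v')" using B[of "n - Suc j" v' v] v' eq by simp
      moreover have "st (n - Suc j) v (b + 1) \<noteq> 0" using Suc.prems(3) by (simp add: st_def)
      ultimately show ?case by (metis runs_WhileS)
    qed
    obtain v where v: "rec_eval f (0 # map \<sigma> ins) v" "v = 0 \<longleftrightarrow> n = 0" using ev by (cases n) auto
    have 2: "runs ?W (st 0 v) (st n 0)" using W[of n v] v by simp
    have "st 0 0 = \<sigma>" using s by (auto simp: st_def fun_eq_iff)
    then have 1: "runs c \<sigma> (st 0 v)" using c'[OF v(1)] by simp
    have "(st n 0)(out := n, b := 0) = \<sigma>(out := n)" using a s by (auto simp: st_def fun_eq_iff)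
    then have 3: "runs (move b out) (st n 0) (\<sigma>(out := n))"
      using runs_move[of b out "st n 0"] a s by (simp add: st_def)
    show ?thesis by (rule runs_Seq[OF 1 runs_Seq[OF 2 3]])
  qed
  then show "\<exists>c. \<forall>\<sigma> y. rec_eval (Mn f) (map \<sigma> ins) y \<longrightarrow> \<sigma> out = 0 \<longrightarrow> (\<forall>r\<ge>b. \<sigma> r = 0) \<longrightarrow> runs c \<sigma> (\<sigma>(out := y))"
    by blast
qed

lemma compilable: "compilable f"
  by (induction f) (auto intro: compilable_Z compilable_S compilable_Proj compilable_Comp compilable_Prim compilable_Mn)

section \<open>Halting of counter programs\<close>

definition halts :: "com \<Rightarrow> nat \<Rightarrow> bool" where
  "halts c k \<longleftrightarrow> (\<exists>n. fst ((step ^^ n) ([c], (\<lambda>_. 0)(0 := k))) = [])"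

lemma step_Nil: "step ([], \<sigma>) = ([], \<sigma>)"
  by (simp add: step_def fun_upd_idem)

lemma halts_mono:
  assumes n: "fst ((step ^^ n) x) = []" and "n \<le> m"
  shows "fst ((step ^^ m) x) = []"
proof -
  have "fst ((step ^^ (n + i)) x) = []" for i
  proof (induction i)
    case (Suc i)
    then have "(step ^^ (n + i)) x = ([], snd ((step ^^ (n + i)) x))" by (metis prod.collapse)
    then have "step ((step ^^ (n + i)) x) = ([], snd ((step ^^ (n + i)) x))" using step_Nil by metis
    then show ?case by simp
  qed (use n in simp)
  then show ?thesis using \<open>n \<le> m\<close> le_Suc_ex by blast
qed

text \<open>After computing f into register 1, the program enters a loop that only increments this
  register, so it stops exactly on the value 0.\<close>

lemma halting_program:
  "\<exists>c. \<forall>k y. rec_eval f [k] y \<longrightarrow> (halts c k \<longleftrightarrow> y = 0)"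
proof -
  obtain c where c: "\<And>\<sigma> y. rec_eval f (map \<sigma> [0]) y \<Longrightarrow> \<sigma> 1 = 0 \<Longrightarrow> \<forall>r\<ge>2. \<sigma> r = 0 \<Longrightarrow>
      runs c \<sigma> (\<sigma>(1 := y))"
    by (rule compilableE[OF compilable, of "[0]" 2 1]) auto
  let ?W = "CWhile 1 (CInc 1)"
  have "halts (CSeq c ?W) k \<longleftrightarrow> y = 0" if ev: "rec_eval f [k] y" for k y
  proof -
    let ?\<sigma> = "(\<lambda>_. 0)(0 := k) :: nat \<Rightarrow> nat"
    let ?\<tau> = "?\<sigma>(1 := y)"
    have "runs c ?\<sigma> ?\<tau>" using ev by (intro c) auto
    then obtain n where "(step ^^ n) ([c, ?W], ?\<sigma>) = ([?W], ?\<tau>)" unfolding runs_def by blast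
    moreover have "(step ^^ 1) ([CSeq c ?W], ?\<sigma>) = ([c, ?W], ?\<sigma>)" by (simp add: step_def fun_upd_idem)
    ultimately have n: "(step ^^ (n + 1)) ([CSeq c ?W], ?\<sigma>) = ([?W], ?\<tau>)" using funpow_chain by metis
    show ?thesis
    proof
      assume "y = 0"
      then have "step ([?W], ?\<tau>) = ([], ?\<tau>)" by (simp add: step_def fun_upd_idem)
      then have "fst ((step ^^ Suc (n + 1)) ([CSeq c ?W], ?\<sigma>)) = []" using n by simp
      then show "halts (CSeq c ?W) k" unfolding halts_def by blast
    next
      assume h: "halts (CSeq c ?W) k"
      show "y = 0"
      proof (rule ccontr)
        assume y: "y \<noteq> 0"
        have inv: "\<exists>cs \<sigma>. (step ^^ j) ([?W], ?\<tau>) = (cs, \<sigma>) \<and> 0 < \<sigma> 1 \<and> (cs = [?W] \<or> cs = [CInc 1, ?W])" for j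
        proof (induction j)
          case (Suc j) then show ?case by (auto simp: step_def)
        qed (use y in simp)
        obtain m where m: "fst ((step ^^ m) ([CSeq c ?W], ?\<sigma>)) = []" using h unfolding halts_def by blast
        have "(step ^^ (m + (n + 1))) ([CSeq c ?W], ?\<sigma>) = (step ^^ m) ([?W], ?\<tau>)"
          using funpow_chain[OF n refl] .
        moreover have "fst ((step ^^ (m + (n + 1))) ([CSeq c ?W], ?\<sigma>)) = []"
          by (rule halts_mono[OF m]) simp
        ultimately show False using inv[of m] by auto
      qed
    qed
  qed
  then show ?thesis by blast
qed

section \<open>The trace of a program\<close>

text \<open>The program points: the stacks met while c runs in front of cs. Their finiteness makes
  the control finite.\<close>

fun conts :: "com \<Rightarrow> com list \<Rightarrow> com list set" where
  "conts (CSeq a b) cs = insert (CSeq a b # cs) (conts a (b # cs) \<union> conts b cs)"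
| "conts (CWhile r c) cs = insert (CWhile r c # cs) (conts c (CWhile r c # cs))"
| "conts c cs = {c # cs}"

fun max_reg :: "com \<Rightarrow> nat" where
  "max_reg (CSeq a b) = max (max_reg a) (max_reg b)"
| "max_reg (CWhile r c) = max r (max_reg c)"
| "max_reg (CInc r) = r"
| "max_reg (CDec r) = r"
| "max_reg CSkip = 0"

lemma finite_conts: "finite (conts c cs)"
  by (induction c arbitrary: cs) auto

lemma conts_self: "c # cs \<in> conts c cs"
  by (cases c) auto

lemma conts_nxt: "x \<in> conts c cs \<Longrightarrow> nxt x z \<in> insert cs (conts c cs)"
proof (induction c arbitrary: cs)
  case (CSeq a b)
  then show ?case using conts_self[of a "b # cs"] conts_self[of b cs] by fastforce
next
  case (CWhile r c)
  then show ?case using conts_self[of c "CWhile r c # cs"] by fastforce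
qed auto

lemma conts_reg: "x \<in> conts c cs \<Longrightarrow> reg x \<le> max_reg c"
  by (induction c arbitrary: cs) fastforce+

definition config :: "com \<Rightarrow> nat \<Rightarrow> nat \<Rightarrow> com list \<times> (nat \<Rightarrow> nat)" where
  "config c k t = (step ^^ t) ([c], (\<lambda>_. 0)(0 := k))"

lemma config_0: "config c k 0 = ([c], (\<lambda>_. 0)(0 := k))"
  by (simp add: config_def)

lemma config_Suc: "config c k (Suc t) = step (config c k t)"
  by (simp add: config_def)

lemma config_conts: "fst (config c k t) \<in> insert [] (conts c [])"
proof (induction t)
  case 0 show ?case using conts_self[of c "[]"] by (simp add: config_0)
next
  case (Suc t)
  obtain cs \<sigma> where "config c k t = (cs, \<sigma>)" by fastforce
  then show ?case using Suc conts_nxt[of cs c "[]" "0 < \<sigma> (reg cs)"]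
    by (auto simp: config_Suc step_def Let_def)
qed

text \<open>The computation is spelled as a sequence of blocks, K blocks (one per register) for each step, so
  that block i + K arises from block i by an operation that a finite control determines. The flag
  records whether the register tested by the current step, if already passed, is nonzero.\<close>
type_synonym ctl = "com list \<times> nat \<times> bool"

definition ctl_next :: "nat \<Rightarrow> ctl \<Rightarrow> bool \<Rightarrow> ctl" where
  "ctl_next K = (\<lambda>(cs, j, z) nz. let z' = (if j = reg cs then nz else z) in
     if Suc j = K then (nxt cs z', 0, False) else (cs, Suc j, z'))"

definition ctl_op :: "ctl \<Rightarrow> bool \<Rightarrow> cop" where
  "ctl_op = (\<lambda>(cs, j, z) nz. if j = reg cs then opr cs nz else Keep)"

definition trace_block :: "com \<Rightarrow> nat \<Rightarrow> nat \<Rightarrow> nat \<Rightarrow> nat" where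
  "trace_block c K k i = snd (config c k (i div K)) (i mod K)"

definition trace_ctl :: "com \<Rightarrow> nat \<Rightarrow> nat \<Rightarrow> nat \<Rightarrow> ctl" where
  "trace_ctl c K k i = (case config c k (i div K) of (cs, \<sigma>) \<Rightarrow>
     (cs, i mod K, reg cs < i mod K \<and> 0 < \<sigma> (reg cs)))"

lemma trace_block_add:
  assumes "0 < K"
  shows "trace_block c K k (i + K) = cop_app (ctl_op (trace_ctl c K k i) (0 < trace_block c K k i)) (trace_block c K k i)"
proof (cases "config c k (i div K)")
  case (Pair cs \<sigma>)
  have "(i + K) div K = Suc (i div K)" "(i + K) mod K = i mod K" using assms by auto
  then show ?thesis using Pair
    by (auto simp: trace_block_def trace_ctl_def ctl_op_def config_Suc step_def Let_def)
qed

text \<open>The tested register is below K and therefore met in every round; when the round ends,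
  the test result is available for \<open>nxt\<close>.\<close>

lemma trace_ctl_Suc:
  assumes "max_reg c < K"
  shows "trace_ctl c K k (Suc i) = ctl_next K (trace_ctl c K k i) (0 < trace_block c K k i)"
proof (cases "config c k (i div K)")
  case (Pair cs \<sigma>)
  have r: "reg cs < K"
    using config_conts[of c k "i div K"] conts_reg[of cs c "[]"] assms Pair by auto
  show ?thesis
  proof (cases "Suc (i mod K) = K")
    case True
    then have "Suc i mod K = 0" "Suc i div K = Suc (i div K)" by (auto simp: mod_Suc div_Suc)
    then show ?thesis using Pair True r
      by (auto simp: trace_block_def trace_ctl_def ctl_next_def config_Suc step_def Let_def less_Suc_eq)
  next
    case False
    then have "Suc i mod K = Suc (i mod K)" "Suc i div K = i div K" by (auto simp: mod_Suc div_Suc)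
    then show ?thesis using Pair False
      by (auto simp: trace_block_def trace_ctl_def ctl_next_def Let_def less_Suc_eq)
  qed
qed

section \<open>Abstract machines on a rotating sequence of blocks\<close>

locale rotating_machine =
  fixes K :: nat and p0 :: 'p and nx :: "'p \<Rightarrow> bool \<Rightarrow> 'p" and dl :: "'p \<Rightarrow> bool \<Rightarrow> cop"
    and H :: "'p set" and P :: "'p set"
  assumes K_pos: "0 < K" and finite_P: "finite P" and H_P: "H \<subseteq> P" and p0_P: "p0 \<in> P"
    and nx_P: "p \<in> P \<Longrightarrow> nx p z \<in> P" and dl_False: "dl p False \<noteq> Dec"

text \<open>b gives the block lengths and \<open>cp i\<close> the control in front of block i. As an
  empty block is never decremented (\<open>dl_False\<close>), \<open>cop_app\<close> is exact
  addition.\<close>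

locale machine_trace = rotating_machine +
  fixes k :: nat and b :: "nat \<Rightarrow> nat" and cp :: "nat \<Rightarrow> 'a"
  assumes b_0: "b 0 = k" and b_init: "0 < i \<Longrightarrow> i < K \<Longrightarrow> b i = 0"
    and cp_0: "cp 0 = p0" and cp_Suc: "cp (Suc i) = nx (cp i) (0 < b i)"
    and b_add: "b (i + K) = cop_app (dl (cp i) (0 < b i)) (b i)"

lemma com_rotating_machine:
  assumes "max_reg c < K"
  shows "rotating_machine K ([c], 0, False) (ctl_next K) ctl_op ({[]} \<times> {..<K} \<times> UNIV)
     (insert [] (conts c []) \<times> {..<K} \<times> UNIV)"
proof
  show "0 < K" using assms by simp
  show "{[]} \<times> {..<K} \<times> UNIV \<subseteq> insert [] (conts c []) \<times> {..<K} \<times> (UNIV :: bool set)" by auto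
  show "finite (insert [] (conts c []) \<times> {..<K} \<times> (UNIV :: bool set))" by (simp add: finite_conts)
  show "([c], 0, False) \<in> insert [] (conts c []) \<times> {..<K} \<times> UNIV"
    using assms conts_self[of c "[]"] by auto
  show "ctl_op p False \<noteq> Dec" for p
    by (cases p; cases "fst p"; cases "hd (fst p)") (auto simp: ctl_op_def)
  show "ctl_next K p z \<in> insert [] (conts c []) \<times> {..<K} \<times> UNIV"
    if "p \<in> insert [] (conts c []) \<times> {..<K} \<times> UNIV" for p z
    using that assms conts_nxt[of "fst p" c "[]"] by (auto simp: ctl_next_def Let_def)
qed

lemma com_machine_trace:
  assumes "max_reg c < K"
  shows "machine_trace K ([c], 0, False) (ctl_next K) ctl_op ({[]} \<times> {..<K} \<times> UNIV)
     (insert [] (conts c []) \<times> {..<K} \<times> UNIV) k (trace_block c K k) (trace_ctl c K k)"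
  unfolding machine_trace_def machine_trace_axioms_def
  using assms com_rotating_machine[OF assms] trace_ctl_Suc[OF assms] trace_block_add[of K c k]
  by (auto simp: trace_block_def trace_ctl_def config_0)

lemma halts_iff_trace:
  assumes "0 < K"
  shows "halts c k \<longleftrightarrow> (\<exists>i. fst (trace_ctl c K k i) = [])"
proof
  assume "halts c k"
  then obtain n where "fst (config c k n) = []" by (auto simp: halts_def config_def)
  then have "fst (trace_ctl c K k (n * K)) = []"
    using assms by (auto simp: trace_ctl_def split: prod.split)
  then show "\<exists>i. fst (trace_ctl c K k i) = []" by blast
next
  assume "\<exists>i. fst (trace_ctl c K k i) = []"
  then obtain i where "fst (config c k (i div K)) = []" by (metis (no_types, lifting) case_prod_beta fst_conv trace_ctl_def)
  then show "halts c k" by (auto simp: halts_def config_def)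
qed

section \<open>The automaton\<close>

datatype 'p st = Init | Done | Fin | Pump | Wait | Chain nat | Zer nat | Trk 'p bool | Cmp bool 'p bool
  | Mid bool nat | LenA | LenB | Y1 | Y2 | X1 | X2 | XA

instance st :: (countable) countable
  by countable_datatype

fun cop_neg :: "cop \<Rightarrow> cop" where
  "cop_neg Inc = Dec" | "cop_neg Dec = Inc" | "cop_neg Keep = Keep"

lemma cop_delta_neg [simp]: "cop_delta (cop_neg d) = - cop_delta d"
  by (cases d) auto

definition sgd :: "bool \<Rightarrow> cop \<Rightarrow> cop" where
  "sgd g d = (if g then d else cop_neg d)"

definition sg :: "bool \<Rightarrow> int" where "sg g = (if g then 1 else -1)"

lemma cop_delta_sgd [simp]: "cop_delta (sgd g d) = sg g * cop_delta d"
  by (cases d) (auto simp: sgd_def sg_def)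

context rotating_machine
begin

text \<open>Letter 0 is the unit of a block, 1 ends a block, 2 and 3 are phase markers with bits 0 and 1.
  Chain and Zer compare the initial registers with k, 0, ..., 0. Cmp True p z and Mid True m test for
  b (i + K) being too large by subtracting block i and adding block i + K after passing m further
  block ends; for the argument False the signs are exchanged. LenA and LenB test that a phase is not longer
  than its predecessor. Y1, ..., XA treat the order spelled by the markers: X1 checks that the
  counter is at least the rank r of the new element and X2 restores it to one more than before, whereas XA
  moves to the predecessor of the current element. Y1, Y2 may skip this check, which can
  only lead to a smaller element.\<close>
inductive tr :: "nat \<Rightarrow> 'p st \<Rightarrow> nat \<Rightarrow> cop \<Rightarrow> 'p st \<Rightarrow> bool" for k where
  start: "a < 4 \<Longrightarrow> q \<in> {Pump, Y1, X1} \<Longrightarrow> tr k Init a Keep q"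
| pump: "a < 4 \<Longrightarrow> tr k Pump a Inc Pump"
| pump_wait: "a < 4 \<Longrightarrow> tr k Pump a Keep Wait"
| wait: "a < 4 \<Longrightarrow> q \<in> {Wait, Fin} \<Longrightarrow> tr k Wait a Keep q"
| done_wait: "a < 4 \<Longrightarrow> tr k Done a Keep Wait"
| fin: "a < 2 \<Longrightarrow> tr k Fin a Keep Fin"
| phase: "a \<in> {2, 3} \<Longrightarrow> q \<in> {Chain 0, Zer 0, Trk p0 False, Cmp g p0 False, LenA} \<Longrightarrow> tr k Wait a Keep q"
| chain: "i < k \<Longrightarrow> tr k (Chain i) 0 Keep (Chain (Suc i))"
| chain_short: "i < k \<Longrightarrow> tr k (Chain i) 1 Keep Done"
| chain_long: "tr k (Chain k) 0 Keep Done"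
| zer: "tr k (Zer 0) 0 Keep (Zer 0)"
| zer_next: "Suc j < K \<Longrightarrow> tr k (Zer j) 1 Keep (Zer (Suc j))"
| zer_error: "Suc j < K \<Longrightarrow> tr k (Zer (Suc j)) 0 Keep Done"
| trk: "p \<in> P \<Longrightarrow> tr k (Trk p z) 0 Keep (Trk p True)"
| trk_next: "p \<in> P \<Longrightarrow> q \<in> {Trk (nx p z) False, Cmp g (nx p z) False} \<Longrightarrow> tr k (Trk p z) 1 Keep q"
| trk_halt: "p \<in> H \<Longrightarrow> a < 2 \<Longrightarrow> tr k (Trk p z) a Keep Done"
| cmp: "p \<in> P \<Longrightarrow> tr k (Cmp g p z) 0 (sgd g Dec) (Cmp g p True)"
| cmp_end: "p \<in> P \<Longrightarrow> tr k (Cmp g p z) 1 (sgd g (cop_neg (dl p z))) (Mid g (K - 1))"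
| mid: "Suc n < K \<Longrightarrow> tr k (Mid g (Suc n)) 0 Keep (Mid g (Suc n))"
| mid_next: "Suc n < K \<Longrightarrow> tr k (Mid g (Suc n)) 1 Keep (Mid g n)"
| mid_read: "tr k (Mid g 0) 0 (sgd g Inc) (Mid g 0)"
| mid_gain: "tr k (Mid True 0) 0 Keep Done"
| mid_loss: "tr k (Mid False 0) 1 Dec Done"
| lenA: "a < 2 \<Longrightarrow> tr k LenA a Inc LenA"
| lenA_end: "a \<in> {2, 3} \<Longrightarrow> tr k LenA a Keep LenB"
| lenB: "a < 2 \<Longrightarrow> tr k LenB a Dec LenB"
| lenB_end: "a \<in> {2, 3} \<Longrightarrow> tr k LenB a Keep Done"
| ord_skip: "a < 2 \<Longrightarrow> q \<in> {Y1, Y2, X1, X2, XA} \<Longrightarrow> tr k q a Keep q"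
| stay: "q \<in> {Y1, Y2} \<Longrightarrow> tr k q 2 Keep q"
| stay_mid: "tr k Y1 3 Keep Y2"
| stay_end: "q \<in> {Y1, X1} \<Longrightarrow> tr k Y2 3 Keep q"
| shift_dec: "tr k X1 2 Dec X1"
| shift_mid: "q \<in> {X2, XA} \<Longrightarrow> tr k X1 3 Keep q"
| shift_inc: "q \<in> {X2, XA} \<Longrightarrow> tr k q 2 Inc q"
| shift_end: "q \<in> {Y1, X1} \<Longrightarrow> tr k X2 3 Keep q"
| descend_end: "q \<in> {Y1, X1} \<Longrightarrow> tr k XA 3 Dec q"

text \<open>Positions are part of the configurations, so that runs on x are paths in a
  graph.\<close>

definition succs :: "nat \<Rightarrow> (nat \<Rightarrow> nat) \<Rightarrow> ((nat \<times> 'p st \<times> nat) \<times> (nat \<times> 'p st \<times> nat)) set" where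
  "succs k x = {((i, q, v), (j, q', v')). j = Suc i \<and> (\<exists>d. tr k q (x i) d q' \<and> int v' = int v + cop_delta d)}"

definition accepts :: "nat \<Rightarrow> (nat \<Rightarrow> nat) \<Rightarrow> bool" where
  "accepts k x \<longleftrightarrow> (\<exists>\<rho>. \<rho> 0 = (Init, 0) \<and> (\<forall>i. ((i, \<rho> i), (Suc i, \<rho> (Suc i))) \<in> succs k x) \<and>
     infinite {i. fst (\<rho> i) \<in> {Done, Fin, XA}})"

end

text \<open>A position (s, h, q) in the sequence of bits: element s, first or second unary number, offset.
  A position (n, i, j, g) in the word: phase n, block i (the marker if i = n), offset, next bit.\<close>
type_synonym gpos = "nat \<times> bool \<times> nat"
type_synonym wpos = "nat \<times> nat \<times> nat \<times> gpos"

definition glen :: "(nat \<Rightarrow> nat) \<Rightarrow> gpos \<Rightarrow> nat" where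
  "glen r = (\<lambda>(s, h, q). if h then Suc (r s) else r s)"

definition gbit :: "(nat \<Rightarrow> nat) \<Rightarrow> gpos \<Rightarrow> nat" where
  "gbit r = (\<lambda>(s, h, q). if q < glen r (s, h, q) then 2 else 3)"

definition gnext :: "(nat \<Rightarrow> nat) \<Rightarrow> gpos \<Rightarrow> gpos" where
  "gnext r = (\<lambda>(s, h, q). if q < glen r (s, h, q) then (s, h, Suc q)
     else if h then (Suc s, False, 0) else (s, True, 0))"

definition letter :: "(nat \<Rightarrow> nat) \<Rightarrow> (nat \<Rightarrow> nat) \<Rightarrow> wpos \<Rightarrow> nat" where
  "letter b r = (\<lambda>(n, i, o', g). if i = n then gbit r g else if o' < b i then 0 else 1)"

definition wnext :: "(nat \<Rightarrow> nat) \<Rightarrow> (nat \<Rightarrow> nat) \<Rightarrow> wpos \<Rightarrow> wpos" where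
  "wnext b r = (\<lambda>(n, i, o', g). if i = n then (Suc n, 0, 0, gnext r g)
     else if o' < b i then (n, i, Suc o', g) else (n, Suc i, 0, g))"

text \<open>The bits start with element 1: element 0 alone needs no description, and the initial
  counter value 0 is its rank.\<close>

definition wpos :: "(nat \<Rightarrow> nat) \<Rightarrow> (nat \<Rightarrow> nat) \<Rightarrow> nat \<Rightarrow> wpos" where
  "wpos b r t = (wnext b r ^^ t) (0, 0, 0, (1, False, 0))"

text \<open>The leading letter 0 is consumed by the transition that leaves
  \<open>Init\<close>.\<close>

definition word :: "(nat \<Rightarrow> nat) \<Rightarrow> (nat \<Rightarrow> nat) \<Rightarrow> nat \<Rightarrow> nat" where
  "word b r t = (case t of 0 \<Rightarrow> 0 | Suc t \<Rightarrow> letter b r (wpos b r t))"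

definition wf_pos :: "(nat \<Rightarrow> nat) \<Rightarrow> (nat \<Rightarrow> nat) \<Rightarrow> wpos \<Rightarrow> bool" where
  "wf_pos b r = (\<lambda>(n, i, o', (s, h, q)). i \<le> n \<and> (if i = n then o' = 0 else o' \<le> b i) \<and> 0 < s \<and> q \<le> glen r (s, h, q))"

lemma wpos_0: "wpos b r 0 = (0, 0, 0, (1, False, 0))"
  by (simp add: wpos_def)

lemma wpos_Suc: "wpos b r (Suc t) = wnext b r (wpos b r t)"
  by (simp add: wpos_def)

lemma wf_wpos: "wf_pos b r (wpos b r t)"
proof (induction t)
  case 0 show ?case by (simp add: wpos_0 wf_pos_def)
next
  case (Suc t) then show ?case
    by (cases "wpos b r t") (auto simp: wpos_Suc wnext_def wf_pos_def gnext_def glen_def split: if_splits prod.splits)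
qed

lemma letter_less: "letter b r p < 4"
  by (auto simp: letter_def gbit_def split: prod.splits)

lemma word_less: "word b r t < 4"
  by (cases t) (auto simp: word_def letter_less)

lemma word_Suc: "word b r (Suc t) = letter b r (wpos b r t)"
  by (simp add: word_def)

lemma gbit_cases: "gbit r g = 2 \<or> gbit r g = 3"
  by (auto simp: gbit_def split: prod.splits)

section \<open>Progress along the word\<close>

definition plen :: "(nat \<Rightarrow> nat) \<Rightarrow> nat \<Rightarrow> nat" where
  "plen b i = (\<Sum>j<i. Suc (b j))"

lemma plen_Suc: "plen b (Suc i) = plen b i + Suc (b i)"
  by (simp add: plen_def)

lemma plen_0: "plen b 0 = 0"
  by (simp add: plen_def)

lemma plen_mono: "i \<le> j \<Longrightarrow> plen b i \<le> plen b j"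
  unfolding plen_def by (rule sum_mono2) auto

lemma ex_marker: "\<exists>t'\<ge>t. fst (wpos b r t') = fst (snd (wpos b r t')) \<and>
    snd (snd (snd (wpos b r t'))) = snd (snd (snd (wpos b r t)))"
\<comment> \<open>The measure is the number of letters left before the marker that ends the
  phase.\<close>
proof (induction "plen b (fst (wpos b r t)) - (plen b (fst (snd (wpos b r t))) + fst (snd (snd (wpos b r t))))" arbitrary: t rule: less_induct)
  case less
  obtain n i o' g where eq: "wpos b r t = (n, i, o', g)" by (metis surj_pair)
  show ?case
  proof (cases "i = n")
    case True then show ?thesis using eq by (intro exI[of _ t]) auto
  next
    case False
    have w: "i < n" "o' \<le> b i" using wf_wpos[of b r t] False by (auto simp: eq wf_pos_def split: prod.splits)
    then have "plen b (Suc i) \<le> plen b n" by (intro plen_mono) simp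
    then have m: "plen b i + Suc (b i) \<le> plen b n" by (simp add: plen_Suc)
    have nx: "wpos b r (Suc t) = (if o' < b i then (n, i, Suc o', g) else (n, Suc i, 0, g))"
      using False by (simp add: wpos_Suc eq wnext_def)
    have "\<exists>t'\<ge>Suc t. fst (wpos b r t') = fst (snd (wpos b r t')) \<and>
      snd (snd (snd (wpos b r t'))) = snd (snd (snd (wpos b r (Suc t))))"
      by (rule less) (use m w in \<open>auto simp: nx eq plen_Suc\<close>)
    then show ?thesis using nx eq by (metis Suc_leD snd_conv)
  qed
qed

lemma ex_stage: "\<exists>t'\<ge>t. snd (snd (snd (wpos b r t'))) = (Suc (fst (snd (snd (snd (wpos b r t))))), False, 0)"
proof -
  \<comment> \<open>A measure of the bits that the current element still needs; each marker spends
    one.\<close>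
  define rest where "rest = (\<lambda>(s, h, q). (if h then 0 else r s + 3) + (glen r (s, h, q) - q))"
  show ?thesis
  proof (induction "rest (snd (snd (snd (wpos b r t))))" arbitrary: t rule: less_induct)
    case less
    obtain t' where t': "t' \<ge> t" "fst (wpos b r t') = fst (snd (wpos b r t'))"
      "snd (snd (snd (wpos b r t'))) = snd (snd (snd (wpos b r t)))" using ex_marker by blast
    obtain s h q where g: "snd (snd (snd (wpos b r t))) = (s, h, q)" by (metis surj_pair)
    have nx: "snd (snd (snd (wpos b r (Suc t')))) = gnext r (s, h, q)"
      using t' g by (cases "wpos b r t'") (auto simp: wpos_Suc wnext_def)
    show ?case
    proof (cases "h \<and> \<not> q < glen r (s, h, q)")
      case True
      then show ?thesis using nx t'(1) g by (intro exI[of _ "Suc t'"]) (auto simp: gnext_def)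
    next
      case False
      have s: "fst (gnext r (s, h, q)) = s" using False by (auto simp: gnext_def)
      have "\<exists>t''\<ge>Suc t'. snd (snd (snd (wpos b r t''))) = (Suc (fst (snd (snd (snd (wpos b r (Suc t')))))), False, 0)"
        by (rule less) (use False in \<open>auto simp: nx g rest_def gnext_def glen_def\<close>)
      then obtain t'' where "t'' \<ge> Suc t'" "snd (snd (snd (wpos b r t''))) = (Suc (fst (gnext r (s, h, q))), False, 0)"
        unfolding nx by blast
      then show ?thesis unfolding g using s t'(1) by (intro exI[of _ t'']) simp
    qed
  qed
qed

section \<open>Non-halting programs\<close>

context machine_trace
begin

lemma b_delta: "int (b (i + K)) = int (b i) + cop_delta (dl (cp i) (0 < b i))"
proof (cases "dl (cp i) (0 < b i)")
  case Dec
  then have "0 < b i" using dl_False by (metis (full_types))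
  then show ?thesis using b_add[of i] Dec by simp
qed (use b_add[of i] in simp_all)

lemma cp_P: "cp i \<in> P"
  by (induction i) (auto simp: cp_0 cp_Suc p0_P nx_P)

definition checking_states :: "'a st set" where
  "checking_states = - ({Init, Pump, Y1, Y2, X1, X2, XA})"

text \<open>What an ongoing check has inferred about its position. On words without errors it
  remains true, which excludes the error transitions of \<open>Chain\<close> and \<open>Zer\<close>,
  and with a non-halting control those of \<open>Trk\<close>.\<close>

fun state_inv :: "wpos \<Rightarrow> 'a st \<Rightarrow> bool" where
  "state_inv (n, i, o', g) (Chain j) = (i = 0 \<and> j = o')"
| "state_inv (n, i, o', g) (Zer j) = (i = j \<and> j < K)"
| "state_inv (n, i, o', g) (Trk p z) = (p = cp i \<and> (z \<longleftrightarrow> 0 < o'))"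
| "state_inv (n, i, o', g) (Cmp _ p z) = (p = cp i \<and> (z \<longleftrightarrow> 0 < o'))"
| "state_inv (n, i, o', g) LenB = (0 < n)"
| "state_inv _ _ = True"

text \<open>The counter value with which an ongoing check was started, as far as it can be inferred. On words
  without errors it never increases, and it decreases whenever a check is completed.\<close>
fun potential :: "wpos \<Rightarrow> 'a st \<Rightarrow> nat \<Rightarrow> int" where
  "potential (n, i, o', g) (Cmp e p z) v = int v + sg e * int o'"
| "potential (n, i, o', g) (Mid e m) v = int v + sg e * (int (b (i + m)) - (if m = 0 then int o' else 0))"
| "potential (n, i, o', g) LenA v = int v - int (plen b i + o')"
| "potential (n, i, o', g) LenB v = int v - int (plen b (n - 1)) + int (plen b i + o')"
| "potential _ _ v = int v"

lemma letter_iff: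
  assumes "wf_pos b r (n, i, o', g)"
  shows "letter b r (n, i, o', g) = 0 \<longleftrightarrow> i < n \<and> o' < b i"
    "letter b r (n, i, o', g) = Suc 0 \<longleftrightarrow> i < n \<and> o' = b i"
    "letter b r (n, i, o', g) < 2 \<longleftrightarrow> i < n"
    "letter b r (n, i, o', g) = 2 \<or> letter b r (n, i, o', g) = 3 \<longleftrightarrow> i = n"
  using assms gbit_cases[of r g] by (auto simp: letter_def wf_pos_def split: prod.splits)

text \<open>A completed comparison loses at least 1: \<open>mid_gain\<close> stops before its block
  is exhausted, \<open>mid_loss\<close> pays 1 after an exact match, and the phase subtracted by
  \<open>LenB\<close> is longer than the one added by \<open>LenA\<close>. The other error
  transitions contradict \<open>state_inv\<close> or \<open>nh\<close>.\<close>

lemma potential_step: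
  assumes w: "wf_pos b r p" and I: "state_inv p q" and c: "q \<in> checking_states"
    and t: "tr k q (letter b r p) d q'" and v: "int v' = int v + cop_delta d"
    and nh: "\<And>i. cp i \<notin> H"
  shows "q' \<in> checking_states" "state_inv (wnext b r p) q'" "potential (wnext b r p) q' v' \<le> potential p q v"
    "q' = Done \<Longrightarrow> potential (wnext b r p) q' v' < potential p q v"
proof -
  obtain n i o' g where p: "p = (n, i, o', g)" by (metis surj_pair)
  note L = letter_iff[OF w[unfolded p]]
  have N: "wnext b r (n, i, o', g) = (if i = n then (Suc n, 0, 0, gnext r g)
     else if o' < b i then (n, i, Suc o', g) else (n, Suc i, 0, g))"
    by (simp add: wnext_def)
  have wi: "i \<le> n" "i = n \<Longrightarrow> o' = 0" "i \<noteq> n \<Longrightarrow> o' \<le> b i"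
    using w by (auto simp: p wf_pos_def split: prod.splits if_splits)
  have pn: "plen b n = plen b (n - 1) + Suc (b (n - 1))" if "0 < n"
    using that plen_Suc[of b "n - 1"] by simp
  have bd: "cop_delta (dl (cp i) (0 < b i)) = int (b (i + K)) - int (b i)"
    using b_delta[of i] by simp
  have "q' \<in> checking_states \<and> state_inv (wnext b r p) q' \<and> potential (wnext b r p) q' v' \<le> potential p q v
    \<and> (q' = Done \<longrightarrow> potential (wnext b r p) q' v' < potential p q v)"
    using t
  proof cases
    case chain_short then show ?thesis using I L(2) by (auto simp: p b_0)
  next
    case chain_long then show ?thesis using I L(1) by (auto simp: p b_0)
  next
    case (zer_error j) then show ?thesis using I L(1) b_init[of "Suc j"] by (auto simp: p)
  next
    case (trk_halt) then show ?thesis using I nh by (auto simp: p)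
  next
    case phase then show ?thesis using L(4) I v
      by (auto simp: wnext_def p checking_states_def cp_0 plen_0 K_pos)
  next
    case (trk_next p' q z) then show ?thesis using L(2) I v
      by (auto simp: wnext_def p checking_states_def cp_Suc)
  next
    case (cmp_end p' g' z) then show ?thesis using L(2) I v bd K_pos
      by (auto simp: wnext_def p checking_states_def sg_def)
  next
    case (mid_next m g') then show ?thesis using L(2) I v
      by (auto simp: wnext_def p checking_states_def)
  next
    case mid_gain then show ?thesis using L(1) I v
      by (auto simp: wnext_def p checking_states_def sg_def)
  next
    case mid_loss then show ?thesis using L(2) I v
      by (auto simp: wnext_def p checking_states_def sg_def)
  next
    case lenA_end then show ?thesis using L(4) I v wi
      by (auto simp: wnext_def p checking_states_def plen_0)
  next
    case lenB_end then show ?thesis using L(4) I v wi pn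
      by (auto simp: wnext_def p checking_states_def)
  qed (use I c v L wi in \<open>auto simp: wnext_def p checking_states_def sg_def plen_Suc\<close>)
  then show "q' \<in> checking_states" "state_inv (wnext b r p) q'" "potential (wnext b r p) q' v' \<le> potential p q v"
    "q' = Done \<Longrightarrow> potential (wnext b r p) q' v' < potential p q v" by auto
qed

end

lemma ex_flip:
  assumes "Q m" "\<not> Q n" "m \<le> n"
  shows "\<exists>t. m \<le> t \<and> Q t \<and> \<not> Q (Suc t)"
proof (rule ccontr)
  assume n: "\<not> ?thesis"
  have "Q t" if "m \<le> t" for t using that
    by (induction rule: dec_induct) (use assms n in auto)
  then show False using assms by blast
qed

lemma ex_marker_letter: "\<exists>t'\<ge>t. letter b r (wpos b r t') \<in> {2, 3}"
proof -
  obtain t' where "t' \<ge> t" "fst (wpos b r t') = fst (snd (wpos b r t'))" using ex_marker by blast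
  then show ?thesis using gbit_cases[of r "snd (snd (snd (wpos b r t')))"]
    by (intro exI[of _ t'], cases "wpos b r t'") (auto simp: letter_def)
qed

abbreviation gp :: "(nat \<Rightarrow> nat) \<Rightarrow> (nat \<Rightarrow> nat) \<Rightarrow> nat \<Rightarrow> gpos" where
  "gp b r t \<equiv> snd (snd (snd (wpos b r t)))"

lemma gp_step:
  "(letter b r (wpos b r t) < 2 \<and> gp b r (Suc t) = gp b r t) \<or>
   (letter b r (wpos b r t) = gbit r (gp b r t) \<and> gp b r (Suc t) = gnext r (gp b r t))"
  by (cases "wpos b r t") (auto simp: wpos_Suc wnext_def letter_def)

lemma gp_wf: "gp b r t = (s, h, q) \<Longrightarrow> 0 < s \<and> q \<le> glen r (s, h, q)"
  using wf_wpos[of b r t] by (cases "wpos b r t") (auto simp: wf_pos_def)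

lemma ex_stage_ge: "\<exists>s0. \<forall>s\<ge>s0. \<exists>t'\<ge>t. gp b r t' = (s, False, 0)"
proof -
  obtain t0 s0 where t0: "t0 \<ge> t" "gp b r t0 = (s0, False, 0)" using ex_stage[of t b r] by blast
  have "\<exists>t'\<ge>t. gp b r t' = (s, False, 0)" if "s \<ge> s0" for s
    using that
  proof (induction rule: dec_induct)
    case base then show ?case using t0 by blast
  next
    case (step s)
    then obtain t' where "t' \<ge> t" "gp b r t' = (s, False, 0)" by blast
    then show ?case using ex_stage[of t' b r] le_trans by fastforce
  qed
  then show ?thesis by blast
qed

text \<open>The element changes only at the end of its second number, so that number must be
  reached.\<close>

lemma ex_second_half:
  assumes "gp b r t = (s, False, 0)"
  shows "\<exists>t'\<ge>t. \<exists>q. gp b r t' = (s, True, q)"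
proof -
  obtain t1 where t1: "t1 \<ge> t" "fst (gp b r t1) = Suc s" using ex_stage[of t b r] assms by auto
  obtain t' where t': "t \<le> t'" "fst (gp b r t') = s" "fst (gp b r (Suc t')) \<noteq> s"
    using ex_flip[of "\<lambda>t. fst (gp b r t) = s" t t1] assms t1 by auto
  obtain h q where "gp b r t' = (s, h, q)" using t'(2) by (metis fst_conv surj_pair)
  then have "h" using gp_step[of b r t'] t'(2,3) by (auto simp: gnext_def split: if_splits)
  then show ?thesis using t' \<open>gp b r t' = (s, h, q)\<close> by auto
qed

section \<open>Error-free words and descending chains\<close>

locale ordered_word = machine_trace K p0 nx dl H P k b cp + nat_linorder less
  for K and p0 :: 'a and nx dl H P k b cp and less (infix "\<sqsubset>" 50) +
  assumes no_halt: "cp i \<notin> H"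
begin

definition rk :: "nat \<Rightarrow> nat" where "rk i = rank i i"

abbreviation "w \<equiv> word b rk"
abbreviation "pos \<equiv> wpos b rk"

text \<open>Markers recur, which rules out \<open>Fin\<close>, and \<open>XA\<close> cannot be
  reached from \<open>Pump\<close>; so \<open>Done\<close> recurs. Each return lowers the potential,
  which at \<open>Done\<close> is the counter itself and cannot fall forever.\<close>

lemma no_checking_run:
  assumes u: "\<And>t. \<exists>d. tr k (fst (u t)) (letter b rk (pos t)) d (fst (u (Suc t))) \<and>
       int (snd (u (Suc t))) = int (snd (u t)) + cop_delta d"
    and u0: "fst (u 0) = Pump" and inf: "\<And>m. \<exists>t\<ge>m. fst (u t) \<in> {Done, Fin, XA}"
  shows False
proof -
  have range: "fst (u t) \<in> insert Pump checking_states" for t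
  proof (induction t)
    case (Suc t)
    obtain d where "tr k (fst (u t)) (letter b rk (pos t)) d (fst (u (Suc t)))" using u by blast
    then show ?case using Suc by cases (auto simp: checking_states_def)
  qed (simp add: u0)
  have no_fin: "fst (u t) \<noteq> Fin" for t
  proof
    assume "fst (u t) = Fin"
    have fin: "fst (u (t + j)) = Fin" for j
    proof (induction j)
      case (Suc j)
      obtain d where "tr k (fst (u (t + j))) (letter b rk (pos (t + j))) d (fst (u (Suc (t + j))))"
        using u by blast
      then show ?case using Suc by cases auto
    qed (use \<open>fst (u t) = Fin\<close> in simp)
    obtain t' where t': "t' \<ge> t" "letter b rk (pos t') \<in> {2, 3}" using ex_marker_letter by blast
    obtain d where "tr k (fst (u t')) (letter b rk (pos t')) d (fst (u (Suc t')))" using u by blast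
    then show False using t' fin[of "t' - t"] by cases auto
  qed
  have done_inf: "\<exists>t\<ge>m. fst (u t) = Done" for m
  proof -
    obtain t where t: "t \<ge> m" "fst (u t) \<in> {Done, Fin, XA}" using inf by blast
    moreover have "fst (u t) \<noteq> XA" using range[of t] by (auto simp: checking_states_def)
    ultimately show ?thesis using no_fin[of t] by blast
  qed
  \<comment> \<open>At \<open>Done\<close> the invariant holds trivially, so it can be started
    there.\<close>
  obtain T where T: "fst (u T) = Done" using done_inf by blast
  define \<Phi> where "\<Phi> t = potential (pos t) (fst (u t)) (snd (u t))" for t
  have step: "fst (u t) \<in> checking_states \<Longrightarrow> state_inv (pos t) (fst (u t)) \<Longrightarrow>
     fst (u (Suc t)) \<in> checking_states \<and> state_inv (pos (Suc t)) (fst (u (Suc t))) \<and> \<Phi> (Suc t) \<le> \<Phi> t \<and>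
     (fst (u (Suc t)) = Done \<longrightarrow> \<Phi> (Suc t) < \<Phi> t)" for t
  proof -
    assume *: "state_inv (pos t) (fst (u t))" "fst (u t) \<in> checking_states"
    obtain d where d: "tr k (fst (u t)) (letter b rk (pos t)) d (fst (u (Suc t)))"
      "int (snd (u (Suc t))) = int (snd (u t)) + cop_delta d" using u by blast
    from potential_step[OF wf_wpos * d no_halt] show ?thesis unfolding \<Phi>_def wpos_Suc by auto
  qed
  have inv: "fst (u (T + j)) \<in> checking_states \<and> state_inv (pos (T + j)) (fst (u (T + j)))" for j
  proof (induction j)
    case 0 show ?case using T by (cases "pos T") (auto simp: checking_states_def)
  next
    case (Suc j) then show ?case using step[of "T + j"] by auto
  qed
  have mono: "\<Phi> (T + (i + j)) \<le> \<Phi> (T + i)" for i j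
  proof (induction j)
    case (Suc j) then show ?case using step[of "T + (i + j)"] inv[of "i + j"] by simp
  qed simp
  have "\<exists>t\<ge>T. \<Phi> t \<le> \<Phi> T - int j \<and> fst (u t) = Done" for j
  proof (induction j)
    case 0 then show ?case using T by auto
  next
    case (Suc j)
    then obtain t where t: "t \<ge> T" "\<Phi> t \<le> \<Phi> T - int j" by blast
    obtain t' where t': "t' \<ge> Suc t" "fst (u t') = Done" using done_inf by blast
    have "\<Phi> (Suc (T + (t' - 1 - T))) < \<Phi> (T + (t' - 1 - T))"
      using step[of "T + (t' - 1 - T)"] inv[of "t' - 1 - T"] t t' by auto
    then have "\<Phi> t' < \<Phi> (t' - 1)" using t t' by simp
    also have "\<dots> \<le> \<Phi> t" using mono[of "t - T" "t' - 1 - t"] t t' by simp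
    finally show ?case using t t' by (intro exI[of _ t']) auto
  qed
  from this[of "nat (\<Phi> T) + 1"] obtain t
    where "\<Phi> t \<le> \<Phi> T - int (nat (\<Phi> T) + 1)" "fst (u t) = Done" by blast
  then have "\<Phi> t < 0" "fst (u t) = Done" by linarith+
  then show False by (cases "pos t") (simp add: \<Phi>_def)
qed

text \<open>The last argument is the element represented by the counter. In state XA it is already the next one.\<close>
fun ord_inv :: "gpos \<Rightarrow> 'a st \<Rightarrow> nat \<Rightarrow> nat \<Rightarrow> bool" where
  "ord_inv (s, h, q) Y1 v e = (\<not> h \<and> e < s \<and> v = rank s e)"
| "ord_inv (s, h, q) X1 v e = (\<not> h \<and> e < s \<and> v + q = rank s e)"
| "ord_inv (s, h, q) Y2 v e = (h \<and> e < s \<and> v = rank s e)"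
| "ord_inv (s, h, q) X2 v e = (h \<and> e < s \<and> v + rk s = rank s e + q \<and> rk s \<le> rank s e)"
| "ord_inv (s, h, q) XA v e = (h \<and> e < Suc s \<and> v + rk s = rank (Suc s) e + q)"
| "ord_inv _ _ v e = False"

text \<open>Since ranks are bijective, the counter can always be read as an element; a run can only
  move it downwards, and strictly so on entering \<open>XA\<close>.\<close>

lemma ord_inv_step:
  assumes I: "ord_inv (gp b rk t) q v e" and tr: "tr k q (letter b rk (pos t)) d q'"
    and v: "int v' = int v + cop_delta d"
  shows "\<exists>e'. ord_inv (gp b rk (Suc t)) q' v' e' \<and> (e' = e \<or> e' \<sqsubset> e) \<and> (q' = XA \<and> q \<noteq> XA \<longrightarrow> e' \<sqsubset> e)"
proof -
  obtain s h o' where g: "gp b rk t = (s, h, o')" by (metis surj_pair)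
  note gw = gp_wf[OF g]
  let ?l = "letter b rk (pos t)"
  have q: "q \<in> {Y1, Y2, X1, X2, XA}" using I by (cases q) (auto simp: g)
  from gp_step[of b rk t] show ?thesis
  proof
    assume "?l < 2 \<and> gp b rk (Suc t) = gp b rk t"
    then have l: "?l < 2" "gp b rk (Suc t) = gp b rk t" by auto
    from tr have "q' = q \<and> d = Keep" by cases (use l q in auto)
    then show ?thesis using I v l by auto
  next
    assume l: "?l = gbit rk (gp b rk t) \<and> gp b rk (Suc t) = gnext rk (gp b rk t)"
    show ?thesis
    proof (cases "o' < glen rk (s, h, o')")
      case True
      then have l2: "?l = 2" "gp b rk (Suc t) = (s, h, Suc o')" using l g by (auto simp: gbit_def gnext_def)
      have "q' = q \<and> ord_inv (s, h, Suc o') q v' e"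
        using tr[unfolded l2] by cases (use I v q in \<open>auto simp: g\<close>)
      then show ?thesis using l2 by auto
    next
      case False
      then have l3: "?l = 3" using l g by (auto simp: gbit_def)
      have o': "o' = glen rk (s, h, o')" using False gw by auto
      show ?thesis
      proof (cases h)
        case False
        have g': "gp b rk (Suc t) = (s, True, 0)" using l g False o' by (auto simp: gnext_def)
        have o'': "o' = rk s" using o' False by (simp add: glen_def)
        show ?thesis using tr[unfolded l3]
        proof cases
          case stay_mid then show ?thesis using I v by (auto simp: g g')
        next
          case shift_mid
          \<comment> \<open>\<open>X1\<close> has subtracted all of \<open>rk s\<close> without
            blocking, so the rank of the new element s is at most that of e, and s lies below
            e.\<close>
          have e: "e < s" "v + rk s = rank s e" using I shift_mid by (auto simp: g o'')
          then have "s \<sqsubset> e" using rank_self_le_iff[of e s] by (simp add: rk_def)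
          then have r1: "rank (Suc s) e = Suc (rank s e)" by (simp add: rank_Suc)
          show ?thesis
          proof (cases "q' = XA")
            case True
            \<comment> \<open>The insertion of s raises the rank of e by one, so the old rank now
              belongs to the immediate predecessor of e.\<close>
            obtain e' where e': "e' < Suc s" "rank (Suc s) e' = rank s e"
              using rank_surj[of "rank s e" "Suc s"] rank_less[OF e(1)] by auto
            then have "e' \<sqsubset> e" using rank_less_iff[of e' "Suc s" e] e(1) r1 by simp
            then show ?thesis using True e' e v shift_mid by (auto simp: g')
          next
            case False
            then show ?thesis using shift_mid e v by (auto simp: g')
          qed
        qed (use q I in \<open>auto simp: g False\<close>)
      next
        case True
        have g': "gp b rk (Suc t) = (Suc s, False, 0)" using l g True o' by (auto simp: gnext_def)
        have o'': "o' = Suc (rk s)" using o' True by (simp add: glen_def)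
        show ?thesis using tr[unfolded l3]
        proof cases
          case stay_end
          have e: "e < s" "v' = rank s e" using I stay_end v by (auto simp: g)
          \<comment> \<open>The unchanged counter is read as a rank among one more element: it
            denotes e if s entered above e, and the predecessor of e otherwise.\<close>
          obtain e' where e': "e' < Suc s" "rank (Suc s) e' = rank s e"
            using rank_surj[of "rank s e" "Suc s"] rank_less[OF e(1)] by auto
          then have "e' = e \<or> e' \<sqsubset> e"
            using rank_less_iff[of e "Suc s" e'] e(1) total[of e' e] rank_Suc[of s e] by auto
          then show ?thesis using stay_end e e' by (intro exI[of _ e']) (auto simp: g')
        next
          case shift_end
          have e: "e < s" "v' = Suc (rank s e)" "rk s \<le> rank s e" using I shift_end v by (auto simp: g o'')
          then have "s \<sqsubset> e" using rank_self_le_iff[of e s] by (simp add: rk_def)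
          then show ?thesis using e shift_end by (intro exI[of _ e]) (auto simp: g' rank_Suc)
        next
          case descend_end
          then show ?thesis using I v by (intro exI[of _ e]) (auto simp: g g' o'')
        qed (use q I in \<open>auto simp: g True\<close>)
      qed
    qed
  qed
qed

text \<open>\<open>ord_inv\<close> excludes \<open>Done\<close> and \<open>Fin\<close>, so
  \<open>XA\<close> recurs. It is left at the end of every element, hence entered infinitely often,
  and each entry descends strictly.\<close>

lemma ordinal_run_ill_founded:
  assumes u: "\<And>t. \<exists>d. tr k (fst (u t)) (letter b rk (pos t)) d (fst (u (Suc t))) \<and>
       int (snd (u (Suc t))) = int (snd (u t)) + cop_delta d"
    and u0: "fst (u 0) \<in> {Y1, X1}" "snd (u 0) = 0" and inf: "\<And>m. \<exists>t\<ge>m. fst (u t) \<in> {Done, Fin, XA}"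
  shows "\<exists>a. \<forall>i. a (Suc i) \<sqsubset> a i"
proof -
  let ?I = "\<lambda>t e. ord_inv (gp b rk t) (fst (u t)) (snd (u t)) e"
  let ?R = "\<lambda>t e e'. (e' = e \<or> e' \<sqsubset> e) \<and> (fst (u (Suc t)) = XA \<and> fst (u t) \<noteq> XA \<longrightarrow> e' \<sqsubset> e)"
  have "\<exists>e. \<forall>t. ?I t (e t) \<and> ?R t (e t) (e (Suc t))"
  proof (rule dependent_nat_choice)
    have "rank 1 0 = 0" using rank_less[of 0 1] by simp
    then show "\<exists>e. ?I 0 e" using u0 by (auto simp: wpos_0)
    fix e t assume "?I t e"
    then show "\<exists>e'. ?I (Suc t) e' \<and> ?R t e e'" using ord_inv_step u by blast
  qed
  then obtain e where I: "\<And>t. ?I t (e t)" and R: "\<And>t. ?R t (e t) (e (Suc t))" by blast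
  have XA_inf: "\<exists>t\<ge>m. fst (u t) = XA" for m
  proof -
    obtain t where t: "t \<ge> m" "fst (u t) \<in> {Done, Fin, XA}" using inf by blast
    then have "fst (u t) = XA" using I[of t] by (cases "gp b rk t") auto
    then show ?thesis using t by blast
  qed
  have enter: "\<exists>t\<ge>m. e (Suc t) \<sqsubset> e t" for m
  proof -
    obtain t0 s where t0: "t0 \<ge> m" "gp b rk t0 = (s, False, 0)" using ex_stage[of m b rk] by blast
    then have n: "fst (u t0) \<noteq> XA" using I[of t0] by auto
    obtain t1 where "t1 \<ge> t0" "fst (u t1) = XA" using XA_inf by blast
    then obtain t where "t0 \<le> t" "fst (u t) \<noteq> XA" "fst (u (Suc t)) = XA"
      using ex_flip[of "\<lambda>t. fst (u t) \<noteq> XA" t0 t1] n by auto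
    then show ?thesis using R[of t] t0(1) by (intro exI[of _ t]) auto
  qed
  show ?thesis
  proof (rule ccontr)
    assume "\<not> ?thesis"
    \<comment> \<open>Without descending chains e would attain a minimal value and stay constant
      from there on.\<close>
    then have "wf {(a, b). a \<sqsubset> b}" unfolding wf_iff_no_infinite_down_chain by auto
    then obtain z where "z \<in> range e" "\<And>y. (y, z) \<in> {(a, b). a \<sqsubset> b} \<Longrightarrow> y \<notin> range e"
      by (rule wfE_min[of _ "e 0" "range e"]) auto
    then obtain N where N: "\<And>t. \<not> e t \<sqsubset> e N" by blast
    have le: "t \<ge> N \<Longrightarrow> e t = e N \<or> e t \<sqsubset> e N" for t
    proof (induction rule: dec_induct)
      case (step t) then show ?case using R[of t] trans by metis
    qed simp
    obtain t where "t \<ge> N" "e (Suc t) \<sqsubset> e t" using enter by blast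
    then show False using le[of t] N trans by metis
  qed
qed

text \<open>The first transition decides between the error checks and the order part.\<close>

lemma accepts_imp_ill_founded:
  assumes "accepts k w" shows "\<exists>a. \<forall>i. a (Suc i) \<sqsubset> a i"
proof -
  obtain \<rho> where \<rho>: "\<rho> 0 = (Init, 0)" "\<And>i. ((i, \<rho> i), (Suc i, \<rho> (Suc i))) \<in> succs k w"
    "infinite {i. fst (\<rho> i) \<in> {Done, Fin, XA}}" using assms unfolding accepts_def by blast
  have st: "\<exists>d. tr k (fst (\<rho> i)) (w i) d (fst (\<rho> (Suc i))) \<and> int (snd (\<rho> (Suc i))) = int (snd (\<rho> i)) + cop_delta d" for i
    using \<rho>(2)[of i] by (auto simp: succs_def split: prod.splits)
  define u where "u t = \<rho> (Suc t)" for t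
  have u: "\<exists>d. tr k (fst (u t)) (letter b rk (pos t)) d (fst (u (Suc t))) \<and>
       int (snd (u (Suc t))) = int (snd (u t)) + cop_delta d" for t
    using st[of "Suc t"] by (simp add: u_def word_Suc)
  have inf: "\<exists>t\<ge>m. fst (u t) \<in> {Done, Fin, XA}" for m
  proof -
    obtain i where "i > m" "fst (\<rho> i) \<in> {Done, Fin, XA}" using \<rho>(3) unfolding infinite_nat_iff_unbounded by blast
    then show ?thesis by (intro exI[of _ "i - 1"]) (auto simp: u_def)
  qed
  obtain d where "tr k Init (w 0) d (fst (u 0))" "int (snd (u 0)) = cop_delta d"
    using st[of 0] \<rho>(1) by (auto simp: u_def)
  then have "fst (u 0) \<in> {Pump, Y1, X1} \<and> snd (u 0) = 0" by cases auto
  then show ?thesis using no_checking_run[OF u _ inf] ordinal_run_ill_founded[OF u _ _ inf] by blast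
qed

text \<open>The run follows an element that stays at or above some member of the chain, and descends
  when a member of the chain below it is spelled. By \<open>top\<close>, the initial element 0
  qualifies.\<close>

lemma ill_founded_imp_accepts:
  assumes a: "\<And>i. a (Suc i) \<sqsubset> a i" and top: "\<And>e. e \<noteq> 0 \<Longrightarrow> e \<sqsubset> 0"
  shows "accepts k w"
proof -
  have a_less: "a j \<sqsubset> a i" if "i < j" for i j
    using that by (induction rule: less_Suc_induct) (auto intro: a trans)
  have inj: "inj a" by (rule injI) (metis a_less irrefl linorder_neqE_nat)
  \<comment> \<open>\<open>el s\<close> is the element followed while s is spelled. If s is a member
    of the chain below it, the next one is the immediate predecessor of \<open>el s\<close> among 0,
    ..., s, which is s or lies above s.\<close>
  define el where "el = rec_nat 0 (\<lambda>s e. if 0 < s \<and> s \<sqsubset> e \<and> s \<in> range a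
     then SOME e'. e' < Suc s \<and> rank (Suc s) e' = rank s e else e)"
  have el_0: "el 0 = 0" and el_Suc: "el (Suc s) = (if 0 < s \<and> s \<sqsubset> el s \<and> s \<in> range a
     then SOME e'. e' < Suc s \<and> rank (Suc s) e' = rank s (el s) else el s)" for s
    by (simp_all add: el_def)
  have el_desc: "el (Suc s) < Suc s \<and> rank (Suc s) (el (Suc s)) = rank s (el s)"
    if "0 < s" "s \<sqsubset> el s" "s \<in> range a" "el s < s" for s
  proof -
    have "\<exists>e'. e' < Suc s \<and> rank (Suc s) e' = rank s (el s)"
      using rank_surj[of "rank s (el s)" "Suc s"] rank_less[OF that(4)] by auto
    from someI_ex[OF this] show ?thesis using that by (simp add: el_Suc)
  qed
  have el: "0 < s \<Longrightarrow> el s < s \<and> (\<exists>t. a t = el s \<or> a t \<sqsubset> el s)" for s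
  proof (induction s)
    case (Suc s)
    show ?case
    proof (cases "s = 0")
      case True
      then show ?thesis using top[of "a 0"] by (auto simp: el_Suc el_0)
    next
      case False
      show ?thesis
      proof (cases "s \<sqsubset> el s \<and> s \<in> range a")
        case True
        then have d: "el (Suc s) < Suc s" "rank (Suc s) (el (Suc s)) = rank s (el s)"
          using el_desc[of s] Suc False by auto
        have "rank s s \<le> rank s (el s)" using True by (simp add: rank_mono)
        then have "\<not> el (Suc s) \<sqsubset> s"
          using rank_less_iff[of "el (Suc s)" "Suc s" s] d by (simp add: rank_Suc irrefl)
        then have "s = el (Suc s) \<or> s \<sqsubset> el (Suc s)" using total[of s "el (Suc s)"] by blast
        then show ?thesis using d True by blast
      next
        case f: False
        then have "el (Suc s) = el s" by (auto simp: el_Suc)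
        then show ?thesis using Suc False by auto
      qed
    qed
  qed simp
  define isX where "isX s \<longleftrightarrow> s \<sqsubset> el s" for s
  define isA where "isA s \<longleftrightarrow> isX s \<and> s \<in> range a" for s
  have rank_next: "rank (Suc s) (el (Suc s)) = (if isX s \<and> \<not> isA s then Suc (rank s (el s)) else rank s (el s))"
    if "0 < s" for s
  proof (cases "isA s")
    case True
    then show ?thesis using el[OF that] el_desc[OF that] by (simp add: isA_def isX_def)
  next
    case False
    then have "el (Suc s) = el s" by (auto simp: el_Suc isA_def isX_def)
    then show ?thesis using False by (simp add: rank_Suc isX_def)
  qed
  have rk_le: "isX s \<Longrightarrow> rk s \<le> rank s (el s)" for s by (simp add: isX_def rk_def rank_mono)
  define sta :: "gpos \<Rightarrow> 'a st" where
    "sta = (\<lambda>(s, h, q). if h then (if isA s then XA else if isX s then X2 else Y2) else if isX s then X1 else Y1)"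
  define val :: "gpos \<Rightarrow> nat" where
    "val = (\<lambda>(s, h, q). if isX s then (if h then rank s (el s) - rk s + q else rank s (el s) - q) else rank s (el s))"
  define \<rho> where "\<rho> t = (case t of 0 \<Rightarrow> (Init, 0) | Suc t \<Rightarrow> (sta (gp b rk t), val (gp b rk t)))" for t
  have step: "\<exists>d. tr k (sta (gp b rk t)) (letter b rk (pos t)) d (sta (gp b rk (Suc t))) \<and>
     int (val (gp b rk (Suc t))) = int (val (gp b rk t)) + cop_delta d" for t
  proof -
    obtain s h q where g: "gp b rk t = (s, h, q)" by (metis surj_pair)
    note gw = gp_wf[OF g]
    from gp_step[of b rk t] show ?thesis
    proof
      assume l: "letter b rk (pos t) < 2 \<and> gp b rk (Suc t) = gp b rk t"
      have "sta (gp b rk t) \<in> {Y1, Y2, X1, X2, XA}" by (auto simp: sta_def split: prod.splits)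
      then have "tr k (sta (gp b rk t)) (letter b rk (pos t)) Keep (sta (gp b rk t))"
        using l by (intro ord_skip) auto
      then show ?thesis using l by (intro exI[of _ Keep]) simp
    next
      assume l: "letter b rk (pos t) = gbit rk (gp b rk t) \<and> gp b rk (Suc t) = gnext rk (gp b rk t)"
      show ?thesis
      proof (cases "q < glen rk (s, h, q)")
        case True
        then have l2: "letter b rk (pos t) = 2" "gp b rk (Suc t) = (s, h, Suc q)"
          using l g by (auto simp: gbit_def gnext_def)
        show ?thesis
        proof (cases "isX s")
          case False
          then show ?thesis unfolding l2 g
            by (intro exI[of _ Keep]) (auto simp: sta_def val_def isA_def intro: stay)
        next
          case X: True
          show ?thesis
          proof (cases h)
            case True
            then show ?thesis unfolding l2 g using X
              by (intro exI[of _ Inc]) (auto simp: sta_def val_def intro: shift_inc)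
          next
            case False
            then have "q < rank s (el s)" using \<open>q < glen rk (s, h, q)\<close> rk_le[OF X] by (simp add: glen_def)
            then show ?thesis unfolding l2 g using X False
              by (intro exI[of _ Dec]) (auto simp: sta_def val_def intro: shift_dec)
          qed
        qed
      next
        case F: False
        then have l3: "letter b rk (pos t) = 3" using l g by (auto simp: gbit_def)
        have q: "q = glen rk (s, h, q)" using F gw by auto
        show ?thesis
        proof (cases h)
          case False
          have g': "gp b rk (Suc t) = (s, True, 0)" using l g False q by (auto simp: gnext_def)
          have "q = rk s" using q False by (simp add: glen_def)
          then show ?thesis unfolding l3 g g' using False rk_le[of s]
            by (intro exI[of _ Keep]) (auto simp: sta_def val_def isA_def intro: stay_mid shift_mid)
        next
          case True
          have g': "gp b rk (Suc t) = (Suc s, False, 0)" using l g True q by (auto simp: gnext_def)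
          have qq: "q = Suc (rk s)" using q True by (simp add: glen_def)
          have v': "val (Suc s, False, 0) = rank (Suc s) (el (Suc s))" by (simp add: val_def)
          have s': "sta (Suc s, False, 0) \<in> {Y1, X1}" by (simp add: sta_def)
          show ?thesis
          proof (cases "isA s")
            case A: True
            then have "tr k (sta (s, h, q)) 3 Dec (sta (Suc s, False, 0))"
              using s' True by (auto simp: sta_def intro: descend_end)
            then show ?thesis unfolding l3 g g' v' using A rank_next[of s] gw rk_le[of s] True qq
              by (intro exI[of _ Dec]) (auto simp: val_def isA_def)
          next
            case A: False
            then have "tr k (sta (s, h, q)) 3 Keep (sta (Suc s, False, 0))"
              using s' True by (auto simp: sta_def intro: shift_end stay_end)
            then show ?thesis unfolding l3 g g' v' using A rank_next[of s] gw rk_le[of s] True qq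
              by (intro exI[of _ Keep]) (auto simp: val_def)
          qed
        qed
      qed
    qed
  qed
  have v0: "val (1, False, 0) = 0"
    using rank_less[of 0 1] el_Suc[of 0] by (simp add: val_def el_0)
  have "((i, \<rho> i), (Suc i, \<rho> (Suc i))) \<in> succs k w" for i
  proof (cases i)
    case 0
    have "tr k Init 0 Keep (sta (1, False, 0))" by (rule start) (auto simp: sta_def)
    then show ?thesis using 0 v0
      by (auto simp: succs_def \<rho>_def wpos_0 word_def intro!: exI[of _ Keep])
  next
    case (Suc t)
    then show ?thesis using step[of t] by (auto simp: succs_def \<rho>_def word_Suc)
  qed
  moreover have "infinite {i. fst (\<rho> i) \<in> {Done, Fin, XA}}"
    unfolding infinite_nat_iff_unbounded
  proof
    fix m
    obtain s0 where s0: "\<And>s. s \<ge> s0 \<Longrightarrow> \<exists>t'\<ge>m. gp b rk t' = (s, False, 0)"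
      using ex_stage_ge[of m b rk] by blast
    \<comment> \<open>Without descents after s0 the followed element would be constant. As the chain
      is injective, a late member exceeds s0 as a number; it lies below the followed element and
      triggers a descent.\<close>
    have "\<exists>s\<ge>s0. isA s"
    proof (rule ccontr)
      assume n: "\<not> ?thesis"
      let ?S = "Suc s0"
      have c: "el s = el ?S" if "s \<ge> ?S" for s using that
      proof (induction rule: dec_induct)
        case (step s)
        then have "\<not> isA s" using n by simp
        then have "el (Suc s) = el s" by (auto simp: el_Suc isA_def isX_def)
        then show ?case using step by simp
      qed simp
      obtain t where t: "a t = el ?S \<or> a t \<sqsubset> el ?S" using el[of ?S] by blast
      have "finite (a -` {..<?S})" using inj by (simp add: finite_vimageI)
      then obtain B where "\<forall>i\<in>a -` {..<?S}. i < B" unfolding finite_nat_set_iff_bounded by blast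
      then obtain t' where t': "t' > t" "t' \<notin> a -` {..<?S}"
        by (metis less_irrefl max_less_iff_conj lessI not_less_eq max.cobounded1 max.cobounded2 le_imp_less_Suc less_not_refl)
      have "a t' \<sqsubset> el ?S" using a_less[OF t'(1)] t trans by metis
      then have "isA (a t')" using c[of "a t'"] t'(2) by (auto simp: isA_def isX_def)
      then show False using n t'(2) by (auto simp: not_less)
    qed
    then obtain s where s: "s \<ge> s0" "isA s" by blast
    obtain t where t: "t \<ge> m" "gp b rk t = (s, False, 0)" using s0[OF s(1)] by blast
    obtain t' q where t': "t' \<ge> t" "gp b rk t' = (s, True, q)" using ex_second_half[OF t(2)] by blast
    then have "fst (\<rho> (Suc t')) = XA" using s(2) by (simp add: \<rho>_def sta_def)
    then show "\<exists>n>m. n \<in> {i. fst (\<rho> i) \<in> {Done, Fin, XA}}"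
      using t t' by (intro exI[of _ "Suc t'"]) auto
  qed
  moreover have "\<rho> 0 = (Init, 0)" by (simp add: \<rho>_def)
  ultimately show ?thesis unfolding accepts_def by blast
qed

end

section \<open>Halting programs\<close>

text \<open>The finite paths are glued by dependent choice on pairs, whose second component counts
  the steps left to the next visit of G.\<close>

lemma infinite_visits:
  assumes G: "\<And>c. c \<in> G \<Longrightarrow> \<exists>c'\<in>G. (c, c') \<in> E\<^sup>+" and c0: "(c0, g) \<in> E\<^sup>*" "g \<in> G"
  shows "\<exists>f. f 0 = c0 \<and> (\<forall>i::nat. (f i, f (Suc i)) \<in> E) \<and> infinite {i. f i \<in> G}"
proof -
  define D where "D c n \<longleftrightarrow> (\<exists>g\<in>G. (c, g) \<in> E ^^ n)" for c n
  let ?Q = "\<lambda>i p. D (fst p) (snd p) \<and> (i = (0::nat) \<longrightarrow> fst p = c0)"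
  let ?R = "\<lambda>i p p'. (fst p, fst p') \<in> E \<and> (snd p \<noteq> 0 \<longrightarrow> snd p = Suc (snd p'))"
  have "\<exists>f. \<forall>i. ?Q i (f i) \<and> ?R i (f i) (f (Suc i))"
  proof (rule dependent_nat_choice)
    obtain n where "(c0, g) \<in> E ^^ n" using c0(1) rtrancl_imp_relpow by blast
    then have "D c0 n" using c0(2) unfolding D_def by blast
    then show "\<exists>p. ?Q 0 p" by auto
  next
    fix p :: "'a \<times> nat" and i assume "?Q i p"
    then obtain c n where p: "p = (c, n)" "D c n" by (cases p) auto
    have "\<exists>m. D c (Suc m) \<and> (n \<noteq> 0 \<longrightarrow> n = Suc m)"
    proof (cases n)
      case 0
      then have "c \<in> G" using p(2) by (auto simp: D_def)
      then obtain c' where "c' \<in> G" "(c, c') \<in> E\<^sup>+" using G by blast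
      then obtain m where "m > 0" "(c, c') \<in> E ^^ m" using trancl_power by metis
      then show ?thesis using 0 \<open>c' \<in> G\<close> unfolding D_def by (intro exI[of _ "m - 1"]) auto
    qed (use p in auto)
    then obtain m where m: "D c (Suc m)" "n \<noteq> 0 \<longrightarrow> n = Suc m" by blast
    then obtain c' where "(c, c') \<in> E" "D c' m" unfolding D_def by (meson relpow_Suc_D2)
    then show "\<exists>p'. ?Q (Suc i) p' \<and> ?R i p p'" using m p by (intro exI[of _ "(c', m)"]) auto
  qed
  then obtain f where f: "\<forall>i. ?Q i (f i) \<and> ?R i (f i) (f (Suc i))" ..
  have "\<exists>j\<ge>i. snd (f j) = 0" for i
  proof (induction "snd (f i)" arbitrary: i)
    case (Suc n)
    then have "n = snd (f (Suc i))" using spec[OF f, of i] by auto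
    from Suc(1)[OF this] show ?case using Suc_leD by blast
  qed auto
  moreover have "snd (f j) = 0 \<Longrightarrow> fst (f j) \<in> G" for j
    using spec[OF f, of j] by (auto simp: D_def)
  ultimately have "infinite {i. fst (f i) \<in> G}" unfolding infinite_nat_iff_unbounded_le by blast
  moreover have "fst (f 0) = c0" using spec[OF f, of 0] by simp
  moreover have "(fst (f i), fst (f (Suc i))) \<in> E" for i using spec[OF f, of i] by simp
  ultimately show ?thesis by (intro exI[of _ "\<lambda>i. fst (f i)"]) simp
qed

text \<open>If the distances of successive markers increase strictly, they become arbitrarily large.\<close>
lemma marker_dichotomy:
  fixes x :: "nat \<Rightarrow> nat"
  assumes inf: "\<And>m. \<exists>e\<ge>m. 2 \<le> x e"
  shows "\<exists>e\<ge>i. 2 \<le> x e \<and> ((\<forall>t. 0 < t \<and> t \<le> B \<longrightarrow> x (e + t) < 2) \<or>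
    (\<exists>c d. 0 < c \<and> 0 < d \<and> d \<le> c \<and> 2 \<le> x (e + c) \<and> 2 \<le> x (e + c + d) \<and>
      (\<forall>t. 0 < t \<and> t < c \<longrightarrow> x (e + t) < 2) \<and> (\<forall>t. 0 < t \<and> t < d \<longrightarrow> x (e + c + t) < 2)))"
proof -
  define nd where "nd e = (LEAST t. 0 < t \<and> 2 \<le> x (e + t))" for e
  have nd: "0 < nd e" "2 \<le> x (e + nd e)" for e
  proof -
    obtain e' where "e' \<ge> Suc e" "2 \<le> x e'" using inf by blast
    then have "0 < e' - e \<and> 2 \<le> x (e + (e' - e))" by auto
    from LeastI[of "\<lambda>t. 0 < t \<and> 2 \<le> x (e + t)", OF this] show "0 < nd e" "2 \<le> x (e + nd e)"
      by (auto simp: nd_def)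
  qed
  have nd_less: "0 < t \<Longrightarrow> t < nd e \<Longrightarrow> x (e + t) < 2" for e t
    unfolding nd_def using not_less_Least by fastforce
  have "\<exists>e\<ge>i. 2 \<le> x e \<and> (B < nd e \<or> nd (e + nd e) \<le> nd e)"
  proof (rule ccontr)
    assume n: "\<not> ?thesis"
    obtain e0 where e0: "e0 \<ge> i" "2 \<le> x e0" using inf by blast
    have "\<exists>e\<ge>i. 2 \<le> x e \<and> j \<le> nd e" for j
    proof (induction j)
      case (Suc j)
      then obtain e where e: "e \<ge> i" "2 \<le> x e" "j \<le> nd e" by blast
      then have "nd e < nd (e + nd e)" using n by auto
      then show ?case using e nd(2)[of e] by (intro exI[of _ "e + nd e"]) auto
    qed (use e0 in blast)
    then obtain e where "e \<ge> i" "2 \<le> x e" "Suc B \<le> nd e" by blast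
    then show False using n by auto
  qed
  then obtain e where e: "e \<ge> i" "2 \<le> x e" "B < nd e \<or> nd (e + nd e) \<le> nd e" by blast
  show ?thesis
  proof (intro exI[of _ e] conjI e)
    show "(\<forall>t. 0 < t \<and> t \<le> B \<longrightarrow> x (e + t) < 2) \<or>
      (\<exists>c d. 0 < c \<and> 0 < d \<and> d \<le> c \<and> 2 \<le> x (e + c) \<and> 2 \<le> x (e + c + d) \<and>
      (\<forall>t. 0 < t \<and> t < c \<longrightarrow> x (e + t) < 2) \<and> (\<forall>t. 0 < t \<and> t < d \<longrightarrow> x (e + c + t) < 2))"
      using e(3)
    proof
      assume "B < nd e"
      then show ?thesis using nd_less[of _ e] by auto
    next
      assume "nd (e + nd e) \<le> nd e"
      then show ?thesis using nd nd_less by (intro disjI2 exI[of _ "nd e"] exI[of _ "nd (e + nd e)"]) auto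
    qed
  qed
qed

section \<open>Exposing errors in an arbitrary word\<close>

locale input_word = machine_trace K p0 nx dl H P k b cp
  for K and p0 :: 'a and nx dl H P k b cp +
  fixes x :: "nat \<Rightarrow> nat" and h :: nat
  assumes x_less: "x i < 4" and halt: "cp h \<in> H"
begin

abbreviation E :: "((nat \<times> 'a st \<times> nat) \<times> (nat \<times> 'a st \<times> nat)) set" where "E \<equiv> succs k x"

lemma E_step: "tr k q (x i) d q' \<Longrightarrow> int v' = int v + cop_delta d \<Longrightarrow> ((i, q, v), (Suc i, q', v')) \<in> E"
  by (auto simp: succs_def)

lemma loop:
  assumes "\<And>j z. j < m \<Longrightarrow> tr k (Q z) (x (i + j)) d (Q True)" and "int v' = int v + int m * cop_delta d"
  shows "((i, Q False, v), (i + m, Q (0 < m), v')) \<in> E\<^sup>*"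
  using assms
proof (induction m arbitrary: v')
  case (Suc m)
  define v'' where "v'' = nat (int v + int m * cop_delta d)"
  have v'': "int v'' = int v + int m * cop_delta d"
    using Suc.prems(2) by (cases d) (auto simp: v''_def algebra_simps)
  have "((i, Q False, v), (i + m, Q (0 < m), v'')) \<in> E\<^sup>*" using Suc.prems(1) v'' by (intro Suc.IH) auto
  moreover have "((i + m, Q (0 < m), v''), (Suc (i + m), Q True, v')) \<in> E"
    by (rule E_step[OF Suc.prems(1)]) (use Suc.prems(2) v'' in \<open>auto simp: algebra_simps\<close>)
  ultimately show ?case by simp
qed simp

lemma loop1:
  assumes "\<And>j. j < m \<Longrightarrow> tr k q (x (i + j)) d q" and "int v' = int v + int m * cop_delta d"
  shows "((i, q, v), (i + m, q, v')) \<in> E\<^sup>*"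
  using loop[of m "\<lambda>_. q" i d v' v] assms by simp

definition matches :: "nat \<Rightarrow> nat \<Rightarrow> bool" where
  "matches e i \<longleftrightarrow> (\<forall>j<i. (\<forall>l<b j. x (e + plen b j + l) = 0) \<and> x (e + plen b j + b j) = 1)"

lemma matches_Suc:
  "matches e (Suc i) \<longleftrightarrow> matches e i \<and> (\<forall>l<b i. x (e + plen b i + l) = 0) \<and> x (e + plen b i + b i) = 1"
  by (auto simp: matches_def less_Suc_eq)

lemma matches_le: "matches e i \<Longrightarrow> j \<le> i \<Longrightarrow> matches e j"
  by (auto simp: matches_def)

text \<open>Along correct blocks \<open>Trk\<close> carries the control of the computation itself,
  so a comparison can be started with the right operation.\<close>

lemma reach_start:
  assumes "x e \<in> {2, 3}" and "matches (Suc e) i" and "q \<in> {Trk (cp i) False, Cmp g (cp i) False}"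
  shows "((e, Wait, v), (Suc e + plen b i, q, v)) \<in> E\<^sup>+"
  using assms(2,3)
proof (induction i arbitrary: q)
  case 0
  have "tr k Wait (x e) Keep q" by (rule phase[of _ _ g]) (use assms(1) 0 cp_0 in auto)
  then have "((e, Wait, v), (Suc e, q, v)) \<in> E" by (rule E_step) simp
  then show ?case by (auto simp: plen_0)
next
  case (Suc i)
  let ?s = "Suc e + plen b i"
  have m: "matches (Suc e) i" "\<And>l. l < b i \<Longrightarrow> x (?s + l) = 0" "x (?s + b i) = 1"
    using Suc.prems(1) by (auto simp: matches_Suc)
  have "((e, Wait, v), (?s, Trk (cp i) False, v)) \<in> E\<^sup>+" using Suc.IH m(1) by blast
  also have "((?s, Trk (cp i) False, v), (?s + b i, Trk (cp i) (0 < b i), v)) \<in> E\<^sup>*"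
    by (rule loop[where d = Keep]) (use m(2) trk[OF cp_P] in auto)
  also have "((?s + b i, Trk (cp i) (0 < b i), v), (Suc (?s + b i), q, v)) \<in> E"
    by (rule E_step[where d = Keep], unfold m(3), rule trk_next[of _ _ _ g]) (use Suc.prems(2) cp_P in \<open>auto simp: cp_Suc\<close>)
  finally show ?case by (simp add: plen_Suc add.assoc)
qed

lemma reach_Zer:
  assumes "x e \<in> {2, 3}" and "matches (Suc e) i" and "i < K"
  shows "((e, Wait, v), (Suc e + plen b i, Zer i, v)) \<in> E\<^sup>+"
  using assms(2,3)
proof (induction i)
  case 0
  have "tr k Wait (x e) Keep (Zer 0)" by (rule phase) (use assms(1) in auto)
  then have "((e, Wait, v), (Suc e, Zer 0, v)) \<in> E" by (rule E_step) simp
  then show ?case by (auto simp: plen_0)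
next
  case (Suc i)
  let ?s = "Suc e + plen b i"
  have m: "matches (Suc e) i" "\<And>l. l < b i \<Longrightarrow> x (?s + l) = 0" "x (?s + b i) = 1"
    using Suc.prems(1) by (auto simp: matches_Suc)
  have "((e, Wait, v), (?s, Zer i, v)) \<in> E\<^sup>+" using Suc m(1) by simp
  also have "((?s, Zer i, v), (?s + b i, Zer i, v)) \<in> E\<^sup>*"
  proof (cases i)
    case 0
    show ?thesis unfolding 0 by (rule loop1[where d = Keep]) (use m(2) zer 0 in auto)
  next
    case (Suc j) then show ?thesis using b_init[of i] \<open>Suc i < K\<close> by simp
  qed
  also have "((?s + b i, Zer i, v), (Suc (?s + b i), Zer (Suc i), v)) \<in> E"
    by (rule E_step[where d = Keep], unfold m(3), rule zer_next) (use Suc.prems(2) in auto)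
  finally show ?case by (simp add: plen_Suc add.assoc)
qed

lemma reach_Mid:
  assumes "matches e (i + m)" "m < K"
  shows "((e + plen b i, Mid g m, v), (e + plen b (i + m), Mid g 0, v)) \<in> E\<^sup>*"
  using assms
proof (induction m arbitrary: i)
  case (Suc m)
  let ?s = "e + plen b i"
  have "matches e (Suc i)" using Suc.prems(1) by (rule matches_le) simp
  then have m: "\<And>l. l < b i \<Longrightarrow> x (?s + l) = 0" "x (?s + b i) = 1" by (auto simp: matches_Suc)
  have "((?s, Mid g (Suc m), v), (?s + b i, Mid g (Suc m), v)) \<in> E\<^sup>*"
    by (rule loop1[where d = Keep]) (use m(1) mid[of m k g] Suc.prems in auto)
  also have "((?s + b i, Mid g (Suc m), v), (Suc (?s + b i), Mid g m, v)) \<in> E"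
    by (rule E_step[where d = Keep], unfold m(2), rule mid_next) (use Suc.prems in auto)
  also have "((Suc (?s + b i), Mid g m, v), (e + plen b (Suc i + m), Mid g 0, v)) \<in> E\<^sup>*"
    using Suc.IH[of "Suc i"] Suc.prems by (simp add: plen_Suc add.assoc)
  finally show ?case by (simp add: plen_Suc add.assoc)
qed simp

text \<open>o' is the offset of the first wrong letter. If the block is too long, everything
  subtracted is regained; if it is too short, less is subtracted than was added, which pays for the
  final \<open>Dec\<close>.\<close>

lemma comparison_error:
  assumes e: "x e \<in> {2, 3}" and m: "matches (Suc e) (j + K)"
    and o': "o' \<le> b (j + K)" "\<And>l. l < o' \<Longrightarrow> x (Suc e + plen b (j + K) + l) = 0"
    and err: "o' < b (j + K) \<and> x (Suc e + plen b (j + K) + o') = 1 \<or>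
      o' = b (j + K) \<and> x (Suc e + plen b (j + K) + o') = 0"
    and v: "b j \<le> v" "b (j + K) \<le> v"
  shows "\<exists>e'. \<exists>v'\<ge>v. ((e, Wait, v), (e', Done, v')) \<in> E\<^sup>+"
proof -
  define g where "g \<longleftrightarrow> o' = b (j + K)"
  let ?s = "Suc e + plen b j" and ?t = "Suc e + plen b (j + K)"
  \<comment> \<open>The counter after block j, after its end letter, and after o' letters of block
    \<open>j + K\<close>. The bounds on v keep all three values nonnegative.\<close>
  define v1 where "v1 = nat (int v - sg g * int (b j))"
  define v2 where "v2 = nat (int v - sg g * int (b (j + K)))"
  define v3 where "v3 = nat (int v - sg g * (int (b (j + K)) - int o'))"
  have v1: "int v1 = int v - sg g * int (b j)" using v by (auto simp: v1_def sg_def)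
  have v2: "int v2 = int v - sg g * int (b (j + K))" using v by (auto simp: v2_def sg_def)
  have v3: "int v3 = int v - sg g * (int (b (j + K)) - int o')" using v o' by (auto simp: v3_def sg_def g_def)
  have "matches (Suc e) (Suc j)" using m by (rule matches_le) (use K_pos in simp)
  then have mj: "matches (Suc e) j" "\<And>l. l < b j \<Longrightarrow> x (?s + l) = 0" "x (?s + b j) = 1"
    by (auto simp: matches_Suc)
  have "((e, Wait, v), (?s, Cmp g (cp j) False, v)) \<in> E\<^sup>+" by (rule reach_start[OF e mj(1), of _ g]) simp
  also have "((?s, Cmp g (cp j) False, v), (?s + b j, Cmp g (cp j) (0 < b j), v1)) \<in> E\<^sup>*"
    by (rule loop[where d = "sgd g Dec"]) (use mj(2) cmp[OF cp_P] v1 in auto)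
  also have "((?s + b j, Cmp g (cp j) (0 < b j), v1), (Suc (?s + b j), Mid g (K - 1), v2)) \<in> E"
    by (rule E_step[where d = "sgd g (cop_neg (dl (cp j) (0 < b j)))"], unfold mj(3), rule cmp_end[OF cp_P])
       (use b_delta[of j] v1 v2 in \<open>auto simp: sg_def\<close>)
  also have "((Suc (?s + b j), Mid g (K - 1), v2), (?t, Mid g 0, v2)) \<in> E\<^sup>*"
    using reach_Mid[of "Suc e" "Suc j" "K - 1" g v2] m K_pos by (simp add: plen_Suc add.assoc)
  also have "((?t, Mid g 0, v2), (?t + o', Mid g 0, v3)) \<in> E\<^sup>*"
    by (rule loop1[where d = "sgd g Inc"]) (use o' v2 v3 in \<open>auto simp: algebra_simps intro: mid_read\<close>)
  finally have r: "((e, Wait, v), (?t + o', Mid g 0, v3)) \<in> E\<^sup>+" .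
  show ?thesis
  proof (cases g)
    case True
    then have "x (?t + o') = 0" "v3 = v" using err v3 by (auto simp: g_def)
    then have "((?t + o', Mid g 0, v3), (Suc (?t + o'), Done, v)) \<in> E"
      using True by (intro E_step[where d = Keep]) (auto intro: mid_gain)
    then show ?thesis using r by (meson le_refl trancl.trancl_into_trancl)
  next
    case False
    then have l: "x (?t + o') = 1" "o' < b (j + K)" using err by (auto simp: g_def)
    then have "v < v3" using v3 False by (auto simp: sg_def)
    then have "((?t + o', Mid g 0, v3), (Suc (?t + o'), Done, v3 - 1)) \<in> E"
      using False l mid_loss[of k] by (intro E_step[where d = Dec]) auto
    moreover have "v \<le> v3 - 1" using \<open>v < v3\<close> by simp
    ultimately show ?thesis using r by (meson trancl.trancl_into_trancl)
  qed
qed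

lemma chain_error:
  assumes e: "x e \<in> {2, 3}" and o': "o' \<le> k" "\<And>l. l < o' \<Longrightarrow> x (Suc e + l) = 0"
    and err: "o' < k \<and> x (Suc e + o') = 1 \<or> o' = k \<and> x (Suc e + o') = 0"
  shows "\<exists>e'. \<exists>v'\<ge>v. ((e, Wait, v), (e', Done, v')) \<in> E\<^sup>+"
proof -
  have "l \<le> o' \<Longrightarrow> ((e, Wait, v), (Suc e + l, Chain l, v)) \<in> E\<^sup>+" for l
  proof (induction l)
    case 0
    have "tr k Wait (x e) Keep (Chain 0)" by (rule phase) (use e in auto)
    then have "((e, Wait, v), (Suc e, Chain 0, v)) \<in> E" by (rule E_step) simp
    then show ?case by auto
  next
    case (Suc l)
    have "((Suc e + l, Chain l, v), (Suc (Suc e + l), Chain (Suc l), v)) \<in> E"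
      by (rule E_step[where d = Keep]) (use Suc.prems o' chain[of l k] in auto)
    then show ?case using Suc by (simp add: trancl.trancl_into_trancl)
  qed
  moreover have "((Suc e + o', Chain o', v), (Suc (Suc e + o'), Done, v)) \<in> E"
    by (rule E_step[where d = Keep]) (use err chain_short[of o' k] chain_long[of k] in auto)
  ultimately show ?thesis by (meson le_refl trancl.trancl_into_trancl)
qed

text \<open>If the first h blocks are correct, tracking them reaches the halting control. Otherwise
  the first wrong block is exposed: block 0 against k, further blocks below K against 0, later ones
  against the block K places before.\<close>

lemma phase_error:
  assumes e: "x e \<in> {2, 3}" and long: "\<And>t. t \<le> plen b h \<Longrightarrow> x (Suc e + t) < 2"
    and v: "\<And>i. i < h \<Longrightarrow> b i \<le> v"
  shows "\<exists>e'. \<exists>v'\<ge>v. ((e, Wait, v), (e', Done, v')) \<in> E\<^sup>+"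
proof (cases "matches (Suc e) h")
  case True
  have "((e, Wait, v), (Suc e + plen b h, Trk (cp h) False, v)) \<in> E\<^sup>+"
    by (rule reach_start[OF e True]) simp
  moreover have "((Suc e + plen b h, Trk (cp h) False, v), (Suc (Suc e + plen b h), Done, v)) \<in> E"
    by (rule E_step[where d = Keep], rule trk_halt[OF halt]) (use long in auto)
  ultimately show ?thesis by (meson le_refl trancl.trancl_into_trancl)
next
  case False
  have "matches (Suc e) 0" by (simp add: matches_def)
  then obtain i where i: "matches (Suc e) i" "\<not> matches (Suc e) (Suc i)"
    using ex_flip[of "matches (Suc e)" 0 h] False by auto
  have ih: "i < h" using False i(1) matches_le not_less by blast
  let ?s = "Suc e + plen b i"
  \<comment> \<open>The offset of the first deviation in block i, or \<open>b i\<close> if all its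
    units are present and the end letter is wrong.\<close>
  define o' where "o' = (LEAST j. b i \<le> j \<or> x (?s + j) \<noteq> 0)"
  have o1: "b i \<le> o' \<or> x (?s + o') \<noteq> 0"
    unfolding o'_def by (rule LeastI[of _ "b i"]) simp
  have o2: "o' \<le> b i" unfolding o'_def by (rule Least_le) simp
  have o3: "x (?s + l) = 0" if "l < o'" for l
    using not_less_Least[of l "\<lambda>j. b i \<le> j \<or> x (?s + j) \<noteq> 0"] that by (auto simp: o'_def)
  have "plen b (Suc i) \<le> plen b h" using ih by (intro plen_mono) simp
  then have "plen b i + o' \<le> plen b h" using o2 by (simp add: plen_Suc)
  then have "x (?s + o') < 2" using long[of "plen b i + o'"] by (simp add: add.assoc)
  then have err: "o' < b i \<and> x (?s + o') = 1 \<or> o' = b i \<and> x (?s + o') = 0"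
    using o1 o2 o3 i by (cases "o' = b i") (auto simp: matches_Suc less_2_cases_iff)
  consider "i = 0" | "0 < i" "i < K" | "K \<le> i" by linarith
  then show ?thesis
  proof cases
    case 1
    then show ?thesis using chain_error[OF e, of o'] o2 o3 err b_0 by (simp add: plen_0)
  next
    case 2
    then have "b i = 0" using b_init by blast
    then have "x ?s = 0" using err by auto
    then have "((?s, Zer i, v), (Suc ?s, Done, v)) \<in> E"
      using zer_error[of "i - 1" k] 2 by (intro E_step[where d = Keep]) auto
    then show ?thesis using reach_Zer[OF e i(1) 2(2), of v] by (meson le_refl trancl.trancl_into_trancl)
  next
    case 3
    then have eq: "i - K + K = i" by simp
    show ?thesis using comparison_error[OF e, of "i - K" o' v, unfolded eq] i(1) o2 o3 err v[of i] v[of "i - K"] ih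
      by auto
  qed
qed

text \<open>The counter gains \<open>c - 1\<close> and loses \<open>d - 1\<close>, which
  \<open>le\<close> makes at most as much.\<close>

lemma length_error:
  assumes e: "2 \<le> x e" and c: "0 < c" "2 \<le> x (e + c)" "\<And>t. 0 < t \<Longrightarrow> t < c \<Longrightarrow> x (e + t) < 2"
    and d: "0 < d" "2 \<le> x (e + c + d)" "\<And>t. 0 < t \<Longrightarrow> t < d \<Longrightarrow> x (e + c + t) < 2" and le: "d \<le> c"
  shows "\<exists>e'. \<exists>v'\<ge>v. ((e, Wait, v), (e', Done, v')) \<in> E\<^sup>+"
proof -
  have mk: "x i \<in> {2, 3}" if "2 \<le> x i" for i using that x_less[of i] by auto
  have "((e, Wait, v), (Suc e, LenA, v)) \<in> E\<^sup>+"
    by (rule r_into_trancl, rule E_step[where d = Keep], rule phase) (use mk[OF e] in auto)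
  also have "((Suc e, LenA, v), (Suc e + (c - 1), LenA, v + (c - 1))) \<in> E\<^sup>*"
    by (rule loop1[where d = Inc]) (use c(3)[of "Suc _"] in \<open>auto intro: lenA\<close>)
  also have "((Suc e + (c - 1), LenA, v + (c - 1)), (Suc (e + c), LenB, v + (c - 1))) \<in> E"
    using E_step[where d = Keep, OF lenA_end[OF mk[OF c(2)]], of "v + (c - 1)" "v + (c - 1)"] c(1) by simp
  also have "((Suc (e + c), LenB, v + (c - 1)), (Suc (e + c) + (d - 1), LenB, v + (c - 1) - (d - 1))) \<in> E\<^sup>*"
    by (rule loop1[where d = Dec]) (use d(3)[of "Suc _"] le in \<open>auto intro: lenB\<close>)
  also have "((Suc (e + c) + (d - 1), LenB, v + (c - 1) - (d - 1)), (Suc (e + c + d), Done, v + (c - 1) - (d - 1))) \<in> E"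
    using E_step[where d = Keep, OF lenB_end[OF mk[OF d(2)]], of "v + (c - 1) - (d - 1)" "v + (c - 1) - (d - 1)"] d(1) by simp
  finally have "((e, Wait, v), (Suc (e + c + d), Done, v + (c - 1) - (d - 1))) \<in> E\<^sup>+" .
  moreover have "v \<le> v + (c - 1) - (d - 1)" using le by simp
  ultimately show ?thesis by blast
qed

lemma wait: "((i, Wait, v), (i + m, Wait, v)) \<in> E\<^sup>*"
  by (rule loop1[where d = Keep]) (auto intro: tr.wait x_less)

lemma acceptsI:
  assumes "\<And>c. c \<in> G \<Longrightarrow> \<exists>c'\<in>G. (c, c') \<in> E\<^sup>+" and "((0, Init, 0), g) \<in> E\<^sup>*" "g \<in> G"
    and G: "\<And>i q v. (i, q, v) \<in> G \<Longrightarrow> q \<in> {Done, Fin, XA}"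
  shows "accepts k x"
proof -
  from infinite_visits[OF assms(1-3)] obtain f
    where f: "f 0 = (0, Init, 0)" "\<And>i. (f i, f (Suc i)) \<in> E" "infinite {i. f i \<in> G}" by auto
  have fst: "fst (f i) = i" for i
  proof (induction i)
    case (Suc i) then show ?case using f(2)[of i] by (auto simp: succs_def split: prod.splits)
  qed (simp add: f)
  define \<rho> where "\<rho> i = snd (f i)" for i
  have fr: "f i = (i, \<rho> i)" for i using fst[of i] by (metis \<rho>_def prod.collapse)
  have "{i. f i \<in> G} \<subseteq> {i. fst (\<rho> i) \<in> {Done, Fin, XA}}"
  proof
    fix i assume "i \<in> {i. f i \<in> G}"
    then have "(i, fst (\<rho> i), snd (\<rho> i)) \<in> G" using fr[of i] by simp
    then show "i \<in> {i. fst (\<rho> i) \<in> {Done, Fin, XA}}" using G by blast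
  qed
  then have "infinite {i. fst (\<rho> i) \<in> {Done, Fin, XA}}" using f(3) finite_subset by blast
  moreover have "\<rho> 0 = (Init, 0)" using f(1) fr[of 0] by simp
  moreover have "((i, \<rho> i), (Suc i, \<rho> (Suc i))) \<in> E" for i using f(2)[of i] unfolding fr .
  ultimately show ?thesis unfolding accepts_def by blast
qed

text \<open>After finitely many markers the run can stay in \<open>Fin\<close>. Otherwise it pumps
  the counter once to C, a bound on all blocks before the halt, and then exposes one error after
  another, none of which lowers the counter.\<close>

theorem halting_accepts: "accepts k x"
proof -
  have pump: "((0, Init, 0), (Suc (Suc C), Wait, C)) \<in> E\<^sup>*" for C
  proof -
    have "((0, Init, 0), (Suc 0, Pump, 0)) \<in> E" by (rule E_step[where d = Keep]) (auto intro: start x_less)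
    also have "((Suc 0, Pump, 0), (Suc 0 + C, Pump, C)) \<in> E\<^sup>*"
      by (rule loop1[where d = Inc]) (auto intro: tr.pump x_less)
    also have "((Suc 0 + C, Pump, C), (Suc (Suc C), Wait, C)) \<in> E"
      using E_step[where d = Keep, OF pump_wait[OF x_less], of C C "Suc 0 + C"] by simp
    finally show ?thesis .
  qed
  show ?thesis
  proof (cases "\<forall>m. \<exists>e\<ge>m. 2 \<le> x e")
    case False
    then obtain N where N: "\<And>i. i \<ge> N \<Longrightarrow> x i < 2" by (meson not_le)
    let ?G = "{(i, q, v). N \<le> i \<and> q = Fin} :: (nat \<times> 'a st \<times> nat) set"
    show ?thesis
    proof (rule acceptsI[of ?G])
      fix c assume "c \<in> ?G"
      then obtain i v where c: "c = (i, Fin, v)" "N \<le> i" by auto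
      have "(c, (Suc i, Fin, v)) \<in> E" unfolding c
        by (rule E_step[where d = Keep]) (use N c in \<open>auto intro: fin\<close>)
      then show "\<exists>c'\<in>?G. (c, c') \<in> E\<^sup>+" using c by (intro bexI[of _ "(Suc i, Fin, v)"]) auto
    next
      have "((0, Init, 0), (Suc (Suc 0) + N, Wait, 0)) \<in> E\<^sup>*" using pump[of 0] wait by (rule rtrancl_trans)
      moreover have "((Suc (Suc 0) + N, Wait, 0), (Suc (Suc (Suc 0) + N), Fin, 0)) \<in> E"
        by (rule E_step[where d = Keep]) (auto intro: tr.wait x_less)
      ultimately show "((0, Init, 0), (Suc (Suc (Suc 0) + N), Fin, 0)) \<in> E\<^sup>*" by (rule rtrancl_into_rtrancl)
    qed auto
  next
    case True
    define C where "C = (\<Sum>i<h. b i)"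
    have C: "b i \<le> C" if "i < h" for i
      unfolding C_def using member_le_sum[of i "{..<h}" b] that by simp
    have seg: "\<exists>e'. \<exists>v'\<ge>v. ((i, Wait, v), (e', Done, v')) \<in> E\<^sup>+" if "C \<le> v" for i v
    proof -
      obtain e where e: "e \<ge> i" "2 \<le> x e" "(\<forall>t. 0 < t \<and> t \<le> Suc (plen b h) \<longrightarrow> x (e + t) < 2) \<or>
        (\<exists>c d. 0 < c \<and> 0 < d \<and> d \<le> c \<and> 2 \<le> x (e + c) \<and> 2 \<le> x (e + c + d) \<and>
          (\<forall>t. 0 < t \<and> t < c \<longrightarrow> x (e + t) < 2) \<and> (\<forall>t. 0 < t \<and> t < d \<longrightarrow> x (e + c + t) < 2))"
        using marker_dichotomy[of x i "Suc (plen b h)"] True by blast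
      have mk: "x e \<in> {2, 3}" using e(2) x_less[of e] by auto
      have "\<exists>e'. \<exists>v'\<ge>v. ((e, Wait, v), (e', Done, v')) \<in> E\<^sup>+"
        using e(3)
      proof
        assume l: "\<forall>t. 0 < t \<and> t \<le> Suc (plen b h) \<longrightarrow> x (e + t) < 2"
        have "x (Suc e + t) < 2" if "t \<le> plen b h" for t
          using l[rule_format, of "Suc t"] that by simp
        then show ?thesis using phase_error[OF mk] C \<open>C \<le> v\<close> by (meson le_trans)
      next
        assume "\<exists>c d. 0 < c \<and> 0 < d \<and> d \<le> c \<and> 2 \<le> x (e + c) \<and> 2 \<le> x (e + c + d) \<and>
          (\<forall>t. 0 < t \<and> t < c \<longrightarrow> x (e + t) < 2) \<and> (\<forall>t. 0 < t \<and> t < d \<longrightarrow> x (e + c + t) < 2)"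
        then obtain c d where "0 < c" "0 < d" "d \<le> c" "2 \<le> x (e + c)" "2 \<le> x (e + c + d)"
          "\<And>t. 0 < t \<Longrightarrow> t < c \<Longrightarrow> x (e + t) < 2" "\<And>t. 0 < t \<Longrightarrow> t < d \<Longrightarrow> x (e + c + t) < 2" by blast
        then show ?thesis by (intro length_error[OF e(2)]) auto
      qed
      then obtain e' v' where "v' \<ge> v" "((e, Wait, v), (e', Done, v')) \<in> E\<^sup>+" by blast
      moreover have "((i, Wait, v), (e, Wait, v)) \<in> E\<^sup>*" using wait[of i v "e - i"] e(1) by simp
      ultimately show ?thesis by (meson rtrancl_trancl_trancl)
    qed
    let ?G = "{(i, q, v). C \<le> v \<and> q = Done} :: (nat \<times> 'a st \<times> nat) set"
    obtain e0 v0 where e0: "v0 \<ge> C" "((Suc (Suc C), Wait, C), (e0, Done, v0)) \<in> E\<^sup>+" using seg by blast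
    show ?thesis
    proof (rule acceptsI[of ?G])
      fix c assume "c \<in> ?G"
      then obtain i v where c: "c = (i, Done, v)" "C \<le> v" by auto
      obtain e' v' where "v' \<ge> v" "((Suc i, Wait, v), (e', Done, v')) \<in> E\<^sup>+" using seg[OF c(2)] by blast
      moreover have "(c, (Suc i, Wait, v)) \<in> E" unfolding c
        by (rule E_step[where d = Keep]) (auto intro: done_wait x_less)
      ultimately have "(c, (e', Done, v')) \<in> E\<^sup>+" "C \<le> v'" using c(2) by (meson trancl_into_trancl2, simp)
      then show "\<exists>c'\<in>?G. (c, c') \<in> E\<^sup>+" by (intro bexI[of _ "(e', Done, v')"]) auto
    next
      show "((0, Init, 0), (e0, Done, v0)) \<in> E\<^sup>*"
        using pump[of C] e0(2) by (meson trancl_into_rtrancl rtrancl_trans)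
    qed (use e0(1) in auto)
  qed
qed

end

section \<open>The reduction\<close>

instance com :: countable
  by countable_datatype

text \<open>Fits \<open>chain_bca\<close> with \<open>dn = 1\<close>: even numbers for the chain, 1
  for \<open>Done\<close>, odd numbers from 3 on for the rest.\<close>

fun enc :: "('p::countable) st \<Rightarrow> nat" where
  "enc (Chain i) = 2 * i"
| "enc Done = 1"
| "enc q = 2 * to_nat q + 3"

lemma enc_inject: "enc q = enc q' \<longleftrightarrow> q = q'"
proof
  have aux: "enc q = (case q of Chain i \<Rightarrow> 2 * i | Done \<Rightarrow> 1 | _ \<Rightarrow> 2 * to_nat q + 3)" for q :: "'a st"
    by (cases q) auto
  have odd: "2 * (i::nat) \<noteq> 2 * j + 3" for i j by presburger
  have odd1: "2 * (i::nat) \<noteq> Suc 0" for i by presburger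
  assume "enc q = enc q'"
  then show "q = q'"
    unfolding aux using odd odd[symmetric] odd1 odd1[symmetric] by (auto split: st.splits)
qed simp

section \<open>Continuity of the word in the ranks\<close>

lemma wpos_local:
  "(\<And>l. l \<le> t \<Longrightarrow> r l = r' l) \<Longrightarrow> wpos b r t = wpos b r' t \<and> fst (snd (snd (snd (wpos b r t)))) \<le> Suc t"
proof (induction t)
  case (Suc t)
  obtain n i o' s h q where w: "wpos b r t = (n, i, o', s, h, q)" by (metis surj_pair)
  have "wpos b r' t = (n, i, o', s, h, q)" "s \<le> Suc t" using Suc w by auto
  moreover have "r s = r' s" using Suc.prems \<open>s \<le> Suc t\<close> by simp
  ultimately show ?case by (auto simp: wpos_Suc w wnext_def gnext_def glen_def)
qed (simp add: wpos_0)

text \<open>Each letter advances the element by at most one, so ranks beyond t cannot influence the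
  letter at t.\<close>

lemma word_local:
  assumes "\<And>l. l \<le> t \<Longrightarrow> r l = r' l" shows "word b r t = word b r' t"
proof (cases t)
  case (Suc u)
  obtain n i o' s h q where w: "wpos b r u = (n, i, o', s, h, q)" by (metis surj_pair)
  have "wpos b r' u = (n, i, o', s, h, q)" "s \<le> Suc u" using wpos_local[of u r r' b] assms Suc w by auto
  moreover have "r s = r' s" using assms Suc \<open>s \<le> Suc u\<close> by simp
  ultimately show ?thesis by (auto simp: Suc word_def w letter_def gbit_def glen_def)
qed (simp add: word_def)

section \<open>The finite transition table\<close>

context rotating_machine
begin

text \<open>Outside the chain the transitions are the same for every k, so \<open>tr 0\<close>
  represents them all.\<close>

definition fixed_tr :: "('p st \<times> nat \<times> cop \<times> 'p st) set" where
  "fixed_tr = {(q, a, d, q'). tr 0 q a d q' \<and> q \<notin> range Chain}"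

lemma tr_not_chain:
  assumes t: "tr k q a d q'" and nc: "q \<notin> range Chain"
  shows "tr k' q a d q'"
  using t
proof cases
  case start then show ?thesis by (simp add: tr.start del: One_nat_def)
next
  case pump then show ?thesis by (simp add: tr.pump del: One_nat_def)
next
  case pump_wait then show ?thesis by (simp add: tr.pump_wait del: One_nat_def)
next
  case wait then show ?thesis by (simp add: tr.wait del: One_nat_def)
next
  case done_wait then show ?thesis by (simp add: tr.done_wait del: One_nat_def)
next
  case fin then show ?thesis by (simp add: tr.fin del: One_nat_def)
next
  case (phase g) then show ?thesis using tr.phase[of a q' g k'] by simp
next
  case chain then show ?thesis using nc by blast
next
  case chain_short then show ?thesis using nc by blast
next
  case chain_long then show ?thesis using nc by blast
next
  case zer then show ?thesis by (simp add: tr.zer del: One_nat_def)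
next
  case zer_next then show ?thesis by (simp add: tr.zer_next del: One_nat_def)
next
  case zer_error then show ?thesis by (simp add: tr.zer_error del: One_nat_def)
next
  case trk then show ?thesis by (simp add: tr.trk del: One_nat_def)
next
  case (trk_next p z g) then show ?thesis using tr.trk_next[of p q' z g k'] by (simp del: One_nat_def)
next
  case trk_halt then show ?thesis by (simp add: tr.trk_halt del: One_nat_def)
next
  case cmp then show ?thesis by (simp add: tr.cmp del: One_nat_def)
next
  case cmp_end then show ?thesis by (simp add: tr.cmp_end del: One_nat_def)
next
  case mid then show ?thesis by (simp add: tr.mid del: One_nat_def)
next
  case mid_next then show ?thesis by (simp add: tr.mid_next del: One_nat_def)
next
  case mid_read then show ?thesis by (simp add: tr.mid_read del: One_nat_def)
next
  case mid_gain then show ?thesis by (simp add: tr.mid_gain del: One_nat_def)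
next
  case mid_loss then show ?thesis by (simp add: tr.mid_loss del: One_nat_def)
next
  case lenA then show ?thesis by (simp add: tr.lenA del: One_nat_def)
next
  case lenA_end then show ?thesis by (simp add: tr.lenA_end del: One_nat_def)
next
  case lenB then show ?thesis by (simp add: tr.lenB del: One_nat_def)
next
  case lenB_end then show ?thesis by (simp add: tr.lenB_end del: One_nat_def)
next
  case ord_skip then show ?thesis by (simp add: tr.ord_skip del: One_nat_def)
next
  case stay then show ?thesis by (simp add: tr.stay del: One_nat_def)
next
  case stay_mid then show ?thesis by (simp add: tr.stay_mid del: One_nat_def)
next
  case stay_end then show ?thesis by (simp add: tr.stay_end del: One_nat_def)
next
  case shift_dec then show ?thesis by (simp add: tr.shift_dec del: One_nat_def)
next
  case shift_mid then show ?thesis by (simp add: tr.shift_mid del: One_nat_def)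
next
  case shift_inc then show ?thesis by (simp add: tr.shift_inc del: One_nat_def)
next
  case shift_end then show ?thesis by (simp add: tr.shift_end del: One_nat_def)
next
  case descend_end then show ?thesis by (simp add: tr.descend_end del: One_nat_def)
qed

lemma tr_iff:
  "tr k q a d q' \<longleftrightarrow> (q, a, d, q') \<in> fixed_tr \<or>
     d = Keep \<and> ((\<exists>i<k. q = Chain i \<and> (a = 0 \<and> q' = Chain (Suc i) \<or> a = 1 \<and> q' = Done)) \<or>
       q = Chain k \<and> a = 0 \<and> q' = Done)" (is "_ \<longleftrightarrow> _ \<or> ?c")
proof
  assume t: "tr k q a d q'"
  show "(q, a, d, q') \<in> fixed_tr \<or> ?c"
  proof (cases "q \<in> range Chain")
    case True
    from t show ?thesis by cases (use True in auto)
  next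
    case False then show ?thesis using tr_not_chain[OF t] by (simp add: fixed_tr_def)
  qed
next
  assume "(q, a, d, q') \<in> fixed_tr \<or> ?c"
  then show "tr k q a d q'"
  proof
    assume "(q, a, d, q') \<in> fixed_tr"
    then show ?thesis using tr_not_chain[of 0 q a d q' k] by (simp add: fixed_tr_def)
  next
    assume ?c
    then show ?thesis using chain[of _ k] chain_short[of _ k] chain_long[of k] by auto
  qed
qed

lemma finite_fixed_tr: "finite fixed_tr"
proof -
  define A :: "'p st set" where "A = {Init, Done, Fin, Pump, Wait, Chain 0, LenA, LenB, Y1, Y2, X1, X2, XA} \<union>
    (\<Union>p\<in>P. \<Union>z. {Trk p z, Cmp True p z, Cmp False p z}) \<union> (\<Union>n<K. {Zer n, Mid True n, Mid False n})"
  have "finite A" unfolding A_def using finite_P by auto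
  have st: "Trk p z \<in> A" "Cmp g p z \<in> A" if "p \<in> P" for p z g
    using that by (cases g; auto simp: A_def)+
  have md: "Mid g n \<in> A" "Zer n \<in> A" if "n < K" for g n
    using that by (cases g; auto simp: A_def)+
  have A0: "Init \<in> A" "Done \<in> A" "Fin \<in> A" "Pump \<in> A" "Wait \<in> A" "Chain 0 \<in> A" "LenA \<in> A" "LenB \<in> A"
    "Y1 \<in> A" "Y2 \<in> A" "X1 \<in> A" "X2 \<in> A" "XA \<in> A" by (simp_all add: A_def)
  have "q \<in> A \<and> a < 4 \<and> q' \<in> A" if "tr 0 q a d q'" "q \<notin> range Chain" for q a d q'
    using that(1)
  proof cases
    case (phase g)
    then show ?thesis using st[OF p0_P] md[OF K_pos] A0 by auto
  next
    case (zer) then show ?thesis using md[OF K_pos] by auto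
  next
    case (zer_next j) then show ?thesis using md(2)[of j] md(2)[of "Suc j"] A0 by auto
  next
    case (zer_error j) then show ?thesis using md(2)[of "Suc j"] A0 by auto
  next
    case (trk p z) then show ?thesis using st(1)[of p] by auto
  next
    case (trk_next p z g) then show ?thesis using st(1)[of p z] st[OF nx_P[of p z]] by auto
  next
    case (trk_halt p z) then show ?thesis using st(1)[of p z] H_P A0 by auto
  next
    case (cmp p g z) then show ?thesis using st(2)[of p] by auto
  next
    case (cmp_end p g z) then show ?thesis using st(2)[of p g z] md(1)[of "K - 1" g] K_pos by auto
  next
    case (mid n g) then show ?thesis using md(1)[of "Suc n" g] by auto
  next
    case (mid_next n g)
    then show ?thesis using md(1)[of "Suc n" g]
      md(1)[of n g] by auto
  next
    case (mid_read g) then show ?thesis using md(1)[OF K_pos, of g] by auto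
  next
    case mid_gain then show ?thesis using md(1)[OF K_pos, of True] A0 by auto
  next
    case mid_loss then show ?thesis using md(1)[OF K_pos, of False] A0 by auto
  qed (use that(2) A0 in auto)
  then have "fixed_tr \<subseteq> A \<times> {..<4} \<times> UNIV \<times> A" by (auto simp: fixed_tr_def)
  moreover have "finite (UNIV :: cop set)"
  proof -
    have "(UNIV :: cop set) = {Dec, Keep, Inc}" using cop.exhaust by blast
    then show ?thesis by (metis finite.emptyI finite.insertI)
  qed
  ultimately show ?thesis using \<open>finite A\<close> by (auto intro: finite_subset)
qed

end

lemma chain_bca_lang:
  fixes p0 :: "'p :: countable"
  assumes "rotating_machine K p0 nx dl H P"
    and T: "set T = (\<lambda>(q, a, d, q'). (enc q, a, d, enc q')) ` rotating_machine.fixed_tr K p0 nx dl H P"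
  shows "bca_lang (chain_bca 1 (enc (Init :: 'p st)) (map enc [Done :: 'p st, Fin, XA]) k T) =
    {x. (\<forall>i. x i < 4) \<and> rotating_machine.accepts K p0 nx dl H P k x}"
proof -
  interpret rotating_machine K p0 nx dl H P by fact
  let ?M = "chain_bca 1 (enc (Init :: 'p st)) (map enc [Done :: 'p st, Fin, XA]) k T"
  have M: "alph ?M = 4" "init ?M = enc (Init :: 'p st)" "acc ?M = map enc [Done :: 'p st, Fin, XA]"
    by (simp_all add: chain_bca_def)
  have trans: "(s, a, d, s') \<in> set (trans ?M) \<longleftrightarrow> (\<exists>q q'. s = enc q \<and> s' = enc q' \<and> tr k q a d q')" for s a d s'
  proof
    assume "(s, a, d, s') \<in> set (trans ?M)"
    then consider "s = 2 * k \<and> a = 0 \<and> d = Keep \<and> s' = 1" | "(s, a, d, s') \<in> set (chain_trans 1 k)" | "(s, a, d, s') \<in> set T"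
      by (auto simp: chain_bca_def)
    then show "\<exists>q q'. s = enc q \<and> s' = enc q' \<and> tr k q a d q'"
    proof cases
      case 1
      then show ?thesis using chain_long[of k] by (intro exI[of _ "Chain k"] exI[of _ Done]) auto
    next
      case 2
      then obtain i where i: "i < k" "s = 2 * i" "d = Keep" "a = 0 \<and> s' = 2 * Suc i \<or> a = 1 \<and> s' = 1"
        by (auto simp: set_chain_trans)
      from i(4) show ?thesis
      proof
        assume "a = 0 \<and> s' = 2 * Suc i"
        then show ?thesis using i chain[of i k] by (intro exI[of _ "Chain i"] exI[of _ "Chain (Suc i)"]) auto
      next
        assume "a = 1 \<and> s' = 1"
        then show ?thesis using i chain_short[of i k] by (intro exI[of _ "Chain i"] exI[of _ Done]) auto
      qed
    next
      case 3
      then show ?thesis using tr_iff unfolding T by auto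
    qed
  next
    assume "\<exists>q q'. s = enc q \<and> s' = enc q' \<and> tr k q a d q'"
    then obtain q q' where q: "s = enc q" "s' = enc q'" "tr k q a d q'" by blast
    from q(3)[unfolded tr_iff] show "(s, a, d, s') \<in> set (trans ?M)"
    proof
      assume "(q, a, d, q') \<in> fixed_tr"
      then have "(s, a, d, s') \<in> set T" unfolding T q by force
      then show ?thesis by (simp add: chain_bca_def)
    qed (use q(1,2) in \<open>auto simp: chain_bca_def set_chain_trans\<close>)
  qed
  have acc: "enc q \<in> set (acc ?M) \<longleftrightarrow> q \<in> {Done, Fin, XA}" for q :: "'p st"
    unfolding M by (auto simp: enc_inject simp del: enc.simps)
  have "(\<exists>\<rho>. bca_run ?M x \<rho> \<and> infinite {i. fst (\<rho> i) \<in> set (acc ?M)}) \<longleftrightarrow> accepts k x" for x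
  proof
    assume "\<exists>\<rho>. bca_run ?M x \<rho> \<and> infinite {i. fst (\<rho> i) \<in> set (acc ?M)}"
    then obtain \<rho> where \<rho>: "\<rho> 0 = (enc (Init :: 'p st), 0)"
      "\<And>i. \<exists>d. (fst (\<rho> i), x i, d, fst (\<rho> (Suc i))) \<in> set (trans ?M) \<and>
          int (snd (\<rho> (Suc i))) = int (snd (\<rho> i)) + cop_delta d"
      "infinite {i. fst (\<rho> i) \<in> set (acc ?M)}"
      unfolding bca_run_def M by blast
    have "\<exists>q :: 'p st. fst (\<rho> i) = enc q" for i
    proof (cases i)
      case 0 then show ?thesis using \<rho>(1) by (metis fst_conv)
    next
      case (Suc j) then show ?thesis using \<rho>(2)[of j] unfolding trans by blast
    qed
    then obtain q :: "nat \<Rightarrow> 'p st" where q: "\<And>i. fst (\<rho> i) = enc (q i)" by metis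
    define \<sigma> where "\<sigma> i = (q i, snd (\<rho> i))" for i
    have "\<sigma> 0 = (Init, 0)" using q[of 0] \<rho>(1) by (simp add: \<sigma>_def enc_inject del: enc.simps)
    moreover have "((i, \<sigma> i), (Suc i, \<sigma> (Suc i))) \<in> succs k x" for i
      using \<rho>(2)[of i] unfolding trans q by (auto simp: succs_def \<sigma>_def enc_inject simp del: enc.simps)
    moreover have "infinite {i. fst (\<sigma> i) \<in> {Done, Fin, XA}}"
      using \<rho>(3) unfolding q acc by (simp add: \<sigma>_def)
    ultimately show "accepts k x" unfolding accepts_def by blast
  next
    assume "accepts k x"
    then obtain \<sigma> where \<sigma>: "\<sigma> 0 = (Init, 0)" "\<And>i. ((i, \<sigma> i), (Suc i, \<sigma> (Suc i))) \<in> succs k x"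
      "infinite {i. fst (\<sigma> i) \<in> {Done, Fin, XA}}" unfolding accepts_def by blast
    define \<rho> where "\<rho> i = (enc (fst (\<sigma> i)), snd (\<sigma> i))" for i
    have "bca_run ?M x \<rho>"
      unfolding bca_run_def M
    proof (intro conjI allI)
      show "\<rho> 0 = (enc (Init :: 'p st), 0)" by (simp add: \<rho>_def \<sigma>)
      fix i
      obtain d where d: "tr k (fst (\<sigma> i)) (x i) d (fst (\<sigma> (Suc i)))"
        "int (snd (\<sigma> (Suc i))) = int (snd (\<sigma> i)) + cop_delta d"
        using \<sigma>(2)[of i] by (auto simp: succs_def split: prod.splits)
      have "(enc (fst (\<sigma> i)), x i, d, enc (fst (\<sigma> (Suc i)))) \<in> set (trans ?M)"
        unfolding trans using d(1) by blast
      then show "\<exists>p a d q. (p, a, d, q) \<in> set (trans ?M) \<and> p = fst (\<rho> i) \<and> a = x i \<and>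
          q = fst (\<rho> (Suc i)) \<and> int (snd (\<rho> (Suc i))) = int (snd (\<rho> i)) + cop_delta d"
        using d(2) by (auto simp: \<rho>_def)
    qed
    moreover have "infinite {i. fst (\<rho> i) \<in> set (acc ?M)}"
      using \<sigma>(3) unfolding \<rho>_def fst_conv acc .
    ultimately show "\<exists>\<rho>. bca_run ?M x \<rho> \<and> infinite {i. fst (\<rho> i) \<in> set (acc ?M)}" by blast
  qed
  then show ?thesis unfolding bca_lang_def M by blast
qed

text \<open>The passage from z to its diagonal tree, the ranks of the induced order and the word is
  continuous, so a Borel L would make ill-foundedness of diagonal trees Borel.\<close>

lemma ordered_words_not_borel:
  assumes L: "\<And>T. (\<And>s t. s @ t \<in> T \<Longrightarrow> s \<in> T) \<Longrightarrow>
    word b (tree_rank T) \<in> L \<longleftrightarrow> (\<exists>a::nat \<Rightarrow> nat. \<forall>i. tree_less T (a (Suc i)) (a i))"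
  shows "\<not> borel_in (cantor 4) L"
proof
  assume "borel_in (cantor 4) L"
  then have "{z. word b (tree_rank (diag_tree z)) \<in> L} \<in> sigma_sets UNIV {U. open U}"
  proof (rule borel_in_cantor_vimage)
    fix z i
    obtain n where n: "\<forall>y. (\<forall>j<n. y j = z j) \<longrightarrow> (\<forall>l\<le>i. tree_rank (diag_tree y) l = tree_rank (diag_tree z) l)"
      using tree_rank_local by blast
    show "\<exists>n. \<forall>y. (\<forall>j<n. y j = z j) \<longrightarrow>
        word b (tree_rank (diag_tree y)) i = word b (tree_rank (diag_tree z)) i"
      by (intro exI[of _ n] allI impI word_local) (use n in blast)
  qed (rule word_less)
  moreover have "{z. word b (tree_rank (diag_tree z)) \<in> L} = {z. \<exists>s. \<forall>n. pref s n \<in> diag_tree z}"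
  proof (intro Collect_cong)
    fix z
    have "word b (tree_rank (diag_tree z)) \<in> L \<longleftrightarrow> (\<exists>a::nat \<Rightarrow> nat. \<forall>i. tree_less (diag_tree z) (a (Suc i)) (a i))"
      by (rule L) (rule diag_tree_closed)
    also have "\<dots> \<longleftrightarrow> (\<exists>s. \<forall>n. pref s n \<in> diag_tree z)"
      by (rule tree_less_ill_iff) (rule diag_tree_closed)
    finally show "word b (tree_rank (diag_tree z)) \<in> L \<longleftrightarrow> (\<exists>s. \<forall>n. pref s n \<in> diag_tree z)" .
  qed
  ultimately show False using ill_founded_diag_not_borel by simp
qed

text \<open>The construction yields either the whole space or a non-Borel set, so deciding a
  property that separates the two contradicts itself on the automaton of its own program.\<close>

lemma undecidable_if_separates:
  assumes full: "\<And>M. bca_lang M = topspace (cantor (alph M)) \<Longrightarrow> Q M"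
    and not_borel: "\<And>M. \<not> borel_in (cantor (alph M)) (bca_lang M) \<Longrightarrow> \<not> Q M"
  shows "\<not> decidable_bca Q"
proof
  assume "decidable_bca Q"
  then obtain f where f: "\<And>M. rec_eval f [bca_enc M] (if Q M then 1 else 0)"
    unfolding decidable_bca_def by blast
  \<comment> \<open>The encoding depends only on the type \<open>ctl\<close>, so the initial and
    accepting states, and with them G, are fixed before c is known.\<close>
  let ?i0 = "enc (Init :: ctl st)" and ?fs = "map enc [Done :: ctl st, Fin, XA]"
  obtain G where G: "\<And>T. rec_eval G [trans_code T] (bca_enc (chain_bca 1 ?i0 ?fs (trans_code T) T))"
    using rec_eval_chain_bca by blast
  \<comment> \<open>c puts the automaton whose code G computes from the input to the supposed
    decision procedure, and halts iff the answer is 0.\<close>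
  obtain c where c: "\<And>k y. rec_eval (Comp f [G]) [k] y \<Longrightarrow> halts c k \<longleftrightarrow> y = 0"
    using halting_program by blast
  define K where "K = Suc (max_reg c)"
  have K: "max_reg c < K" "0 < K" by (simp_all add: K_def)
  let ?p0 = "([c], 0, False) :: ctl" and ?H = "{[]} \<times> {..<K} \<times> (UNIV :: bool set)"
    and ?P = "insert [] (conts c []) \<times> {..<K} \<times> (UNIV :: bool set)"
  note rm = com_rotating_machine[OF K(1)]
  interpret rotating_machine K ?p0 "ctl_next K" ctl_op ?H ?P by (rule rm)
  obtain T where T: "set T = (\<lambda>(q, a, d, q'). (enc q, a, d, enc q')) ` fixed_tr"
    by (rule exE[OF finite_list[OF finite_imageI[OF finite_fixed_tr]]])
  \<comment> \<open>The input is the code of the transitions built from c, so that c is asked about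
    its own automaton M.\<close>
  define k where "k = trans_code T"
  define M where "M = chain_bca 1 ?i0 ?fs k T"
  have alph: "alph M = 4" by (simp add: M_def chain_bca_def)
  have lang: "bca_lang M = {x. (\<forall>i. x i < 4) \<and> accepts k x}"
    unfolding M_def by (rule chain_bca_lang[OF rm T])
  interpret tr: machine_trace K ?p0 "ctl_next K" ctl_op ?H ?P k "trace_block c K k" "trace_ctl c K k"
    by (rule com_machine_trace[OF K(1)])
  have H: "trace_ctl c K k i \<in> ?H \<longleftrightarrow> fst (trace_ctl c K k i) = []" for i
    using K(2) by (auto simp: trace_ctl_def split: prod.splits)
  have "rec_eval (Comp f [G]) [k] (if Q M then 1 else 0)"
    using rec_eval_Comp1[OF G f, of T] by (simp add: M_def k_def)
  then have halts: "halts c k \<longleftrightarrow> \<not> Q M" using c by fastforce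
  show False
  proof (cases "halts c k")
    case True
    then obtain h where "fst (trace_ctl c K k h) = []" using halts_iff_trace[OF K(2)] by blast
    then have h: "trace_ctl c K k h \<in> ?H" using H by blast
    have "accepts k x" if x: "\<forall>i. x i < 4" for x
    proof -
      interpret input_word K ?p0 "ctl_next K" ctl_op ?H ?P k "trace_block c K k" "trace_ctl c K k" x h
        by unfold_locales (use x h in auto)
      show ?thesis by (rule halting_accepts)
    qed
    then have "bca_lang M = topspace (cantor (alph M))" unfolding lang alph topspace_cantor by blast
    then show False using full halts True by blast
  next
    case False
    have nh: "trace_ctl c K k i \<notin> ?H" for i
      unfolding H using False halts_iff_trace[OF K(2), of c k] by simp
    have "\<not> borel_in (cantor 4) (bca_lang M)"
    proof (rule ordered_words_not_borel[of "trace_block c K k"])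
      fix T :: "nat list set" assume closed: "\<And>s t. s @ t \<in> T \<Longrightarrow> s \<in> T"
      interpret lin: nat_linorder "tree_less T" by (rule nat_linorder_tree_less)
      interpret ordered_word K ?p0 "ctl_next K" ctl_op ?H ?P k "trace_block c K k" "trace_ctl c K k" "tree_less T"
        by unfold_locales (rule nh)
      have rk: "rk = tree_rank T" by (simp add: fun_eq_iff rk_def tree_rank_def)
      have "accepts k (word (trace_block c K k) (tree_rank T)) \<longleftrightarrow>
        (\<exists>a::nat \<Rightarrow> nat. \<forall>i. tree_less T (a (Suc i)) (a i))"
      proof
        assume "accepts k (word (trace_block c K k) (tree_rank T))"
        then show "\<exists>a::nat \<Rightarrow> nat. \<forall>i. tree_less T (a (Suc i)) (a i)"
          using accepts_imp_ill_founded unfolding rk by blast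
      next
        assume "\<exists>a::nat \<Rightarrow> nat. \<forall>i. tree_less T (a (Suc i)) (a i)"
        then obtain a :: "nat \<Rightarrow> nat" where a: "\<forall>i. tree_less T (a (Suc i)) (a i)" by blast
        have "tree_less T e 0" if "e \<noteq> 0" for e using tree_less_top[OF a closed that] .
        then show "accepts k (word (trace_block c K k) (tree_rank T))"
          using ill_founded_imp_accepts[of a] a unfolding rk by blast
      qed
      then show "word (trace_block c K k) (tree_rank T) \<in> bca_lang M \<longleftrightarrow>
        (\<exists>a::nat \<Rightarrow> nat. \<forall>i. tree_less T (a (Suc i)) (a i))"
        unfolding lang by (simp add: word_less)
    qed
    then show False using not_borel[of M] halts False by (simp add: alph)
  qed
qed

text \<open>The whole space is clopen and thus belongs to every class, while all members of the
  classes are Borel; so each property separates the two cases.\<close>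

theorem mainTheorem11:
  shows "\<not> decidable_bca (\<lambda>M. borel_in (cantor (alph M)) (bca_lang M)) \<and>
    (\<forall>r :: nat rel. Well_order r \<and> Field r \<noteq> {} \<longrightarrow>
       \<not> decidable_bca (\<lambda>M. Sigma0_class (cantor (alph M)) r (bca_lang M)) \<and>
       \<not> decidable_bca (\<lambda>M. Pi0_class (cantor (alph M)) r (bca_lang M)))"
proof (intro conjI allI impI)
  show "\<not> decidable_bca (\<lambda>M. borel_in (cantor (alph M)) (bca_lang M))"
    by (rule undecidable_if_separates) (auto simp: borel_in_def intro: sigma_sets_top)
next
  fix r :: "nat rel" assume r: "Well_order r \<and> Field r \<noteq> {}"
  show "\<not> decidable_bca (\<lambda>M. Sigma0_class (cantor (alph M)) r (bca_lang M))"
    by (rule undecidable_if_separates)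
       (use r in \<open>auto intro: Sigma0_class_trivial dest: Sigma0_class_borel\<close>)
  show "\<not> decidable_bca (\<lambda>M. Pi0_class (cantor (alph M)) r (bca_lang M))"
  proof (rule undecidable_if_separates)
    show "Pi0_class (cantor (alph M)) r (bca_lang M)" if "bca_lang M = topspace (cantor (alph M))" for M
      unfolding Pi0_class_def that using r by (auto intro: Sigma0_class_trivial)
  qed (use Pi0_class_borel in blast)
qed

end
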